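(* Let $\Sigma$ be an irreducible reduced root system with base $\Pi$ and highest root $\mu^+$, and let $W_\Delta$ be the Weyl group of the root system $\Delta$ of type $\mathrm{BC}_2$, with $s_1,s_2$ the simple reflections. Suppose $(S,T)\in\mathrm{SPA}(\Pi)$. Put $$\breve S=\sigma_{\Pi\setminus T}(S\setminus T)\ \cup\ \{\lambda\in T:\chi_{S\setminus T}(\tilde w_{\Pi\setminus T}(\lambda))+\chi_{S\cap T}(\lambda)=1\},$$ $$\bar T=\sigma_{\Pi\setminus S}(T\setminus S)\ \cup\ \{\lambda\in S\setminus T:\mathrm{supp}_\Pi(\tilde w_{\Pi\setminus S}(\lambda))\cap(T\setminus S)=\emptyset\}.$$ Then the elements $u*(S,T)$, $u\in W_\Delta=\{\pm1,\pm s_1,\pm s_2,\pm s_2s_1\}$, are: $1*(S,T)=(S,T)$; $s_1*(S,T)=(\breve S,T)$; $s_2*(S,T)=(S,\bar T)$; $(s_2s_1)*(S,T)=(\breve S,\bar T\cdot\sigma_\Pi)$; $(-1)*(S,T)=(S\cdot\sigma_\Pi,T\cdot\sigma_\Pi)$; $(-s_1)*(S,T)=(\breve S\cdot\sigma_\Pi,T\cdot\sigma_\Pi)$; $(-s_2)*(S,T)=(S\cdot\sigma_\Pi,\bar T\cdot\sigma_\Pi)$; $(-s_2s_1)*(S,T)=(\breve S\cdot\sigma_\Pi,\bar T)$. Moreover, $$\breve S=\begin{cases}S&\text{if }\chi_{S\setminus T}(\mu^+)=0,\\ \sigma_{\Pi\setminus T}(S\setminus T)\cup(T\setminus S)&\text{if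 }\chi_{S\setminus T}(\mu^+)=1,\\ \sigma_{\Pi\setminus T}(S\setminus T)&\text{if }\chi_{S\setminus T}(\mu^+)=2,\end{cases}$$ and $$\bar T=\begin{cases}S\setminus T&\text{if }T\subseteq S,\\ \{\sigma_{\Pi\setminus S}(\mu),\lambda\}&\text{if (ex) holds},\\ \sigma_{\Pi\setminus S}(T\setminus S)&\text{otherwise},\end{cases}$$ where (ex) is the condition: $\Pi$ has type $\mathrm A_n$ with $n\ge3$, and there exist distinct $\lambda,\lambda',\mu\in\Pi$ such that $S=\{\lambda,\lambda'\}$, $T=\{\mu\}$, and $\lambda'$ lies between $\lambda$ and $\mu$ on the Dynkin diagram of $\Pi$.
   Context: $Q_\Sigma$ is the root lattice and $W_\Sigma$ the Weyl group of $\Sigma$. For $S\subseteq\Pi$, $\chi_S\in\mathrm{Hom}(Q_\Sigma,\mathbb Z)$ is $1$ on $S$ and $0$ on $\Pi\setminus S$; $\chi_{(S,T)}=(\chi_S,\chi_T)\in\mathrm{Hom}(Q_\Sigma,\mathbb Z^2)$. $\mathrm{supp}_\Pi(\sum_{\gamma\in\Pi}n_\gamma\gamma)=\{\gamma\in\Pi:n_\gamma\neq0\}$. $\Delta=\{\pm\alpha_1,\pm\alpha_2,\pm(\alpha_1+\alpha_2),\pm2\alpha_1,\pm(2\alpha_1+\alpha_2),\pm(2\alpha_1+2\alpha_2)\}$ is the root system of type $\mathrm{BC}_2$ with base $\{\alpha_1,\alpha_2\}$, root lattice identified with $\mathbb Z^2$ via this base, and $s_i=s_{\alpha_i}$; so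 $s_1\alpha_1=-\alpha_1$, $s_1\alpha_2=2\alpha_1+\alpha_2$, $s_2\alpha_1=\alpha_1+\alpha_2$, $s_2\alpha_2=-\alpha_2$. $W_\Delta$ is dihedral of order 8. $\mathrm{SPA}(\Pi)$ (SP-admissible pairs) is the set of pairs $(S,T)$ of subsets of $\Pi$ such that $\chi_{(S,T)}(\Sigma)\subseteq\Delta\cup\{0\}$ and $\chi_{(S,T)}(\Sigma)$ contains one of $\pm\alpha_1,\pm(\alpha_1+\alpha_2)$. For $u\in W_\Delta$ and $(S,T)\in\mathrm{SPA}(\Pi)$, the set $\{u\circ\chi_{(S,T)}\circ w:w\in W_\Sigma\}$ contains exactly one element $\rho$ with $\rho(\Pi)\subseteq\Delta^+\cup\{0\}$; this $\rho$ equals $\chi_{(S',T')}$ for a unique $(S',T')\in\mathrm{SPA}(\Pi)$, and $u*(S,T):=(S',T')$ (a left action of $W_\Delta$ on $\mathrm{SPA}(\Pi)$). For $X\subseteq\Pi$ nonempty, $\Sigma_X=\Sigma\cap\mathrm{span}_{\mathbb R}(X)$ is a root system with base $X$; $w_X$ is the longest element of its Weyl group $W_X$ relative to $X$ (the unique element with $w_X(\Sigma_X^+)=-\Sigma_X^+$), and $\sigma_X=-w_X|_X$, a diagram automorphism of $X$ with $\sigma_X^2=1$. If $X=\emptyset$, $w_X=1$, $\sigma_X=1$. $\tilde w_X\in W_\Sigma$ is the extension of $w_X$ that fixes every vector orthogonal to $\mathrm{span}_{\mathbb R}(X)$. For $\varphi\in\mathrm{Aut}(\Pi)$ and $S\subseteq\Pi$,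 $S\cdot\varphi=\varphi^{-1}(S)$. *)

theory Defs
  imports "HOL-Analysis.Analysis"
begin

section \<open>Root systems\<close>

text \<open>A root system here is a root system in its own real span, which need not be the whole
  ambient space; so the subsystems \<open>\<Sigma> \<inter> span X\<close> are covered without changing the type.
  The ambient inner product restricts to a Weyl-invariant one on the span.\<close>

definition cartan :: "'a::euclidean_space \<Rightarrow> 'a \<Rightarrow> real" where
  "cartan x \<beta> = 2 * (x \<bullet> \<beta>) / (\<beta> \<bullet> \<beta>)"

definition root_refl :: "'a::euclidean_space \<Rightarrow> 'a \<Rightarrow> 'a" where
  "root_refl \<beta> x = x - cartan x \<beta> *\<^sub>R \<beta>"

definition root_system :: "'a::euclidean_space set \<Rightarrow> bool" where
  "root_system \<Sigma> \<longleftrightarrow> finite \<Sigma> \<and> 0 \<notin> \<Sigma> \<and>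
     (\<forall>\<beta>\<in>\<Sigma>. root_refl \<beta> ` \<Sigma> = \<Sigma>) \<and> (\<forall>\<alpha>\<in>\<Sigma>. \<forall>\<beta>\<in>\<Sigma>. cartan \<alpha> \<beta> \<in> \<int>)"

definition reduced_roots :: "'a::euclidean_space set \<Rightarrow> bool" where
  "reduced_roots \<Sigma> \<longleftrightarrow> (\<forall>\<beta>\<in>\<Sigma>. \<forall>c. c *\<^sub>R \<beta> \<in> \<Sigma> \<longrightarrow> c = 1 \<or> c = -1)"

definition irreducible_roots :: "'a::euclidean_space set \<Rightarrow> bool" where
  "irreducible_roots \<Sigma> \<longleftrightarrow> \<Sigma> \<noteq> {} \<and>
     \<not> (\<exists>A C. A \<noteq> {} \<and> C \<noteq> {} \<and> A \<union> C = \<Sigma> \<and> (\<forall>x\<in>A. \<forall>y\<in>C. x \<bullet> y = 0))"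

definition is_base :: "'a::euclidean_space set \<Rightarrow> 'a set \<Rightarrow> bool" where
  "is_base \<Sigma> B \<longleftrightarrow> B \<subseteq> \<Sigma> \<and> independent B \<and>
     (\<forall>\<beta>\<in>\<Sigma>. \<exists>c :: 'a \<Rightarrow> int. \<beta> = (\<Sum>\<gamma>\<in>B. of_int (c \<gamma>) *\<^sub>R \<gamma>) \<and>
        ((\<forall>\<gamma>\<in>B. c \<gamma> \<ge> 0) \<or> (\<forall>\<gamma>\<in>B. c \<gamma> \<le> 0)))"

definition pos_roots :: "'a::euclidean_space set \<Rightarrow> 'a set \<Rightarrow> 'a set" where
  "pos_roots \<Sigma> B = {\<beta>\<in>\<Sigma>. \<forall>\<gamma>\<in>B. representation B \<beta> \<gamma> \<ge> 0}"

definition highest_root :: "'a::euclidean_space set \<Rightarrow> 'a set \<Rightarrow> 'a \<Rightarrow> bool" where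
  "highest_root \<Sigma> B \<mu> \<longleftrightarrow> \<mu> \<in> \<Sigma> \<and>
     (\<forall>\<beta>\<in>\<Sigma>. \<forall>\<gamma>\<in>B. representation B \<beta> \<gamma> \<le> representation B \<mu> \<gamma>)"

definition root_lattice :: "'a::euclidean_space set \<Rightarrow> 'a set" where
  "root_lattice \<Sigma> = {(\<Sum>\<beta>\<in>\<Sigma>. of_int (c \<beta>) *\<^sub>R \<beta>) | c :: 'a \<Rightarrow> int. True}"

definition root_supp :: "'a::euclidean_space set \<Rightarrow> 'a \<Rightarrow> 'a set" where
  "root_supp B x = {\<gamma>\<in>B. representation B x \<gamma> \<noteq> 0}"

text \<open>Weyl group elements are maps of the ambient space, trivial on the orthogonal complement of
  the roots. As reflections are involutions, closing under composition with them on the left gives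
  the generated group.\<close>

inductive_set weyl_group :: "('a::euclidean_space) set \<Rightarrow> ('a \<Rightarrow> 'a) set"
  for \<Sigma> :: "'a set" where
  weyl_id: "id \<in> weyl_group \<Sigma>"
| weyl_refl: "\<lbrakk>\<beta> \<in> \<Sigma>; w \<in> weyl_group \<Sigma>\<rbrakk> \<Longrightarrow> root_refl \<beta> \<circ> w \<in> weyl_group \<Sigma>"

text \<open>For a subset \<open>X\<close> of a base of \<open>\<Sigma>\<close>, \<open>long_elt \<Sigma> X\<close> is \<open>w\<^sub>X\<close>; only its values on \<open>span X\<close> are
  used. For empty \<open>X\<close> it is the identity, the group being trivial.\<close>

definition long_elt :: "'a::euclidean_space set \<Rightarrow> 'a set \<Rightarrow> 'a \<Rightarrow> 'a" where
  "long_elt \<Sigma> X = (THE w. w \<in> weyl_group (\<Sigma> \<inter> span X) \<and>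
     w ` pos_roots (\<Sigma> \<inter> span X) X = uminus ` pos_roots (\<Sigma> \<inter> span X) X)"

definition diag_aut :: "'a::euclidean_space set \<Rightarrow> 'a set \<Rightarrow> 'a \<Rightarrow> 'a" where
  "diag_aut \<Sigma> X \<gamma> = - long_elt \<Sigma> X \<gamma>"

text \<open>The image under \<open>diag_aut \<Sigma> {}\<close> is only ever taken of the empty set.\<close>

definition long_elt_ext :: "'a::euclidean_space set \<Rightarrow> 'a set \<Rightarrow> 'a \<Rightarrow> 'a" where
  "long_elt_ext \<Sigma> X = (THE w. w \<in> weyl_group \<Sigma> \<and> (\<forall>x\<in>span X. w x = long_elt \<Sigma> X x) \<and>
     (\<forall>x. (\<forall>y\<in>span X. x \<bullet> y = 0) \<longrightarrow> w x = x))"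

definition base_act :: "'a set \<Rightarrow> 'a set \<Rightarrow> ('a \<Rightarrow> 'a) \<Rightarrow> 'a set" where
  "base_act B S \<phi> = {\<gamma>\<in>B. \<phi> \<gamma> \<in> S}"

definition type_A :: "'a::euclidean_space set \<Rightarrow> nat \<Rightarrow> bool" where
  "type_A B n \<longleftrightarrow> (\<exists>\<gamma>s. distinct \<gamma>s \<and> set \<gamma>s = B \<and> length \<gamma>s = n \<and>
     (\<forall>i<n. \<forall>j<n. cartan (\<gamma>s ! i) (\<gamma>s ! j) =
        (if i = j then 2 else if i = j + 1 \<or> j = i + 1 then -1 else 0)))"

text \<open>\<open>y\<close> is an interior vertex of a simple path from \<open>x\<close> to \<open>z\<close> in the Dynkin diagram; the
  diagram is a forest, so that path is unique.\<close>

definition dynkin_adj :: "'a::euclidean_space \<Rightarrow> 'a \<Rightarrow> bool" where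
  "dynkin_adj x y \<longleftrightarrow> x \<noteq> y \<and> x \<bullet> y \<noteq> 0"

definition dynkin_between :: "'a::euclidean_space set \<Rightarrow> 'a \<Rightarrow> 'a \<Rightarrow> 'a \<Rightarrow> bool" where
  "dynkin_between B x y z \<longleftrightarrow> y \<noteq> x \<and> y \<noteq> z \<and>
     (\<exists>p. p \<noteq> [] \<and> distinct p \<and> set p \<subseteq> B \<and> successively dynkin_adj p \<and>
          hd p = x \<and> last p = z \<and> y \<in> set p)"

section \<open>The root system of type BC2\<close>

text \<open>Elements of the root lattice of \<open>\<Delta>\<close> are pairs of integers: \<open>(a, b)\<close> stands for
  \<open>a \<alpha>\<^sub>1 + b \<alpha>\<^sub>2\<close>.\<close>

definition BC2_pos :: "(int \<times> int) set" where
  "BC2_pos = {(1,0), (0,1), (1,1), (2,0), (2,1), (2,2)}"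

definition BC2 :: "(int \<times> int) set" where
  "BC2 = BC2_pos \<union> uminus ` BC2_pos"

text \<open>The linear maps with \<open>s\<^sub>1 \<alpha>\<^sub>1 = -\<alpha>\<^sub>1\<close>, \<open>s\<^sub>1 \<alpha>\<^sub>2 = 2\<alpha>\<^sub>1 + \<alpha>\<^sub>2\<close>, \<open>s\<^sub>2 \<alpha>\<^sub>1 = \<alpha>\<^sub>1 + \<alpha>\<^sub>2\<close>,
  \<open>s\<^sub>2 \<alpha>\<^sub>2 = -\<alpha>\<^sub>2\<close>.\<close>

definition BC2_s1 :: "int \<times> int \<Rightarrow> int \<times> int" where
  "BC2_s1 = (\<lambda>(a, b). (2 * b - a, b))"

definition BC2_s2 :: "int \<times> int \<Rightarrow> int \<times> int" where
  "BC2_s2 = (\<lambda>(a, b). (a, a - b))"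

inductive_set BC2_weyl :: "(int \<times> int \<Rightarrow> int \<times> int) set" where
  BC2_weyl_id: "id \<in> BC2_weyl"
| BC2_weyl_s1: "u \<in> BC2_weyl \<Longrightarrow> BC2_s1 \<circ> u \<in> BC2_weyl"
| BC2_weyl_s2: "u \<in> BC2_weyl \<Longrightarrow> BC2_s2 \<circ> u \<in> BC2_weyl"

section \<open>SP-admissible pairs\<close>

text \<open>Homomorphisms on the root lattice are extensional functions (undefined off the lattice), so
  that equality of functions is equality of homomorphisms. Base coordinates of lattice elements are
  integers, so the floor below is exact.\<close>

definition chi :: "'a::euclidean_space set \<Rightarrow> 'a set \<Rightarrow> 'a set \<Rightarrow> 'a \<Rightarrow> int" where
  "chi \<Sigma> B S = (\<lambda>x\<in>root_lattice \<Sigma>. \<Sum>\<gamma>\<in>S. \<lfloor>representation B x \<gamma>\<rfloor>)"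

lemma root_lattice_coords_int:
  assumes "root_system \<Sigma>" "is_base \<Sigma> B" "x \<in> root_lattice \<Sigma>"
  shows "representation B x \<gamma> \<in> \<int>" and "x \<in> span B"
proof -
  have ind: "independent B"
    using assms(2) by (simp add: is_base_def)
  have root: "representation B \<beta> \<gamma> \<in> \<int> \<and> \<beta> \<in> span B" if "\<beta> \<in> \<Sigma>" for \<beta>
  proof -
    have "\<forall>\<beta>\<in>\<Sigma>. \<exists>c :: 'a \<Rightarrow> int. \<beta> = (\<Sum>\<gamma>\<in>B. of_int (c \<gamma>) *\<^sub>R \<gamma>) \<and>
        ((\<forall>\<gamma>\<in>B. c \<gamma> \<ge> 0) \<or> (\<forall>\<gamma>\<in>B. c \<gamma> \<le> 0))"
      using assms(2) unfolding is_base_def by (elim conjE)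
    from bspec[OF this that] obtain c :: "'a \<Rightarrow> int"
      where c: "\<beta> = (\<Sum>\<gamma>\<in>B. of_int (c \<gamma>) *\<^sub>R \<gamma>)"
      by (elim exE conjE)
    have sp: "of_int (c v) *\<^sub>R v \<in> span B" if "v \<in> B" for v
      using that by (simp add: span_base span_scale)
    have "representation B \<beta> \<gamma> = (\<Sum>v\<in>B. representation B (of_int (c v) *\<^sub>R v) \<gamma>)"
      unfolding c by (subst representation_sum[OF ind]) (use sp in auto)
    also have "\<dots> = (\<Sum>v\<in>B. of_int (c v) * (if v = \<gamma> then 1 else 0))"
      using ind by (intro sum.cong refl)
        (auto simp: representation_scale representation_basis span_base)
    also have "\<dots> \<in> \<int>" by (intro Ints_sum) auto
    finally show ?thesis unfolding c using sp by (auto intro: span_sum)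
  qed
  obtain c :: "'a \<Rightarrow> int" where c: "x = (\<Sum>\<beta>\<in>\<Sigma>. of_int (c \<beta>) *\<^sub>R \<beta>)"
    using assms(3) unfolding root_lattice_def by blast
  have sp: "of_int (c v) *\<^sub>R v \<in> span B" if "v \<in> \<Sigma>" for v
    using root[OF that] by (simp add: span_scale)
  have "representation B x \<gamma> = (\<Sum>v\<in>\<Sigma>. representation B (of_int (c v) *\<^sub>R v) \<gamma>)"
    unfolding c by (subst representation_sum[OF ind]) (use sp in auto)
  also have "\<dots> = (\<Sum>v\<in>\<Sigma>. of_int (c v) * representation B v \<gamma>)"
    using ind root by (intro sum.cong refl) (auto simp: representation_scale)
  also have "\<dots> \<in> \<int>" using root by (intro Ints_sum Ints_mult) auto
  finally show "representation B x \<gamma> \<in> \<int>" .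
  show "x \<in> span B" unfolding c using sp by (auto intro: span_sum)
qed

lemma chi_add:
  assumes "root_system \<Sigma>" "is_base \<Sigma> B" "x \<in> root_lattice \<Sigma>" "y \<in> root_lattice \<Sigma>"
  shows "chi \<Sigma> B S (x + y) = chi \<Sigma> B S x + chi \<Sigma> B S y"
proof -
  have ind: "independent B" using assms(2) by (simp add: is_base_def)
  obtain c d :: "'a \<Rightarrow> int" where "x = (\<Sum>\<beta>\<in>\<Sigma>. of_int (c \<beta>) *\<^sub>R \<beta>)" "y = (\<Sum>\<beta>\<in>\<Sigma>. of_int (d \<beta>) *\<^sub>R \<beta>)"
    using assms(3,4) unfolding root_lattice_def by blast
  then have "x + y = (\<Sum>\<beta>\<in>\<Sigma>. of_int (c \<beta> + d \<beta>) *\<^sub>R \<beta>)"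
    by (simp add: scaleR_add_left sum.distrib)
  then have xy: "x + y \<in> root_lattice \<Sigma>"
    unfolding root_lattice_def mem_Collect_eq
    by (intro exI[of _ "\<lambda>\<beta>. c \<beta> + d \<beta>"]) auto
  have "\<lfloor>representation B (x + y) \<gamma>\<rfloor> = \<lfloor>representation B x \<gamma>\<rfloor> + \<lfloor>representation B y \<gamma>\<rfloor>" for \<gamma>
    using root_lattice_coords_int[OF assms(1,2,3)] root_lattice_coords_int[OF assms(1,2,4)] ind
    by (simp add: representation_add floor_add2)
  then show ?thesis using assms(3,4) xy by (simp add: chi_def sum.distrib)
qed

lemma chi_base:
  assumes "root_system \<Sigma>" "is_base \<Sigma> B" "S \<subseteq> B" "\<gamma> \<in> B"
  shows "chi \<Sigma> B S \<gamma> = (if \<gamma> \<in> S then 1 else 0)"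
proof -
  have ind: "independent B" and fin: "finite \<Sigma>" and B: "B \<subseteq> \<Sigma>"
    using assms(1,2) by (simp_all add: root_system_def is_base_def)
  have finS: "finite S" using assms(3) B fin by (meson finite_subset)
  have "\<gamma> \<in> \<Sigma>" using B assms(4) by blast
  have "(\<Sum>\<beta>\<in>\<Sigma>. of_int (if \<beta> = \<gamma> then 1 else 0) *\<^sub>R \<beta>) = (\<Sum>\<beta>\<in>\<Sigma>. if \<beta> = \<gamma> then \<beta> else 0)"
    by (rule sum.cong) auto
  also have "\<dots> = \<gamma>" using fin \<open>\<gamma> \<in> \<Sigma>\<close> by simp
  finally have "\<gamma> = (\<Sum>\<beta>\<in>\<Sigma>. of_int (if \<beta> = \<gamma> then 1 else 0) *\<^sub>R \<beta>)" by simp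
  then have "\<gamma> \<in> root_lattice \<Sigma>"
    unfolding root_lattice_def mem_Collect_eq
    by (intro exI[of _ "\<lambda>\<beta>. if \<beta> = \<gamma> then 1 else 0"]) auto
  then have "chi \<Sigma> B S \<gamma> = (\<Sum>v\<in>S. if v = \<gamma> then 1 else 0)"
    using ind assms(4) by (auto simp: chi_def representation_basis intro!: sum.cong)
  then show ?thesis using finS by simp
qed

definition chi_pair :: "'a::euclidean_space set \<Rightarrow> 'a set \<Rightarrow> 'a set \<times> 'a set \<Rightarrow> 'a \<Rightarrow> int \<times> int" where
  "chi_pair \<Sigma> B p = (\<lambda>x\<in>root_lattice \<Sigma>. (chi \<Sigma> B (fst p) x, chi \<Sigma> B (snd p) x))"

definition SPA :: "'a::euclidean_space set \<Rightarrow> 'a set \<Rightarrow> ('a set \<times> 'a set) set" where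
  "SPA \<Sigma> B = {(S, T). S \<subseteq> B \<and> T \<subseteq> B \<and> chi_pair \<Sigma> B (S, T) ` \<Sigma> \<subseteq> BC2 \<union> {0} \<and>
     chi_pair \<Sigma> B (S, T) ` \<Sigma> \<inter> {(1,0), -(1,0), (1,1), -(1,1)} \<noteq> {}}"

definition SPA_hom :: "'a::euclidean_space set \<Rightarrow> 'a set \<Rightarrow> (int \<times> int \<Rightarrow> int \<times> int) \<Rightarrow>
    'a set \<times> 'a set \<Rightarrow> 'a \<Rightarrow> int \<times> int" where
  "SPA_hom \<Sigma> B u p =
     (THE \<rho>. \<rho> \<in> {compose (root_lattice \<Sigma>) (u \<circ> chi_pair \<Sigma> B p) w | w. w \<in> weyl_group \<Sigma>} \<and>
            \<rho> ` B \<subseteq> BC2_pos \<union> {0})"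

definition SPA_act :: "'a::euclidean_space set \<Rightarrow> 'a set \<Rightarrow> (int \<times> int \<Rightarrow> int \<times> int) \<Rightarrow>
    'a set \<times> 'a set \<Rightarrow> 'a set \<times> 'a set" where
  "SPA_act \<Sigma> B u p = (THE q. q \<in> SPA \<Sigma> B \<and> chi_pair \<Sigma> B q = SPA_hom \<Sigma> B u p)"

definition breve_S :: "'a::euclidean_space set \<Rightarrow> 'a set \<Rightarrow> 'a set \<Rightarrow> 'a set \<Rightarrow> 'a set" where
  "breve_S \<Sigma> B S T = diag_aut \<Sigma> (B - T) ` (S - T) \<union>
     {\<gamma>\<in>T. chi \<Sigma> B (S - T) (long_elt_ext \<Sigma> (B - T) \<gamma>) + chi \<Sigma> B (S \<inter> T) \<gamma> = 1}"

definition bar_T :: "'a::euclidean_space set \<Rightarrow> 'a set \<Rightarrow> 'a set \<Rightarrow> 'a set \<Rightarrow> 'a set" where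
  "bar_T \<Sigma> B S T = diag_aut \<Sigma> (B - S) ` (T - S) \<union>
     {\<gamma>\<in>S - T. root_supp B (long_elt_ext \<Sigma> (B - S) \<gamma>) \<inter> (T - S) = {}}"

definition ex_cond :: "'a::euclidean_space set \<Rightarrow> 'a set \<Rightarrow> 'a set \<Rightarrow> 'a \<Rightarrow> 'a \<Rightarrow> 'a \<Rightarrow> bool" where
  "ex_cond B S T l l' m \<longleftrightarrow> (\<exists>n\<ge>3. type_A B n) \<and> distinct [l, l', m] \<and> {l, l', m} \<subseteq> B \<and>
     S = {l, l'} \<and> T = {m} \<and> dynkin_between B l l' m"

end

theory Submission
  imports Defs
begin

text \<open>A pair \<open>(S, T)\<close> is admissible iff \<open>\<chi> = (\<chi>\<^sub>S, \<chi>\<^sub>T)\<close> maps \<open>\<Sigma>\<close> into \<open>\<Delta> \<union> {0}\<close> and hits a short root.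
  A functional has at most one dominant element in its Weyl orbit, so \<open>u * (S, T)\<close> is known as soon as some
  \<open>w\<close> makes \<open>u \<circ> \<chi> \<circ> w\<close> nonnegative on the base; for \<open>s\<^sub>1\<close>, \<open>s\<^sub>2\<close> and \<open>-1\<close> the longest elements of
  \<open>\<Pi> - T\<close>, \<open>\<Pi> - S\<close> and \<open>\<Pi>\<close> do this.

  For the explicit forms, \<open>w\<^sub>X(\<gamma>)\<close> with \<open>\<gamma> \<notin> X\<close> is the largest root whose part outside \<open>X\<close> is \<open>\<gamma>\<close>, and sums
  along paths of the Dynkin diagram supply roots to compare it with. The new pair is again admissible, so at
  most two simple roots belong to each of its members, which leaves few possibilities. In the exceptional case
  an interior vertex of the diagram has coefficient 1 in the highest root; then its neighbours have coefficient
  1 as well, so all coefficients are 1, and the type is A.\<close>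

section \<open>Reflections and the Weyl group\<close>

text \<open>\<open>SPA_hom\<close> and \<open>SPA_act\<close> are definite descriptions, so each
  formula needs a Weyl element that produces the claimed pair together with the uniqueness of the
  dominant element. Uniqueness is a statement about real vectors: \<chi>_R is the pairing with a
  vector \<open>dual R\<close>, a linear u turns (\<chi>_S, \<chi>_T) into another pair of pairings,
  and each of the two can be treated alone, by the exchange argument on words in simple reflections.
  The obstacle on the other side is that nonnegative values on the base do not yet make a functional
  of the form \<chi>_R: the values must be 0 or 1, and the highest root and a short root are used
  for that. The same step yields the lower bound 1 for the value in the definition of breve S, on
  which the case distinction relies. The subsystem of a subset X of the base is an instance of the
  same locale, so one construction of the longest element serves \<Pi>, \<Pi> - T and \<Pi> - S; and
  since reflections act on the whole space, w_X and its extension are the same map.\<close>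

lemma root_refl_add: "root_refl \<beta> (x + y) = root_refl \<beta> x + root_refl \<beta> y"
  by (simp add: root_refl_def cartan_def inner_add_left add_divide_distrib algebra_simps)

lemma root_refl_scaleR: "root_refl \<beta> (c *\<^sub>R x) = c *\<^sub>R root_refl \<beta> x"
  by (simp add: root_refl_def cartan_def algebra_simps)

lemma linear_root_refl: "linear (root_refl \<beta>)"
  by (intro linearI root_refl_add root_refl_scaleR)

lemma root_refl_self: "\<beta> \<noteq> 0 \<Longrightarrow> root_refl \<beta> \<beta> = - \<beta>"
  by (simp add: root_refl_def cartan_def scaleR_2)

lemma root_refl_orthogonal: "x \<bullet> \<beta> = 0 \<Longrightarrow> root_refl \<beta> x = x"
  by (simp add: root_refl_def cartan_def)

lemma root_refl_inner: "root_refl \<beta> x \<bullet> root_refl \<beta> y = x \<bullet> y"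
proof (cases "\<beta> = 0")
  case False
  then have b: "\<beta> \<bullet> \<beta> \<noteq> 0" by simp
  show ?thesis unfolding root_refl_def cartan_def
    using b by (simp add: inner_diff_left inner_diff_right inner_commute divide_simps)
qed (simp add: root_refl_def)

lemma orthogonal_root_refl: "orthogonal_transformation (root_refl \<beta>)"
  by (simp add: orthogonal_transformation_def linear_root_refl root_refl_inner)

lemma root_refl_involutive [simp]: "root_refl \<beta> (root_refl \<beta> x) = x"
proof (cases "\<beta> = 0")
  case False
  then have b: "\<beta> \<bullet> \<beta> \<noteq> 0" by simp
  show ?thesis unfolding root_refl_def cartan_def
    using b by (simp add: inner_diff_left algebra_simps)
qed (simp add: root_refl_def)

lemma root_refl_comp_self: "root_refl \<beta> \<circ> root_refl \<beta> = id"
  by (simp add: fun_eq_iff)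

lemma root_refl_conj:
  assumes "orthogonal_transformation w"
  shows "root_refl (w \<beta>) (w x) = w (root_refl \<beta> x)"
proof -
  have "w x \<bullet> w \<beta> = x \<bullet> \<beta>" "w \<beta> \<bullet> w \<beta> = \<beta> \<bullet> \<beta>" and l: "linear w"
    using assms by (simp_all add: orthogonal_transformation_def)
  then show ?thesis
    by (simp add: root_refl_def cartan_def linear_diff[OF l] linear_scale[OF l])
qed

lemma orthogonal_weyl: "w \<in> weyl_group \<Phi> \<Longrightarrow> orthogonal_transformation w"
proof (induction rule: weyl_group.induct)
  case weyl_id
  then show ?case by (simp add: orthogonal_transformation_def linear_id[unfolded id_def] id_def)
qed (metis orthogonal_transformation_compose orthogonal_root_refl)

lemma weyl_comp:
  assumes "w \<in> weyl_group \<Phi>" and "w' \<in> weyl_group \<Phi>"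
  shows "w \<circ> w' \<in> weyl_group \<Phi>"
  using assms(1)
proof (induction rule: weyl_group.induct)
  case (weyl_refl \<beta> w)
  then show ?case unfolding comp_assoc by (intro weyl_group.weyl_refl)
qed (use assms(2) in simp)

lemma weyl_root_refl: "\<beta> \<in> \<Phi> \<Longrightarrow> root_refl \<beta> \<in> weyl_group \<Phi>"
  using weyl_group.weyl_refl[OF _ weyl_group.weyl_id] by simp

lemma weyl_inv_ex: "w \<in> weyl_group \<Phi> \<Longrightarrow> \<exists>v\<in>weyl_group \<Phi>. v \<circ> w = id \<and> w \<circ> v = id"
proof (induction rule: weyl_group.induct)
  case weyl_id
  then show ?case by (intro bexI[of _ id] weyl_group.weyl_id) simp
next
  case (weyl_refl \<beta> w)
  then obtain v where v: "v \<in> weyl_group \<Phi>" "v \<circ> w = id" "w \<circ> v = id" by blast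
  have "(v \<circ> root_refl \<beta>) \<circ> (root_refl \<beta> \<circ> w) = v \<circ> (root_refl \<beta> \<circ> root_refl \<beta>) \<circ> w"
       "(root_refl \<beta> \<circ> w) \<circ> (v \<circ> root_refl \<beta>) = root_refl \<beta> \<circ> (w \<circ> v) \<circ> root_refl \<beta>"
    by (simp_all add: comp_assoc)
  then show ?case using v weyl_comp[OF v(1) weyl_root_refl[OF weyl_refl(1)]]
    by (metis comp_id root_refl_comp_self)
qed

lemma weyl_obtain_inv:
  assumes "w \<in> weyl_group \<Phi>"
  obtains v where "v \<in> weyl_group \<Phi>" "\<And>x. v (w x) = x" "\<And>x. w (v x) = x"
  using weyl_inv_ex[OF assms] by (metis comp_apply id_apply)

lemma linear_weyl: "w \<in> weyl_group \<Phi> \<Longrightarrow> linear w"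
  using orthogonal_weyl orthogonal_transformation_linear by blast

lemma weyl_inner: "w \<in> weyl_group \<Phi> \<Longrightarrow> w x \<bullet> w y = x \<bullet> y"
  using orthogonal_weyl orthogonal_transformation_def by metis

lemma weyl_group_mono: "\<Phi> \<subseteq> \<Psi> \<Longrightarrow> w \<in> weyl_group \<Phi> \<Longrightarrow> w \<in> weyl_group \<Psi>"
  by (rotate_tac, induction rule: weyl_group.induct) (auto intro: weyl_group.intros)

lemma weyl_diff_in_span:
  "w \<in> weyl_group \<Phi> \<Longrightarrow> w x - x \<in> span \<Phi>"
proof (induction arbitrary: x rule: weyl_group.induct)
  case weyl_id
  then show ?case by (simp add: span_zero)
next
  case (weyl_refl \<beta> w)
  have "(root_refl \<beta> \<circ> w) x - x = (w x - x) - cartan (w x) \<beta> *\<^sub>R \<beta>"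
    by (simp add: root_refl_def)
  then show ?case using weyl_refl by (metis span_base span_diff span_scale)
qed

lemma weyl_fixes_orthogonal:
  "w \<in> weyl_group \<Phi> \<Longrightarrow> (\<forall>\<beta>\<in>\<Phi>. x \<bullet> \<beta> = 0) \<Longrightarrow> w x = x"
  by (induction rule: weyl_group.induct) (auto simp: root_refl_orthogonal)

section \<open>Coefficients with respect to the base, and positive roots\<close>

locale based_roots =
  fixes \<Phi> B :: "'a::euclidean_space set"
  assumes root_sys: "root_system \<Phi>" and reduced: "reduced_roots \<Phi>" and base: "is_base \<Phi> B"
begin

lemma finite_roots: "finite \<Phi>" and zero_notin: "0 \<notin> \<Phi>"
  and refl_image: "\<beta> \<in> \<Phi> \<Longrightarrow> root_refl \<beta> ` \<Phi> = \<Phi>"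
  and cartan_Ints: "\<alpha> \<in> \<Phi> \<Longrightarrow> \<beta> \<in> \<Phi> \<Longrightarrow> cartan \<alpha> \<beta> \<in> \<int>"
  using root_sys by (auto simp: root_system_def)

lemma base_subset: "B \<subseteq> \<Phi>" and indep: "independent B" and finite_base: "finite B"
  using base finite_roots by (auto simp: is_base_def intro: finite_subset)

lemma weyl_image: "w \<in> weyl_group \<Phi> \<Longrightarrow> w ` \<Phi> = \<Phi>"
proof (induction rule: weyl_group.induct)
  case (weyl_refl \<beta> w)
  then show ?case by (simp only: image_comp[symmetric] refl_image)
qed simp

lemma weyl_root: "w \<in> weyl_group \<Phi> \<Longrightarrow> \<beta> \<in> \<Phi> \<Longrightarrow> w \<beta> \<in> \<Phi>"
  using weyl_image by blast

lemma refl_root: "\<alpha> \<in> \<Phi> \<Longrightarrow> \<beta> \<in> \<Phi> \<Longrightarrow> root_refl \<alpha> \<beta> \<in> \<Phi>"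
  using refl_image by blast

lemma neg_root: "\<beta> \<in> \<Phi> \<Longrightarrow> - \<beta> \<in> \<Phi>"
  using refl_root[of \<beta> \<beta>] zero_notin root_refl_self[of \<beta>] by metis

text \<open>Only the pairing of \<open>dual R\<close> with \<open>span B\<close> is determined.\<close>

definition dual :: "'a set \<Rightarrow> 'a" where
  "dual R = (SOME v. \<forall>\<gamma>\<in>B. v \<bullet> \<gamma> = (if \<gamma> \<in> R then 1 else 0))"

lemma dual_base: "\<gamma> \<in> B \<Longrightarrow> dual R \<bullet> \<gamma> = (if \<gamma> \<in> R then 1 else 0)"
proof -
  obtain g :: "'a \<Rightarrow> real" where g: "linear g" "\<forall>\<gamma>\<in>B. g \<gamma> = (if \<gamma> \<in> R then 1 else 0)"
    using linear_independent_extend[OF indep, of "\<lambda>\<gamma>. if \<gamma> \<in> R then 1 else 0"] by metis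
  \<comment> \<open>The Riesz vector of the functional g.\<close>
  have "(\<Sum>b\<in>Basis. g b *\<^sub>R b) \<bullet> x = g x" for x
  proof -
    have "g x = g (\<Sum>b\<in>Basis. (x \<bullet> b) *\<^sub>R b)" by (simp add: euclidean_representation)
    also have "\<dots> = (\<Sum>b\<in>Basis. (x \<bullet> b) * g b)"
      by (simp add: linear_sum[OF g(1)] linear_scale[OF g(1)])
    finally show ?thesis by (simp add: inner_sum_right inner_commute[of _ x] mult.commute)
  qed
  then have "\<exists>v. \<forall>\<gamma>\<in>B. v \<bullet> \<gamma> = (if \<gamma> \<in> R then 1 else 0)" using g(2) by metis
  from someI_ex[OF this] show "\<gamma> \<in> B \<Longrightarrow> ?thesis" unfolding dual_def by blast
qed

lemma dual_representation:
  assumes "x \<in> span B" "\<gamma> \<in> B" shows "dual {\<gamma>} \<bullet> x = representation B x \<gamma>"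
proof -
  have "dual {\<gamma>} \<bullet> x = dual {\<gamma>} \<bullet> (\<Sum>b\<in>B. representation B x b *\<^sub>R b)"
    using sum_representation_eq[OF indep assms(1) finite_base subset_refl] by simp
  also have "\<dots> = (\<Sum>b\<in>B. representation B x b * (if b = \<gamma> then 1 else 0))"
    by (simp add: inner_sum_right dual_base)
  also have "\<dots> = (\<Sum>b\<in>B. if b = \<gamma> then representation B x b else 0)"
    by (rule sum.cong) auto
  also have "\<dots> = representation B x \<gamma>" using assms(2) finite_base by simp
  finally show ?thesis .
qed

lemma expand: "x \<in> span B \<Longrightarrow> (\<Sum>\<gamma>\<in>B. (dual {\<gamma>} \<bullet> x) *\<^sub>R \<gamma>) = x"
  using sum_representation_eq[OF indep _ finite_base subset_refl, of x]
  by (metis (no_types, lifting) dual_representation sum.cong)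

lemma inner_expand: "x \<in> span B \<Longrightarrow> v \<bullet> x = (\<Sum>\<gamma>\<in>B. (dual {\<gamma>} \<bullet> x) * (v \<bullet> \<gamma>))"
proof -
  assume "x \<in> span B"
  then have "v \<bullet> x = v \<bullet> (\<Sum>\<gamma>\<in>B. (dual {\<gamma>} \<bullet> x) *\<^sub>R \<gamma>)" by (simp add: expand)
  then show ?thesis by (simp add: inner_sum_right)
qed

lemma dual_sum:
  assumes "x \<in> span B" "R \<subseteq> B" shows "dual R \<bullet> x = (\<Sum>\<gamma>\<in>R. dual {\<gamma>} \<bullet> x)"
proof -
  have "dual R \<bullet> x = (\<Sum>\<gamma>\<in>B. if \<gamma> \<in> R then dual {\<gamma>} \<bullet> x else 0)"
    by (subst inner_expand[OF assms(1)]) (auto simp: dual_base intro!: sum.cong)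
  also have "\<dots> = (\<Sum>\<gamma>\<in>B \<inter> R. dual {\<gamma>} \<bullet> x)"
    using finite_base by (simp add: sum.inter_restrict)
  finally show ?thesis using assms(2) by (simp add: Int_absorb1)
qed

lemma span_eqI:
  assumes "x \<in> span B" "y \<in> span B" "\<And>\<gamma>. \<gamma> \<in> B \<Longrightarrow> dual {\<gamma>} \<bullet> x = dual {\<gamma>} \<bullet> y" shows "x = y"
  by (metis (no_types, lifting) assms expand sum.cong)

lemma root_span: "\<beta> \<in> \<Phi> \<Longrightarrow> \<beta> \<in> span B"
proof -
  assume "\<beta> \<in> \<Phi>"
  then obtain c :: "'a \<Rightarrow> int" where "\<beta> = (\<Sum>\<gamma>\<in>B. of_int (c \<gamma>) *\<^sub>R \<gamma>)"
    using base unfolding is_base_def by blast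
  then show ?thesis by (metis (no_types, lifting) span_base span_scale span_sum)
qed

lemma root_coeffs:
  assumes "\<beta> \<in> \<Phi>"
  obtains c :: "'a \<Rightarrow> int" where "\<And>\<gamma>. \<gamma> \<in> B \<Longrightarrow> dual {\<gamma>} \<bullet> \<beta> = of_int (c \<gamma>)"
    and "(\<forall>\<gamma>\<in>B. c \<gamma> \<ge> 0) \<or> (\<forall>\<gamma>\<in>B. c \<gamma> \<le> 0)"
proof -
  obtain c :: "'a \<Rightarrow> int" where c: "\<beta> = (\<Sum>\<gamma>\<in>B. of_int (c \<gamma>) *\<^sub>R \<gamma>)"
    and s: "(\<forall>\<gamma>\<in>B. c \<gamma> \<ge> 0) \<or> (\<forall>\<gamma>\<in>B. c \<gamma> \<le> 0)"
    using base assms unfolding is_base_def by blast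
  have "dual {\<gamma>} \<bullet> \<beta> = of_int (c \<gamma>)" if "\<gamma> \<in> B" for \<gamma>
  proof -
    have "dual {\<gamma>} \<bullet> \<beta> = (\<Sum>b\<in>B. of_int (c b) * (dual {\<gamma>} \<bullet> b))" by (subst c) (simp add: inner_sum_right)
    also have "\<dots> = (\<Sum>b\<in>B. if b = \<gamma> then of_int (c b) else 0)"
      by (rule sum.cong) (auto simp: dual_base)
    also have "\<dots> = of_int (c \<gamma>)" using that finite_base by simp
    finally show ?thesis .
  qed
  with s show ?thesis using that by blast
qed

lemma coeff_Ints: "\<beta> \<in> \<Phi> \<Longrightarrow> \<gamma> \<in> B \<Longrightarrow> dual {\<gamma>} \<bullet> \<beta> \<in> \<int>"
  by (metis Ints_of_int root_coeffs)

abbreviation "Pos \<equiv> pos_roots \<Phi> B"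

lemma Pos_iff: "\<beta> \<in> Pos \<longleftrightarrow> \<beta> \<in> \<Phi> \<and> (\<forall>\<gamma>\<in>B. dual {\<gamma>} \<bullet> \<beta> \<ge> 0)"
  using dual_representation root_span by (auto simp: pos_roots_def)

lemma Pos_root: "\<beta> \<in> Pos \<Longrightarrow> \<beta> \<in> \<Phi>" by (simp add: Pos_iff)

lemma Pos_cases: "\<beta> \<in> \<Phi> \<Longrightarrow> \<beta> \<in> Pos \<or> - \<beta> \<in> Pos"
proof -
  assume b: "\<beta> \<in> \<Phi>"
  then obtain c where "\<And>\<gamma>. \<gamma> \<in> B \<Longrightarrow> dual {\<gamma>} \<bullet> \<beta> = of_int (c \<gamma>)" "(\<forall>\<gamma>\<in>B. c \<gamma> \<ge> 0) \<or> (\<forall>\<gamma>\<in>B. c \<gamma> \<le> 0)"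
    using root_coeffs by metis
  then show ?thesis using b neg_root by (auto simp: Pos_iff)
qed

lemma Pos_if_coeff: "\<beta> \<in> \<Phi> \<Longrightarrow> \<gamma> \<in> B \<Longrightarrow> dual {\<gamma>} \<bullet> \<beta> > 0 \<Longrightarrow> \<beta> \<in> Pos"
  using Pos_cases[of \<beta>] by (fastforce simp: Pos_iff)

lemma Pos_not_neg: "\<beta> \<in> Pos \<Longrightarrow> - \<beta> \<notin> Pos"
proof
  assume "\<beta> \<in> Pos" "- \<beta> \<in> Pos"
  then have "dual {\<gamma>} \<bullet> \<beta> = 0" if "\<gamma> \<in> B" for \<gamma> using that by (fastforce simp: Pos_iff)
  then have "\<beta> = 0" using span_eqI[of \<beta> 0] root_span \<open>\<beta> \<in> Pos\<close> by (simp add: Pos_iff span_zero)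
  then show False using \<open>\<beta> \<in> Pos\<close> zero_notin by (simp add: Pos_iff)
qed

lemma base_Pos: "\<gamma> \<in> B \<Longrightarrow> \<gamma> \<in> Pos"
  using base_subset by (auto simp: Pos_iff dual_base)

text \<open>Reducedness enters here: a positive root supported at \<alpha> alone is a multiple of
  \<alpha>, hence \<alpha> or -\<alpha>, and positivity excludes the latter.\<close>

lemma Pos_other_coeff:
  assumes "\<beta> \<in> Pos" "\<alpha> \<in> B" "\<beta> \<noteq> \<alpha>"
  obtains \<gamma> where "\<gamma> \<in> B" "\<gamma> \<noteq> \<alpha>" "dual {\<gamma>} \<bullet> \<beta> > 0"
proof -
  have "\<exists>\<gamma>\<in>B. \<gamma> \<noteq> \<alpha> \<and> dual {\<gamma>} \<bullet> \<beta> > 0"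
  proof (rule ccontr)
    assume "\<not> ?thesis"
    then have z: "dual {\<gamma>} \<bullet> \<beta> = 0" if "\<gamma> \<in> B" "\<gamma> \<noteq> \<alpha>" for \<gamma>
      using that assms(1) by (force simp: Pos_iff)
    have "\<beta> = (dual {\<alpha>} \<bullet> \<beta>) *\<^sub>R \<alpha>"
      by (rule span_eqI) (use z assms root_span base_subset in
          \<open>auto simp: Pos_iff dual_base span_base span_scale\<close>)
    moreover from this have "dual {\<alpha>} \<bullet> \<beta> = 1 \<or> dual {\<alpha>} \<bullet> \<beta> = -1"
      using reduced assms Pos_root base_subset unfolding reduced_roots_def by (metis subsetD)
    ultimately show False using assms base_Pos Pos_not_neg by (metis scaleR_one scaleR_minus1_left)
  qed
  then show ?thesis using that by blast
qed

lemma simple_refl_coeff: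
  assumes "\<gamma> \<in> B" "\<alpha> \<in> B" "\<gamma> \<noteq> \<alpha>" shows "dual {\<gamma>} \<bullet> root_refl \<alpha> x = dual {\<gamma>} \<bullet> x"
  using assms by (simp add: root_refl_def inner_diff_right dual_base)

text \<open>The reflection in \<alpha> alters the coefficient at \<alpha> only, so a positive
  coefficient elsewhere survives, and a single positive coefficient makes a root positive.\<close>

lemma simple_refl_Pos:
  assumes "\<beta> \<in> Pos" "\<alpha> \<in> B" "\<beta> \<noteq> \<alpha>" shows "root_refl \<alpha> \<beta> \<in> Pos"
  using Pos_other_coeff[OF assms]
  by (metis Pos_if_coeff Pos_root assms(1,2) base_subset refl_root simple_refl_coeff subsetD)

lemma base_nonzero: "\<gamma> \<in> B \<Longrightarrow> \<gamma> \<noteq> 0" using base_subset zero_notin by blast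

text \<open>The reflection of \<alpha> in \<gamma> is a positive root, and its coefficient at
  \<gamma> is minus the Cartan number.\<close>

lemma base_obtuse:
  assumes "\<alpha> \<in> B" "\<gamma> \<in> B" "\<alpha> \<noteq> \<gamma>" shows "\<alpha> \<bullet> \<gamma> \<le> 0"
proof -
  have "root_refl \<gamma> \<alpha> \<in> Pos" using assms base_Pos simple_refl_Pos by blast
  then have "dual {\<gamma>} \<bullet> root_refl \<gamma> \<alpha> \<ge> 0" using assms by (simp add: Pos_iff)
  then have "cartan \<alpha> \<gamma> \<le> 0" using assms by (simp add: root_refl_def inner_diff_right dual_base)
  then show ?thesis using base_nonzero[OF assms(2)]
    by (metis cartan_def divide_le_0_iff inner_gt_zero_iff linorder_not_less mult_le_0_iff zero_less_numeral)
qed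

subsection \<open>Words in the simple reflections\<close>

text \<open>The head of the list is the reflection applied last, so reversing the list inverts the
  product.\<close>

primrec wprod :: "'a list \<Rightarrow> 'a \<Rightarrow> 'a" where
  "wprod [] = id"
| "wprod (\<alpha> # l) = root_refl \<alpha> \<circ> wprod l"

lemma wprod_append: "wprod (l @ m) = wprod l \<circ> wprod m"
  by (induction l) (auto simp: comp_assoc)

lemma wprod_rev: "wprod (rev l) (wprod l x) = x" "wprod l (wprod (rev l) x) = x"
proof -
  show "wprod (rev l) (wprod l x) = x" for l :: "'a list"
    by (induction l) (auto simp: wprod_append)
  from this[of "rev l"] show "wprod l (wprod (rev l) x) = x" by simp
qed

lemma wprod_weyl: "set l \<subseteq> B \<Longrightarrow> wprod l \<in> weyl_group \<Phi>"
  using base_subset by (induction l) (auto intro: weyl_group.intros)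

text \<open>The sum of the coefficients is the height, a natural number on positive roots, so
  \<open>nat\<close> and the floor lose nothing there. It is the measure of the induction that
  brings a root to a simple one.\<close>

lemma height_pos_less:
  assumes "\<beta> \<in> Pos" "\<alpha> \<in> B" "\<beta> \<bullet> \<alpha> > 0"
  shows "nat \<lfloor>\<Sum>\<gamma>\<in>B. dual {\<gamma>} \<bullet> root_refl \<alpha> \<beta>\<rfloor> < nat \<lfloor>\<Sum>\<gamma>\<in>B. dual {\<gamma>} \<bullet> \<beta>\<rfloor> \<or> \<beta> = \<alpha>"
proof (cases "\<beta> = \<alpha>")
  case False
  then have p: "root_refl \<alpha> \<beta> \<in> Pos" using assms simple_refl_Pos by blast
  have h: "\<exists>n::nat. (\<Sum>\<gamma>\<in>B. dual {\<gamma>} \<bullet> \<delta>) = real n" if "\<delta> \<in> Pos" for \<delta>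
  proof -
    have "(\<Sum>\<gamma>\<in>B. dual {\<gamma>} \<bullet> \<delta>) \<in> \<int>" "(\<Sum>\<gamma>\<in>B. dual {\<gamma>} \<bullet> \<delta>) \<ge> 0"
      using that coeff_Ints by (auto simp: Pos_iff intro!: Ints_sum sum_nonneg)
    then show ?thesis by (metis Ints_cases of_int_0_le_iff of_int_of_nat_eq zero_le_imp_eq_int)
  qed
  have "cartan \<beta> \<alpha> > 0" using assms base_nonzero by (simp add: cartan_def)
  have "(\<Sum>\<gamma>\<in>B. dual {\<gamma>} \<bullet> root_refl \<alpha> \<beta>) = (\<Sum>\<gamma>\<in>B. dual {\<gamma>} \<bullet> \<beta> - cartan \<beta> \<alpha> * (if \<gamma> = \<alpha> then 1 else 0))"
    by (rule sum.cong) (use assms in \<open>auto simp: root_refl_def inner_diff_right dual_base\<close>)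
  also have "\<dots> = (\<Sum>\<gamma>\<in>B. dual {\<gamma>} \<bullet> \<beta>) - cartan \<beta> \<alpha>"
    using finite_base assms by (simp add: sum_subtractf flip: sum_distrib_left)
  finally have "(\<Sum>\<gamma>\<in>B. dual {\<gamma>} \<bullet> root_refl \<alpha> \<beta>) < (\<Sum>\<gamma>\<in>B. dual {\<gamma>} \<bullet> \<beta>)"
    using \<open>cartan \<beta> \<alpha> > 0\<close> by simp
  then show ?thesis using h[OF p] h[OF assms(1)] by auto
qed simp

lemma Pos_conjugate_simple:
  "\<beta> \<in> Pos \<Longrightarrow> \<exists>l \<gamma>. set l \<subseteq> B \<and> \<gamma> \<in> B \<and> \<beta> = wprod l \<gamma>"
proof (induction "nat \<lfloor>\<Sum>\<gamma>\<in>B. dual {\<gamma>} \<bullet> \<beta>\<rfloor>" arbitrary: \<beta> rule: less_induct)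
  case less
  show ?case
  proof (cases "\<beta> \<in> B")
    case True
    then show ?thesis by (intro exI[of _ "[]"] exI[of _ \<beta>]) simp
  next
    case False
    \<comment> \<open>As \<beta> \<bullet> \<beta> > 0, some term of its expansion over the base is
      positive; the simple root of that term has positive inner product with \<beta>, and reflecting
      in it lowers the height.\<close>
    have "\<beta> \<noteq> 0" using less zero_notin Pos_root by blast
    then have "0 < \<beta> \<bullet> \<beta>" by simp
    also have "\<beta> \<bullet> \<beta> = (\<Sum>\<gamma>\<in>B. (dual {\<gamma>} \<bullet> \<beta>) * (\<beta> \<bullet> \<gamma>))"
      using inner_expand root_span Pos_root less by blast
    finally obtain \<alpha> where a: "\<alpha> \<in> B" "(dual {\<alpha>} \<bullet> \<beta>) * (\<beta> \<bullet> \<alpha>) > 0"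
      by (metis (no_types, lifting) sum_nonpos linorder_not_less)
    then have "\<beta> \<bullet> \<alpha> > 0" using less by (auto simp: Pos_iff zero_less_mult_iff dest!: bspec)
    then have "root_refl \<alpha> \<beta> \<in> Pos"
      "nat \<lfloor>\<Sum>\<gamma>\<in>B. dual {\<gamma>} \<bullet> root_refl \<alpha> \<beta>\<rfloor> < nat \<lfloor>\<Sum>\<gamma>\<in>B. dual {\<gamma>} \<bullet> \<beta>\<rfloor>"
      using height_pos_less[of \<beta> \<alpha>] simple_refl_Pos[of \<beta> \<alpha>] a less False by auto
    then obtain l \<gamma> where "set l \<subseteq> B" "\<gamma> \<in> B" "root_refl \<alpha> \<beta> = wprod l \<gamma>"
      using less.hyps by blast
    then show ?thesis using a by (intro exI[of _ "\<alpha> # l"] exI[of _ \<gamma>]) (auto, metis root_refl_involutive)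
  qed
qed

lemma root_conjugate_simple:
  assumes "\<beta> \<in> \<Phi>" shows "\<exists>l \<gamma>. set l \<subseteq> B \<and> \<gamma> \<in> B \<and> \<beta> = wprod l \<gamma>"
proof (cases "\<beta> \<in> Pos")
  case False
  then have "- \<beta> \<in> Pos" using Pos_cases assms by blast
  then obtain l \<gamma> where l: "set l \<subseteq> B" "\<gamma> \<in> B" "- \<beta> = wprod l \<gamma>" using Pos_conjugate_simple by blast
  \<comment> \<open>The extra letter sends \<gamma> to -\<gamma>, which turns a word for -\<beta>
    into one for \<beta>.\<close>
  have "wprod (l @ [\<gamma>]) \<gamma> = wprod l (- \<gamma>)"
    using l base_nonzero by (simp add: wprod_append root_refl_self)
  also have "\<dots> = \<beta>" using l linear_weyl[OF wprod_weyl[OF l(1)]] by (metis linear_neg minus_minus)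
  finally show ?thesis using l by (intro exI[of _ "l @ [\<gamma>]"] exI[of _ \<gamma>]) auto
qed (rule Pos_conjugate_simple)

text \<open>The group is generated by the reflections in all roots. Each root is a word l applied to
  a simple root \<gamma>, and its reflection is the conjugate of that in \<gamma>, so each generator
  becomes the word l, \<gamma>, reversed l.\<close>

lemma weyl_word: "w \<in> weyl_group \<Phi> \<Longrightarrow> \<exists>l. set l \<subseteq> B \<and> w = wprod l"
proof (induction rule: weyl_group.induct)
  case weyl_id
  show ?case by (intro exI[of _ "[]"]) simp
next
  case (weyl_refl \<beta> w)
  then obtain m where m: "set m \<subseteq> B" "w = wprod m" by blast
  obtain l \<gamma> where l: "set l \<subseteq> B" "\<gamma> \<in> B" "\<beta> = wprod l \<gamma>" using root_conjugate_simple weyl_refl by blast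
  have "root_refl \<beta> x = wprod (l @ [\<gamma>] @ rev l) x" for x
    using root_refl_conj[OF orthogonal_weyl[OF wprod_weyl[OF l(1)]], of \<gamma> "wprod (rev l) x"]
    by (simp add: wprod_append wprod_rev l)
  then have "root_refl \<beta> \<circ> w = wprod ((l @ [\<gamma>] @ rev l) @ m)"
    unfolding wprod_append[of _ m] m(2)[symmetric] by (simp add: fun_eq_iff)
  then show ?case using l m by (intro exI[of _ "(l @ [\<gamma>] @ rev l) @ m"]) auto
qed

text \<open>If the letters are applied to \<alpha> one by one from the left, \<alpha> must become
  negative at some letter, and a simple reflection makes no positive root negative but its own.
  Multiplying by the reflection in \<alpha> deletes that letter.\<close>

lemma strong_exchange:
  "set l \<subseteq> B \<Longrightarrow> \<alpha> \<in> Pos \<Longrightarrow> wprod (rev l) \<alpha> \<notin> Pos \<Longrightarrow>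
    \<exists>l'. length l' < length l \<and> set l' \<subseteq> B \<and> root_refl \<alpha> \<circ> wprod l = wprod l'"
proof (induction l arbitrary: \<alpha>)
  case (Cons a m)
  show ?case
  proof (cases "\<alpha> = a")
    case True
    then show ?thesis using Cons.prems by (intro exI[of _ m]) (auto simp: fun_eq_iff)
  next
    case False
    have "root_refl a \<alpha> \<in> Pos" using False Cons.prems simple_refl_Pos by simp
    moreover have "wprod (rev m) (root_refl a \<alpha>) \<notin> Pos" using Cons.prems by (simp add: wprod_append)
    ultimately obtain m' where m': "length m' < length m" "set m' \<subseteq> B"
      "root_refl (root_refl a \<alpha>) \<circ> wprod m = wprod m'"
      using Cons.IH[of "root_refl a \<alpha>"] Cons.prems(1) by (metis list.set_intros(2) subset_iff)
    have "root_refl \<alpha> (root_refl a x) = root_refl a (root_refl (root_refl a \<alpha>) x)" for x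
      using root_refl_conj[OF orthogonal_root_refl[of a], of \<alpha> "root_refl a x"] by simp
    then have "root_refl \<alpha> \<circ> wprod (a # m) = wprod (a # m')"
      using fun_cong[OF m'(3)] by (intro ext) simp
    moreover have "length (a # m') < length (a # m)" "set (a # m') \<subseteq> B" using m' Cons.prems by auto
    ultimately show ?thesis by blast
  qed
qed simp

lemma dominant_word_fixed:
  "set l \<subseteq> B \<Longrightarrow> (\<forall>\<gamma>\<in>B. v \<bullet> \<gamma> \<ge> 0) \<Longrightarrow> (\<forall>\<gamma>\<in>B. wprod l v \<bullet> \<gamma> \<ge> 0) \<Longrightarrow> wprod l v = v"
proof (induction "length l" arbitrary: l rule: less_induct)
  case less
  show ?case
  proof (cases l)
    case (Cons a m)
    show ?thesis
    proof (cases "wprod (rev m) a \<in> Pos")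
      case False
      then obtain m' where m': "length m' < length m" "set m' \<subseteq> B" "root_refl a \<circ> wprod m = wprod m'"
        using strong_exchange[of m a] less Cons base_Pos by auto
      then have "wprod l = wprod m'" using Cons by simp
      then show ?thesis using less m' Cons by simp
    next
      case True
      have a: "a \<in> B" and m: "set m \<subseteq> B" using less Cons by auto
      have "v \<bullet> wprod (rev m) a \<ge> 0"
        using True less.prems(2) inner_expand[of "wprod (rev m) a" v] root_span
        by (auto simp: Pos_iff intro!: sum_nonneg mult_nonneg_nonneg)
      moreover have "v \<bullet> wprod (rev m) a = wprod m v \<bullet> a"
        by (metis m weyl_inner wprod_rev(2) wprod_weyl)
      moreover have "wprod l v \<bullet> a = - (wprod m v \<bullet> a)"
      proof -
        have "wprod l v \<bullet> a = root_refl a (wprod m v) \<bullet> root_refl a (- a)"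
          using Cons base_nonzero[OF a] linear_neg[OF linear_root_refl[of a]]
          by (simp add: root_refl_self)
        then show ?thesis by (simp only: root_refl_inner) simp
      qed
      ultimately have z: "wprod m v \<bullet> a = 0" using less.prems(3) a by fastforce
      then have "wprod l v = wprod m v" using Cons root_refl_orthogonal by simp
      then show ?thesis using less m Cons by (metis impossible_Cons linorder_not_less)
    qed
  qed simp
qed

lemma dominant_weyl_fixed:
  assumes "w \<in> weyl_group \<Phi>" "\<And>\<gamma>. \<gamma> \<in> B \<Longrightarrow> v \<bullet> \<gamma> \<ge> 0" "\<And>\<gamma>. \<gamma> \<in> B \<Longrightarrow> w v \<bullet> \<gamma> \<ge> 0"
  shows "w v = v"
  using weyl_word[OF assms(1)] dominant_word_fixed assms(2,3) by blast

text \<open>For first letter a and rest m: if m^{-1} a were positive, the whole word would send this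
  root to -a. So it is negative, and the exchange shortens the word.\<close>

lemma weyl_Pos_id_word:
  "set l \<subseteq> B \<Longrightarrow> wprod l ` Pos \<subseteq> Pos \<Longrightarrow> wprod l = id"
proof (induction "length l" arbitrary: l rule: less_induct)
  case less
  show ?case
  proof (cases l)
    case (Cons a m)
    have a: "a \<in> B" and m: "set m \<subseteq> B" using less Cons by auto
    show ?thesis
    proof (cases "wprod (rev m) a \<in> Pos")
      case False
      then obtain m' where m': "length m' < length m" "set m' \<subseteq> B" "root_refl a \<circ> wprod m = wprod m'"
        using strong_exchange[of m a] less Cons base_Pos by auto
      then have "wprod l = wprod m'" using Cons by simp
      then show ?thesis using less m' Cons by simp
    next
      case True
      then have "wprod l (wprod (rev m) a) \<in> Pos" using less by blast
      moreover have "wprod l (wprod (rev m) a) = - a"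
        using Cons base_nonzero[OF a] by (simp add: wprod_rev root_refl_self)
      ultimately show ?thesis using base_Pos[OF a] Pos_not_neg by simp
    qed
  qed simp
qed

lemma weyl_Pos_id: "w \<in> weyl_group \<Phi> \<Longrightarrow> w ` Pos \<subseteq> Pos \<Longrightarrow> w = id"
  using weyl_word weyl_Pos_id_word by blast

end

context based_roots
begin

subsection \<open>The longest element\<close>

lemma weyl_coeff: "x \<in> span B \<Longrightarrow> w \<in> weyl_group \<Phi> \<Longrightarrow> v \<bullet> w x = (\<Sum>\<gamma>\<in>B. (dual {\<gamma>} \<bullet> x) * (v \<bullet> w \<gamma>))"
proof -
  assume x: "x \<in> span B" and w: "w \<in> weyl_group \<Phi>"
  have "v \<bullet> w x = v \<bullet> w (\<Sum>\<gamma>\<in>B. (dual {\<gamma>} \<bullet> x) *\<^sub>R \<gamma>)" using x by (simp add: expand)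
  then show ?thesis
    by (simp add: linear_sum[OF linear_weyl[OF w]] linear_scale[OF linear_weyl[OF w]] inner_sum_right)
qed

lemma finite_Pos: "finite Pos"
  using finite_roots by (simp add: pos_roots_def)

text \<open>Among all w take one that keeps the fewest positive roots positive. If a simple root
  \<alpha> stayed positive, w composed with the reflection in \<alpha> would keep fewer, because
  that reflection permutes the other positive roots. So every simple root, hence every positive one,
  becomes negative.\<close>

lemma longest_exists: "\<exists>w\<in>weyl_group \<Phi>. w ` Pos = uminus ` Pos"
proof -
  define N where "N w = {\<beta>\<in>Pos. w \<beta> \<in> Pos}" for w :: "'a \<Rightarrow> 'a"
  obtain w where w: "w \<in> weyl_group \<Phi>" and
    min: "\<And>w'. w' \<in> weyl_group \<Phi> \<Longrightarrow> card (N w) \<le> card (N w')"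
    using ex_has_least_nat[of "\<lambda>w. w \<in> weyl_group \<Phi>" id "\<lambda>w. card (N w)"] weyl_group.weyl_id by metis
  have lw: "linear w" and iw: "inj w"
    using linear_weyl[OF w] orthogonal_transformation_inj[OF orthogonal_weyl[OF w]] by auto
  have neg: "- w \<alpha> \<in> Pos" if a: "\<alpha> \<in> B" for \<alpha>
  proof (rule ccontr)
    assume "- w \<alpha> \<notin> Pos"
    then have wa: "w \<alpha> \<in> Pos" using Pos_cases weyl_root[OF w] a base_subset by blast
    define w' where "w' = w \<circ> root_refl \<alpha>"
    have w': "w' \<in> weyl_group \<Phi>" unfolding w'_def using w a base_subset by (intro weyl_comp weyl_root_refl) auto
    have "root_refl \<alpha> ` N w' \<subseteq> N w - {\<alpha>}"
    proof
      fix x assume "x \<in> root_refl \<alpha> ` N w'"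
      then obtain \<beta> where b: "x = root_refl \<alpha> \<beta>" "\<beta> \<in> Pos" "w (root_refl \<alpha> \<beta>) \<in> Pos"
        by (auto simp: N_def w'_def)
      have "\<beta> \<noteq> \<alpha>"
      proof
        assume "\<beta> = \<alpha>"
        then have "w (root_refl \<alpha> \<beta>) = - w \<alpha>" using base_nonzero[OF a] lw by (simp add: root_refl_self linear_neg)
        then show False using b(3) wa Pos_not_neg by simp
      qed
      moreover have "root_refl \<alpha> \<beta> \<noteq> \<alpha>"
      proof
        assume "root_refl \<alpha> \<beta> = \<alpha>"
        then have "\<beta> = - \<alpha>" using root_refl_involutive[of \<alpha> \<beta>] base_nonzero[OF a] by (simp add: root_refl_self)
        then show False using b(2) Pos_not_neg base_Pos[OF a] by blast
      qed
      ultimately show "x \<in> N w - {\<alpha>}" using b simple_refl_Pos[of \<beta> \<alpha>] a by (simp add: N_def)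
    qed
    moreover have fin: "finite (N w)" using finite_Pos by (simp add: N_def)
    moreover have "inj (root_refl \<alpha>)" by (metis injI root_refl_involutive)
    ultimately have "card (N w') \<le> card (N w - {\<alpha>})"
      by (metis card_image card_mono finite_Diff inj_on_subset subset_UNIV)
    also have "\<dots> < card (N w)" using fin wa base_Pos[OF a] by (intro psubset_card_mono) (auto simp: N_def)
    finally show False using min[OF w'] by simp
  qed
  have "- w \<beta> \<in> Pos" if b: "\<beta> \<in> Pos" for \<beta>
  proof -
    have "dual {\<delta>} \<bullet> w \<beta> \<le> 0" if "\<delta> \<in> B" for \<delta>
    proof -
      have "dual {\<delta>} \<bullet> w \<beta> = (\<Sum>\<gamma>\<in>B. (dual {\<gamma>} \<bullet> \<beta>) * (dual {\<delta>} \<bullet> w \<gamma>))"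
        using weyl_coeff w b Pos_root root_span by blast
      also have "\<dots> \<le> 0"
        using neg b that by (intro sum_nonpos mult_nonneg_nonpos) (auto simp: Pos_iff)
      finally show ?thesis .
    qed
    then show ?thesis using neg_root weyl_root[OF w] b by (simp add: Pos_iff)
  qed
  then have sub: "w ` Pos \<subseteq> uminus ` Pos" by force
  moreover have "card (w ` Pos) = card (uminus ` Pos)"
    using iw by (simp add: card_image inj_on_subset[OF iw])
  ultimately have "w ` Pos = uminus ` Pos"
    using finite_Pos by (intro card_subset_eq) auto
  then show ?thesis using w by blast
qed

lemma longest_unique:
  assumes "w \<in> weyl_group \<Phi>" "w ` Pos = uminus ` Pos" "w' \<in> weyl_group \<Phi>" "w' ` Pos = uminus ` Pos"
  shows "w' = w"
proof -
  obtain v where v: "v \<in> weyl_group \<Phi>" "\<And>x. v (w x) = x" "\<And>x. w (v x) = x"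
    using weyl_obtain_inv assms(1) by blast
  have "(v \<circ> w') ` Pos = v ` (w ` Pos)" using assms(2,4) by (simp only: image_comp[symmetric])
  also have "\<dots> = Pos" using v by (simp add: image_image)
  finally have "v \<circ> w' = id" using weyl_Pos_id[OF weyl_comp[OF v(1) assms(3)]] by simp
  then have "v (w' x) = x" for x by (metis comp_apply id_apply)
  then show ?thesis using v(3) by (metis ext)
qed

text \<open>Written with the same description as \<open>long_elt\<close>, so that interpreting the
  locale for the roots in span X identifies the two by unfolding.\<close>

definition w0 :: "'a \<Rightarrow> 'a" where
  "w0 = (THE w. w \<in> weyl_group \<Phi> \<and> w ` Pos = uminus ` Pos)"

lemma w0: "w0 \<in> weyl_group \<Phi>" "w0 ` Pos = uminus ` Pos"
proof -
  have "\<exists>!w. w \<in> weyl_group \<Phi> \<and> w ` Pos = uminus ` Pos"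
    using longest_exists by (auto intro: longest_unique)
  from theI'[OF this] have "w0 \<in> weyl_group \<Phi> \<and> w0 ` Pos = uminus ` Pos" unfolding w0_def .
  then show "w0 \<in> weyl_group \<Phi>" "w0 ` Pos = uminus ` Pos" by auto
qed

lemma w0_Pos: "\<beta> \<in> Pos \<Longrightarrow> - w0 \<beta> \<in> Pos"
  using w0(2) by force

lemma w0_minus: "w0 (- x) = - w0 x"
  using linear_neg linear_weyl w0(1) by blast

lemma w0_w0: "w0 (w0 x) = x"
proof -
  have "(w0 \<circ> w0) ` Pos \<subseteq> Pos"
  proof
    fix x assume "x \<in> (w0 \<circ> w0) ` Pos"
    then obtain y where "y \<in> Pos" "x = w0 (w0 y)" by auto
    then show "x \<in> Pos" using w0_Pos[OF w0_Pos[of y]] by (simp add: w0_minus)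
  qed
  then have "w0 \<circ> w0 = id" using weyl_Pos_id[OF weyl_comp[OF w0(1) w0(1)]] by blast
  then show ?thesis by (metis comp_apply id_apply)
qed

text \<open>Put \<beta> = -w0 \<gamma>, so that \<gamma> = -w0 \<beta>. Expanding \<beta> over the
  base, all terms of -w0 \<beta> are nonnegative and nothing cancels, so each simple root in the
  support of \<beta> goes to \<gamma> under -w0. As w0 is an involution, that simple root is
  \<beta>.\<close>

lemma w0_base: assumes g: "\<gamma> \<in> B" shows "- w0 \<gamma> \<in> B"
proof -
  define \<beta> where "\<beta> = - w0 \<gamma>"
  have b: "\<beta> \<in> Pos" using w0_Pos base_Pos g by (simp add: \<beta>_def)
  then have "\<beta> \<noteq> 0" using zero_notin Pos_root by blast
  then obtain \<epsilon> where e: "\<epsilon> \<in> B" "dual {\<epsilon>} \<bullet> \<beta> \<noteq> 0"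
    using span_eqI[of \<beta> 0] root_span Pos_root b by (auto simp: span_zero)
  then have epos: "dual {\<epsilon>} \<bullet> \<beta> > 0" using b by (force simp: Pos_iff)
  have "- w0 \<epsilon> = \<gamma>"
  proof (rule ccontr)
    assume ne: "- w0 \<epsilon> \<noteq> \<gamma>"
    obtain \<zeta> where z: "\<zeta> \<in> B" "\<zeta> \<noteq> \<gamma>" "dual {\<zeta>} \<bullet> (- w0 \<epsilon>) > 0"
      using Pos_other_coeff[OF w0_Pos[OF base_Pos[OF e(1)]] g ne] by blast
    have "\<gamma> = - w0 \<beta>" by (simp add: \<beta>_def w0_minus w0_w0)
    then have "- (dual {\<zeta>} \<bullet> \<gamma>) = dual {\<zeta>} \<bullet> w0 \<beta>" by simp
    also have "\<dots> = (\<Sum>\<delta>\<in>B. (dual {\<delta>} \<bullet> \<beta>) * (dual {\<zeta>} \<bullet> w0 \<delta>))"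
      using weyl_coeff w0(1) root_span b Pos_root by blast
    also have "\<dots> < 0"
    proof -
      have le: "(dual {\<delta>} \<bullet> \<beta>) * (dual {\<zeta>} \<bullet> w0 \<delta>) \<le> 0" if "\<delta> \<in> B" for \<delta>
        using b w0_Pos[OF base_Pos[OF that]] that z(1) by (intro mult_nonneg_nonpos) (auto simp: Pos_iff)
      moreover have "(dual {\<epsilon>} \<bullet> \<beta>) * (dual {\<zeta>} \<bullet> w0 \<epsilon>) < 0"
        using epos z(3) by (simp add: mult_pos_neg)
      ultimately have "(\<Sum>\<delta>\<in>B. (dual {\<delta>} \<bullet> \<beta>) * (dual {\<zeta>} \<bullet> w0 \<delta>)) < (\<Sum>\<delta>\<in>B. 0)"
        using e(1) finite_base by (intro sum_strict_mono_ex1) auto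
      then show ?thesis by simp
    qed
    finally show False using z g by (simp add: dual_base)
  qed
  then have "\<epsilon> = - w0 \<gamma>" by (metis minus_minus w0_minus w0_w0)
  then show ?thesis using e by simp
qed

subsection \<open>Parabolic subsystems\<close>

lemma dual_span_zero:
  assumes "x \<in> span X" "X \<subseteq> B" "R \<inter> X = {}" shows "dual R \<bullet> x = 0"
proof -
  show ?thesis
  proof (rule span_induct[OF assms(1), of "\<lambda>x. dual R \<bullet> x = 0"])
    show "dual R \<bullet> x = 0" if "x \<in> X" for x
    proof -
      have "x \<in> B" "x \<notin> R" using that assms(2,3) by blast+
      then show ?thesis by (simp add: dual_base)
    qed
  qed (simp add: subspace_hyperplane)
qed

lemma span_subI:
  assumes "x \<in> span B" "X \<subseteq> B" "\<And>\<gamma>. \<gamma> \<in> B - X \<Longrightarrow> dual {\<gamma>} \<bullet> x = 0" shows "x \<in> span X"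
proof -
  have "x = (\<Sum>\<gamma>\<in>X. (dual {\<gamma>} \<bullet> x) *\<^sub>R \<gamma>)"
    using expand[OF assms(1)] sum.mono_neutral_right[OF finite_base assms(2), of "\<lambda>\<gamma>. (dual {\<gamma>} \<bullet> x) *\<^sub>R \<gamma>"]
      assms(3) by simp
  then show ?thesis by (metis (no_types, lifting) span_base span_scale span_sum)
qed

text \<open>This makes the results on longest elements available for X. A root in span X has
  coefficient 0 outside X, so its integral expansion over B is already one over X.\<close>

lemma sub_based_roots: assumes X: "X \<subseteq> B" shows "based_roots (\<Phi> \<inter> span X) X"
proof
  have "root_refl \<beta> ` (\<Phi> \<inter> span X) = \<Phi> \<inter> span X" if b: "\<beta> \<in> \<Phi> \<inter> span X" for \<beta>
  proof -
    have sub: "root_refl \<beta> x \<in> \<Phi> \<inter> span X" if "x \<in> \<Phi> \<inter> span X" for x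
      using that b refl_root[of \<beta> x] by (simp add: root_refl_def span_diff span_scale)
    moreover have "x \<in> root_refl \<beta> ` (\<Phi> \<inter> span X)" if "x \<in> \<Phi> \<inter> span X" for x
      using sub[OF that] root_refl_involutive[of \<beta> x] by (metis imageI)
    ultimately show ?thesis by blast
  qed
  then show "root_system (\<Phi> \<inter> span X)"
    using finite_roots zero_notin cartan_Ints by (simp add: root_system_def)
  show "reduced_roots (\<Phi> \<inter> span X)"
    using reduced by (auto simp: reduced_roots_def)
  have "\<exists>c :: 'a \<Rightarrow> int. \<beta> = (\<Sum>\<gamma>\<in>X. of_int (c \<gamma>) *\<^sub>R \<gamma>) \<and> ((\<forall>\<gamma>\<in>X. c \<gamma> \<ge> 0) \<or> (\<forall>\<gamma>\<in>X. c \<gamma> \<le> 0))"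
    if b: "\<beta> \<in> \<Phi> \<inter> span X" for \<beta>
  proof -
    obtain c where c: "\<And>\<gamma>. \<gamma> \<in> B \<Longrightarrow> dual {\<gamma>} \<bullet> \<beta> = of_int (c \<gamma>)" "(\<forall>\<gamma>\<in>B. c \<gamma> \<ge> 0) \<or> (\<forall>\<gamma>\<in>B. c \<gamma> \<le> 0)"
      using root_coeffs b by blast
    have z: "c i = 0" if "i \<in> B - X" for i
      using dual_span_zero[of \<beta> X "{i}"] b X c(1)[of i] that by auto
    have "\<beta> = (\<Sum>\<gamma>\<in>B. of_int (c \<gamma>) *\<^sub>R \<gamma>)"
      using expand[OF root_span, of \<beta>] b c(1) by simp
    also have "\<dots> = (\<Sum>\<gamma>\<in>X. of_int (c \<gamma>) *\<^sub>R \<gamma>)"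
    proof (rule sum.mono_neutral_right[OF finite_base X])
      show "\<forall>i\<in>B - X. real_of_int (c i) *\<^sub>R i = 0"
        using z by simp
    qed
    finally show ?thesis using c(2) X by blast
  qed
  then show "is_base (\<Phi> \<inter> span X) X"
    using X base_subset independent_mono[OF indep X] by (auto simp: is_base_def span_base)
qed

context
  fixes X assumes X: "X \<subseteq> B"
begin

interpretation sub: based_roots "\<Phi> \<inter> span X" X by (rule sub_based_roots[OF X])

lemma long_elt_w0: "long_elt \<Phi> X = sub.w0"
  by (simp only: long_elt_def sub.w0_def)

lemma long_elt_weyl: "long_elt \<Phi> X \<in> weyl_group \<Phi>"
  using weyl_group_mono[OF _ sub.w0(1)] by (simp add: long_elt_w0)

lemma long_elt_long_elt [simp]: "long_elt \<Phi> X (long_elt \<Phi> X x) = x"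
  by (simp add: long_elt_w0 sub.w0_w0)

lemma long_elt_diff_span: "long_elt \<Phi> X x - x \<in> span X"
proof -
  have "span (\<Phi> \<inter> span X) \<subseteq> span X" by (simp add: span_minimal)
  then show ?thesis
    using weyl_diff_in_span[OF sub.w0(1), of x] unfolding long_elt_w0 by blast
qed

lemma diag_aut_base: "\<gamma> \<in> X \<Longrightarrow> diag_aut \<Phi> X \<gamma> \<in> X"
  by (simp add: diag_aut_def long_elt_w0 sub.w0_base)

lemma diag_aut_diag_aut: "diag_aut \<Phi> X (diag_aut \<Phi> X \<gamma>) = \<gamma>"
  by (simp add: diag_aut_def long_elt_w0 sub.w0_minus sub.w0_w0)

lemma long_elt_neg: "long_elt \<Phi> X \<gamma> = - diag_aut \<Phi> X \<gamma>"
  by (simp add: diag_aut_def)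

text \<open>Elements of \<open>weyl_group\<close> act on the whole space and fix what is orthogonal
  to the roots, so w_X is its own extension. Uniqueness follows by splitting a vector into its part
  in span X and an orthogonal part.\<close>

lemma long_elt_ext_eq: "long_elt_ext \<Phi> X = long_elt \<Phi> X"
  unfolding long_elt_ext_def
proof (rule the_equality)
  have c0: "long_elt \<Phi> X x = x" if "\<forall>y\<in>span X. x \<bullet> y = 0" for x
    unfolding long_elt_w0 by (rule weyl_fixes_orthogonal[OF sub.w0(1)]) (use that in blast)
  then show "long_elt \<Phi> X \<in> weyl_group \<Phi> \<and> (\<forall>x\<in>span X. long_elt \<Phi> X x = long_elt \<Phi> X x) \<and>
      (\<forall>x. (\<forall>y\<in>span X. x \<bullet> y = 0) \<longrightarrow> long_elt \<Phi> X x = x)"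
    using long_elt_weyl by blast
  fix w assume w: "w \<in> weyl_group \<Phi> \<and> (\<forall>x\<in>span X. w x = long_elt \<Phi> X x) \<and>
      (\<forall>x. (\<forall>y\<in>span X. x \<bullet> y = 0) \<longrightarrow> w x = x)"
  show "w = long_elt \<Phi> X"
  proof
    fix x
    obtain y z where y: "y \<in> span X" and z: "\<And>u. u \<in> span X \<Longrightarrow> orthogonal z u" and x: "x = y + z"
      using orthogonal_subspace_decomp_exists[of X x] by metis
    have "\<forall>u\<in>span X. z \<bullet> u = 0" using z by (simp add: orthogonal_def)
    then have "w z = z" "long_elt \<Phi> X z = z" using w c0[of z] by auto
    moreover have "w y = long_elt \<Phi> X y" using w y by auto
    moreover have "linear w" "linear (long_elt \<Phi> X)"
      using linear_weyl[of w] linear_weyl[OF long_elt_weyl] w by auto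
    ultimately show "w x = long_elt \<Phi> X x" by (simp add: x linear_add)
  qed
qed

lemma dual_long_elt: "R \<inter> X = {} \<Longrightarrow> dual R \<bullet> long_elt \<Phi> X x = dual R \<bullet> x"
  using dual_span_zero[OF long_elt_diff_span X, of R x] by (simp add: inner_diff_right)

lemma long_elt_base_Pos: "\<gamma> \<in> B - X \<Longrightarrow> long_elt \<Phi> X \<gamma> \<in> Pos"
  using Pos_if_coeff[of "long_elt \<Phi> X \<gamma>" \<gamma>] dual_long_elt[of "{\<gamma>}" \<gamma>] weyl_root[OF long_elt_weyl] base_subset
  by (auto simp: dual_base)

text \<open>The root w_X \<beta> has the coefficients of \<beta> outside X, among them 1 at
  \<gamma>, so it is positive, and w_X \<beta> - \<gamma> is a nonnegative combination of X.
  Applying w_X, which makes X negative, shows that \<beta> - w_X \<gamma> is nonpositive.\<close>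

lemma long_elt_highest:
  assumes b: "\<beta> \<in> \<Phi>" and g: "\<gamma> \<in> B - X" and e: "\<And>\<delta>. \<delta> \<in> B - X \<Longrightarrow> dual {\<delta>} \<bullet> \<beta> = (if \<delta> = \<gamma> then 1 else 0)"
    and d: "\<delta> \<in> B"
  shows "dual {\<delta>} \<bullet> \<beta> \<le> dual {\<delta>} \<bullet> long_elt \<Phi> X \<gamma>"
proof -
  let ?w = "long_elt \<Phi> X"
  have lw: "linear ?w" by (rule linear_weyl[OF long_elt_weyl])
  define \<eta> where "\<eta> = ?w \<beta> - \<gamma>"
  have "?w \<beta> \<in> \<Phi>" by (rule weyl_root[OF long_elt_weyl b])
  moreover have c: "dual {\<epsilon>} \<bullet> ?w \<beta> = (if \<epsilon> = \<gamma> then 1 else 0)" if "\<epsilon> \<in> B - X" for \<epsilon>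
    using dual_long_elt[of "{\<epsilon>}" \<beta>] e that by auto
  ultimately have wb: "?w \<beta> \<in> Pos" using Pos_if_coeff[of "?w \<beta>" \<gamma>] g by simp
  have "\<eta> \<in> span X"
  proof (rule span_subI[OF _ X])
    show "\<eta> \<in> span B" unfolding \<eta>_def using root_span[OF Pos_root[OF wb]] g by (intro span_diff) (auto intro: span_base)
    show "dual {\<epsilon>} \<bullet> \<eta> = 0" if "\<epsilon> \<in> B - X" for \<epsilon>
      using c[OF that] that g by (simp add: \<eta>_def inner_diff_right dual_base)
  qed
  moreover have "dual {\<epsilon>} \<bullet> \<eta> \<ge> 0" if "\<epsilon> \<in> X" for \<epsilon>
    using wb that X g by (auto simp: \<eta>_def inner_diff_right dual_base Pos_iff)
  ultimately have "dual {\<delta>} \<bullet> ?w \<eta> \<le> 0"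
  proof -
    assume 1: "\<eta> \<in> span X" and 2: "\<And>\<epsilon>. \<epsilon> \<in> X \<Longrightarrow> dual {\<epsilon>} \<bullet> \<eta> \<ge> 0"
    have "dual {\<delta>} \<bullet> ?w \<eta> = (\<Sum>\<epsilon>\<in>B. (dual {\<epsilon>} \<bullet> \<eta>) * (dual {\<delta>} \<bullet> ?w \<epsilon>))"
      using weyl_coeff[OF _ long_elt_weyl, of \<eta>] 1 span_mono[OF X] by blast
    also have "\<dots> \<le> 0"
    proof (rule sum_nonpos)
      fix \<epsilon> assume "\<epsilon> \<in> B"
      show "(dual {\<epsilon>} \<bullet> \<eta>) * (dual {\<delta>} \<bullet> ?w \<epsilon>) \<le> 0"
      proof (cases "\<epsilon> \<in> X")
        case True
        then have "diag_aut \<Phi> X \<epsilon> \<in> B" using diag_aut_base X by blast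
        then show ?thesis using 2[OF True] d by (auto simp: long_elt_neg dual_base mult_nonneg_nonpos)
      next
        case False
        then show ?thesis using dual_span_zero[OF 1 X, of "{\<epsilon>}"] by simp
      qed
    qed
    finally show ?thesis .
  qed
  moreover have "?w \<eta> = \<beta> - ?w \<gamma>" by (simp add: \<eta>_def linear_diff[OF lw])
  ultimately show ?thesis by (simp add: inner_diff_right)
qed

end

end

section \<open>The action on admissible pairs\<close>

text \<open>In the coordinates \<open>x = b\<close>, \<open>y = a - b\<close> the set \<open>BC2 \<union> {0}\<close> is the set of integer points
  with \<open>\<bar>x\<bar> + \<bar>y\<bar> \<le> 2\<close>, \<open>BC2_s1\<close> changes the sign of \<open>y\<close>, and \<open>BC2_s2\<close> swaps \<open>x\<close> and \<open>y\<close>.\<close>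

lemma BC2_iff: "(a, b) \<in> BC2 \<union> {0} \<longleftrightarrow> \<bar>b\<bar> + \<bar>a - b\<bar> \<le> 2"
proof -
  have "BC2 \<union> {0} = {(1,0), (0,1), (1,1), (2,0), (2,1), (2,2), (-1,0), (0,-1), (-1,-1), (-2,0),
      (-2,-1), (-2,-2), (0,0)}"
    by (auto simp: BC2_def BC2_pos_def zero_prod_def)
  note eq = this
  show ?thesis
  proof
    assume "(a, b) \<in> BC2 \<union> {0}"
    then show "\<bar>b\<bar> + \<bar>a - b\<bar> \<le> 2"
      unfolding eq by (elim insertE emptyE) simp_all
  next
    assume h: "\<bar>b\<bar> + \<bar>a - b\<bar> \<le> 2"
    then have "b = -2 \<or> b = -1 \<or> b = 0 \<or> b = 1 \<or> b = 2" by linarith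
    moreover from h have "a - b = -2 \<or> a - b = -1 \<or> a - b = 0 \<or> a - b = 1 \<or> a - b = 2" by linarith
    ultimately show "(a, b) \<in> BC2 \<union> {0}"
      unfolding eq diff_eq_eq using h by (elim disjE) simp_all
  qed
qed

lemma BC2_pos_iff: "x \<in> BC2_pos \<union> {0} \<longleftrightarrow> x \<in> BC2 \<union> {0} \<and> fst x \<ge> 0 \<and> snd x \<ge> 0"
proof -
  obtain a b where x: "x = (a, b)" by fastforce
  have eq: "BC2_pos \<union> {0} = {(1,0), (0,1), (1,1), (2,0), (2,1), (2,2), (0,0)}"
    by (auto simp: BC2_pos_def zero_prod_def)
  show ?thesis unfolding x BC2_iff fst_conv snd_conv
  proof
    assume "(a, b) \<in> BC2_pos \<union> {0}"
    then show "\<bar>b\<bar> + \<bar>a - b\<bar> \<le> 2 \<and> a \<ge> 0 \<and> b \<ge> 0"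
      unfolding eq by (elim insertE emptyE) simp_all
  next
    assume h: "\<bar>b\<bar> + \<bar>a - b\<bar> \<le> 2 \<and> a \<ge> 0 \<and> b \<ge> 0"
    then have "a = 0 \<or> a = 1 \<or> a = 2" "b = 0 \<or> b = 1 \<or> b = 2" by linarith+
    then show "(a, b) \<in> BC2_pos \<union> {0}"
      unfolding eq using h by (elim disjE) simp_all
  qed
qed

definition BC2_short :: "(int \<times> int) set" where
  "BC2_short = {(1,0), -(1,0), (1,1), -(1,1)}"

text \<open>In the coordinates x, y the short roots are plus or minus the unit vectors. Within |x| +
  |y| \<le> 2 they are the points with x + y = a odd; this parity later rules out the value 2 on the
  base.\<close>

lemma BC2_short_iff: "(a, b) \<in> BC2_short \<longleftrightarrow> \<bar>a\<bar> = 1 \<and> \<bar>b\<bar> + \<bar>a - b\<bar> \<le> 2"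
proof -
  have eq: "BC2_short = {(1,0), (-1,0), (1,1), (-1,-1)}" by (auto simp: BC2_short_def)
  show ?thesis
  proof
    assume "(a, b) \<in> BC2_short"
    then show "\<bar>a\<bar> = 1 \<and> \<bar>b\<bar> + \<bar>a - b\<bar> \<le> 2"
      unfolding eq by (elim insertE emptyE) simp_all
  next
    assume h: "\<bar>a\<bar> = 1 \<and> \<bar>b\<bar> + \<bar>a - b\<bar> \<le> 2"
    then have "a = 1 \<or> a = -1" by linarith
    moreover from h have "b = -1 \<or> b = 0 \<or> b = 1" by linarith
    ultimately show "(a, b) \<in> BC2_short"
      unfolding eq using h by (elim disjE) simp_all
  qed
qed

lemma BC2_weyl_props:
  assumes "u \<in> BC2_weyl"
  shows BC2_weyl_linear: "\<exists>p q r s. \<forall>a b. u (a, b) = (p * a + q * b, r * a + s * b)"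
    and BC2_weyl_BC2: "x \<in> BC2 \<union> {0} \<Longrightarrow> u x \<in> BC2 \<union> {0}"
    and BC2_weyl_short: "x \<in> BC2_short \<Longrightarrow> u x \<in> BC2_short"
proof -
  show "\<exists>p q r s. \<forall>a b. u (a, b) = (p * a + q * b, r * a + s * b)" using assms
  proof (induction rule: BC2_weyl.induct)
    case BC2_weyl_id
    show ?case by (intro exI[of _ 1] exI[of _ 0]) (simp; intro exI[of _ 0] exI[of _ 1]; simp)
  next
    case (BC2_weyl_s1 u)
    then obtain p q r s where "\<forall>a b. u (a, b) = (p * a + q * b, r * a + s * b)" by blast
    then show ?case
      by (intro exI[of _ "2 * r - p"] exI[of _ "2 * s - q"] exI[of _ r] exI[of _ s])
        (simp add: BC2_s1_def algebra_simps)
  next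
    case (BC2_weyl_s2 u)
    then obtain p q r s where "\<forall>a b. u (a, b) = (p * a + q * b, r * a + s * b)" by blast
    then show ?case
      by (intro exI[of _ p] exI[of _ q] exI[of _ "p - r"] exI[of _ "q - s"])
        (simp add: BC2_s2_def algebra_simps)
  qed
  have s1: "BC2_s1 y \<in> BC2 \<union> {0}" "y \<in> BC2_short \<Longrightarrow> BC2_s1 y \<in> BC2_short" if "y \<in> BC2 \<union> {0}" for y
    using that by (cases y; simp only: BC2_s1_def case_prod_conv BC2_iff BC2_short_iff; arith)+
  have s2: "BC2_s2 y \<in> BC2 \<union> {0}" "y \<in> BC2_short \<Longrightarrow> BC2_s2 y \<in> BC2_short" if "y \<in> BC2 \<union> {0}" for y
    using that by (cases y; simp only: BC2_s2_def case_prod_conv BC2_iff BC2_short_iff; arith)+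
  have sh: "y \<in> BC2 \<union> {0}" if "y \<in> BC2_short" for y
    using that by (cases y) (simp only: BC2_iff BC2_short_iff)
  show "x \<in> BC2 \<union> {0} \<Longrightarrow> u x \<in> BC2 \<union> {0}" using assms
    by (induction rule: BC2_weyl.induct) (use s1 s2 in \<open>simp_all only: id_apply comp_apply\<close>)
  show "x \<in> BC2_short \<Longrightarrow> u x \<in> BC2_short" using assms
    by (induction rule: BC2_weyl.induct) (use s1 s2 sh in \<open>simp_all only: id_apply comp_apply\<close>)
qed

lemma BC2_weyl_eq:
  "BC2_weyl = {id, uminus, BC2_s1, uminus \<circ> BC2_s1, BC2_s2, uminus \<circ> BC2_s2,
     BC2_s2 \<circ> BC2_s1, uminus \<circ> (BC2_s2 \<circ> BC2_s1)}" (is "_ = ?R")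
proof
  note d = fun_eq_iff BC2_s1_def BC2_s2_def
  \<comment> \<open>Both tables come from s_1 and s_2 being involutions with (s_1 s_2)^2 = -1, that
    is, s_1 s_2 = -s_2 s_1, and from -1 being central.\<close>
  have s1: "BC2_s1 \<circ> id = BC2_s1" "BC2_s1 \<circ> uminus = uminus \<circ> BC2_s1" "BC2_s1 \<circ> BC2_s1 = id"
    "BC2_s1 \<circ> (uminus \<circ> BC2_s1) = uminus" "BC2_s1 \<circ> BC2_s2 = uminus \<circ> (BC2_s2 \<circ> BC2_s1)"
    "BC2_s1 \<circ> (uminus \<circ> BC2_s2) = BC2_s2 \<circ> BC2_s1"
    "BC2_s1 \<circ> (BC2_s2 \<circ> BC2_s1) = uminus \<circ> BC2_s2" "BC2_s1 \<circ> (uminus \<circ> (BC2_s2 \<circ> BC2_s1)) = BC2_s2"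
    by (auto simp: d)
  have s2: "BC2_s2 \<circ> id = BC2_s2" "BC2_s2 \<circ> uminus = uminus \<circ> BC2_s2" "BC2_s2 \<circ> BC2_s2 = id"
    "BC2_s2 \<circ> (uminus \<circ> BC2_s2) = uminus" "BC2_s2 \<circ> (uminus \<circ> BC2_s1) = uminus \<circ> (BC2_s2 \<circ> BC2_s1)"
    "BC2_s2 \<circ> (BC2_s2 \<circ> BC2_s1) = BC2_s1" "BC2_s2 \<circ> (uminus \<circ> (BC2_s2 \<circ> BC2_s1)) = uminus \<circ> BC2_s1"
    by (auto simp: d)
  show "BC2_weyl \<subseteq> ?R"
  proof
    fix u assume "u \<in> BC2_weyl"
    then show "u \<in> ?R"
    proof (induction rule: BC2_weyl.induct)
      case (BC2_weyl_s1 u)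
      then show ?case by (elim insertE emptyE) (simp_all only: s1 insert_iff simp_thms)
    next
      case (BC2_weyl_s2 u)
      then show ?case by (elim insertE emptyE) (simp_all only: s2 insert_iff simp_thms)
    qed simp
  qed
  note I = BC2_weyl.intros
  have 1: "BC2_s1 \<in> BC2_weyl" "BC2_s2 \<in> BC2_weyl"
    using I(2)[OF I(1)] I(3)[OF I(1)] by (simp_all only: comp_id)
  have 2: "BC2_s2 \<circ> BC2_s1 \<in> BC2_weyl" using I(3) 1 by blast
  \<comment> \<open>The signs are reached through -s_2 = s_1 s_2 s_1, then -1 = s_2 (-s_2), -s_1 =
    s_1 (-1) and -s_2 s_1 = s_2 (-s_1).\<close>
  have 3: "uminus \<circ> BC2_s2 \<in> BC2_weyl" using I(2)[OF 2] by (simp only: s1)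
  have 4: "uminus \<in> BC2_weyl" using I(3)[OF 3] by (simp only: s2)
  have 5: "uminus \<circ> BC2_s1 \<in> BC2_weyl" using I(2)[OF 4] by (simp only: s1)
  have 6: "uminus \<circ> (BC2_s2 \<circ> BC2_s1) \<in> BC2_weyl" using I(3)[OF 5] by (simp only: s2)
  show "?R \<subseteq> BC2_weyl" using I(1) 1 2 3 4 5 6 by blast
qed

lemma SPA_iff: "(S, T) \<in> SPA \<Phi> B \<longleftrightarrow> S \<subseteq> B \<and> T \<subseteq> B \<and> chi_pair \<Phi> B (S, T) ` \<Phi> \<subseteq> BC2 \<union> {0} \<and>
    chi_pair \<Phi> B (S, T) ` \<Phi> \<inter> BC2_short \<noteq> {}"
  by (simp add: SPA_def BC2_short_def)

section \<open>Homomorphisms on the root lattice as pairings with vectors\<close>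

context based_roots
begin

abbreviation "L \<equiv> root_lattice \<Phi>"

lemma lattice_span: "x \<in> L \<Longrightarrow> x \<in> span B"
  by (rule root_lattice_coords_int(2)[OF root_sys base])

lemma root_lattice_root: "\<beta> \<in> \<Phi> \<Longrightarrow> \<beta> \<in> L"
proof -
  assume "\<beta> \<in> \<Phi>"
  then have "\<beta> = (\<Sum>\<alpha>\<in>\<Phi>. of_int (if \<alpha> = \<beta> then 1 else 0) *\<^sub>R \<alpha>)"
    using finite_roots by (simp add: if_distrib[of of_int] if_distrib[of "\<lambda>c. c *\<^sub>R _"] cong: if_cong)
  then show ?thesis unfolding root_lattice_def by (intro CollectI exI[of _ "\<lambda>\<alpha>. if \<alpha> = \<beta> then 1 else 0"]) simp
qed

lemma weyl_lattice: assumes x: "x \<in> L" and w: "w \<in> weyl_group \<Phi>" shows "w x \<in> L"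
proof -
  obtain c :: "'a \<Rightarrow> int" where c: "x = (\<Sum>\<beta>\<in>\<Phi>. of_int (c \<beta>) *\<^sub>R \<beta>)"
    using x unfolding root_lattice_def by blast
  obtain v where v: "\<And>x. v (w x) = x" using weyl_obtain_inv[OF w] by metis
  have "w x = (\<Sum>\<beta>\<in>\<Phi>. of_int (c (v (w \<beta>))) *\<^sub>R w \<beta>)"
    by (simp add: c v linear_sum[OF linear_weyl[OF w]] linear_scale[OF linear_weyl[OF w]])
  also have "\<dots> = (\<Sum>\<beta>\<in>w ` \<Phi>. of_int (c (v \<beta>)) *\<^sub>R \<beta>)"
    using v by (subst sum.reindex) (auto intro!: inj_on_inverseI[of _ v])
  finally have "w x = (\<Sum>\<beta>\<in>\<Phi>. of_int (c (v \<beta>)) *\<^sub>R \<beta>)" using weyl_image[OF w] by simp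
  then show ?thesis unfolding root_lattice_def by (intro CollectI exI[of _ "\<lambda>\<beta>. c (v \<beta>)"]) simp
qed

text \<open>The bridge from integer-valued functionals to inner products: on the lattice the
  coordinates are integers, so the floors in \<open>chi\<close> are exact.\<close>

lemma chi_real: assumes "x \<in> L" "S \<subseteq> B" shows "real_of_int (chi \<Phi> B S x) = dual S \<bullet> x"
proof -
  have "real_of_int \<lfloor>representation B x \<gamma>\<rfloor> = dual {\<gamma>} \<bullet> x" if "\<gamma> \<in> B" for \<gamma>
    using root_lattice_coords_int(1)[OF root_sys base assms(1)]
      dual_representation[OF lattice_span[OF assms(1)] that] by (metis floor_of_int Ints_cases)
  then have "real_of_int (chi \<Phi> B S x) = (\<Sum>\<gamma>\<in>S. dual {\<gamma>} \<bullet> x)"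
    using assms by (auto simp: chi_def intro!: sum.cong)
  then show ?thesis using dual_sum lattice_span assms by simp
qed

lemma base_lattice: "\<gamma> \<in> B \<Longrightarrow> \<gamma> \<in> L"
  using base_subset root_lattice_root by blast

lemma chi_simple: "\<gamma> \<in> B \<Longrightarrow> S \<subseteq> B \<Longrightarrow> chi \<Phi> B S \<gamma> = (if \<gamma> \<in> S then 1 else 0)"
  using chi_base[OF root_sys base] by blast

lemma chi_simple_neg: "\<gamma> \<in> B \<Longrightarrow> S \<subseteq> B \<Longrightarrow> chi \<Phi> B S (- \<gamma>) = - (if \<gamma> \<in> S then 1 else 0)"
proof -
  assume g: "\<gamma> \<in> B" "S \<subseteq> B"
  then have "- \<gamma> \<in> L" using base_subset neg_root root_lattice_root by blast
  then have "real_of_int (chi \<Phi> B S (- \<gamma>)) = real_of_int (- (if \<gamma> \<in> S then 1 else 0))"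
    using g by (simp add: chi_real dual_base)
  then show ?thesis by linarith
qed

lemma chi_union:
  assumes "x \<in> L" "R \<subseteq> B" "Q \<subseteq> B" "R \<inter> Q = {}"
  shows "chi \<Phi> B (R \<union> Q) x = chi \<Phi> B R x + chi \<Phi> B Q x"
proof -
  have "finite R" "finite Q" using assms finite_base finite_subset by blast+
  then show ?thesis using assms by (simp add: chi_def sum.union_disjoint)
qed

lemma chi_long_elt:
  assumes "x \<in> L" "R \<subseteq> B" "X \<subseteq> B" "R \<inter> X = {}"
  shows "chi \<Phi> B R (long_elt \<Phi> X x) = chi \<Phi> B R x"
proof -
  have "real_of_int (chi \<Phi> B R (long_elt \<Phi> X x)) = real_of_int (chi \<Phi> B R x)"
    using assms weyl_lattice[OF assms(1) long_elt_weyl[OF assms(3)]] dual_long_elt[OF assms(3,4)]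
    by (simp add: chi_real)
  then show ?thesis by linarith
qed

lemma chi_Pos_nonneg: "\<beta> \<in> Pos \<Longrightarrow> R \<subseteq> B \<Longrightarrow> chi \<Phi> B R \<beta> \<ge> 0"
proof -
  assume b: "\<beta> \<in> Pos" "R \<subseteq> B"
  then have "\<beta> \<in> L" "\<beta> \<in> span B" using Pos_root root_lattice_root root_span by blast+
  then have "real_of_int (chi \<Phi> B R \<beta>) \<ge> 0"
    using b dual_sum[of \<beta> R] by (auto simp: chi_real Pos_iff intro!: sum_nonneg)
  then show ?thesis by linarith
qed

text \<open>The functional v o w is the pairing with w^{-1} v. Both w^{-1} v and w'^{-1} v are
  dominant and lie in one orbit, so they agree.\<close>

lemma dominant_unique:
  assumes w: "w \<in> weyl_group \<Phi>" "w' \<in> weyl_group \<Phi>"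
    and d: "\<And>\<gamma>. \<gamma> \<in> B \<Longrightarrow> v \<bullet> w \<gamma> \<ge> 0" "\<And>\<gamma>. \<gamma> \<in> B \<Longrightarrow> v \<bullet> w' \<gamma> \<ge> 0"
  shows "v \<bullet> w x = v \<bullet> w' x"
proof -
  obtain i where i: "i \<in> weyl_group \<Phi>" "\<And>x. i (w x) = x" "\<And>x. w (i x) = x"
    using weyl_obtain_inv[OF w(1)] by metis
  obtain i' where i': "i' \<in> weyl_group \<Phi>" "\<And>x. i' (w' x) = x" "\<And>x. w' (i' x) = x"
    using weyl_obtain_inv[OF w(2)] by metis
  have e: "i v \<bullet> x = v \<bullet> w x" "i' v \<bullet> x = v \<bullet> w' x" for x
    using weyl_inner[OF w(1), of "i v" x] weyl_inner[OF w(2), of "i' v" x] i i' by simp_all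
  have "(i' \<circ> w) (i v) = i v"
    by (rule dominant_weyl_fixed[OF weyl_comp[OF i'(1) w(1)]]) (simp_all add: i e d)
  then show ?thesis using e i by simp
qed

text \<open>The orbit condition of \<open>SPA_hom\<close> as a relation with an existential witness.
  Unlike the definite descriptions it composes at once, and dominance is built in, since the \<chi>
  of a pair takes the values 0 and 1 on the base.\<close>

definition acts :: "(int \<times> int \<Rightarrow> int \<times> int) \<Rightarrow> 'a set \<times> 'a set \<Rightarrow> 'a set \<times> 'a set \<Rightarrow> bool" where
  "acts u p q \<longleftrightarrow> p \<in> SPA \<Phi> B \<and> q \<in> SPA \<Phi> B \<and>
     (\<exists>w\<in>weyl_group \<Phi>. \<forall>x\<in>L. chi_pair \<Phi> B q x = u (chi_pair \<Phi> B p (w x)))"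

lemma acts_comp: "acts u p q \<Longrightarrow> acts v q r \<Longrightarrow> acts (v \<circ> u) p r"
proof -
  assume a: "acts u p q" "acts v q r"
  then obtain w w' where w: "w \<in> weyl_group \<Phi>" "\<forall>x\<in>L. chi_pair \<Phi> B q x = u (chi_pair \<Phi> B p (w x))"
    "w' \<in> weyl_group \<Phi>" "\<forall>x\<in>L. chi_pair \<Phi> B r x = v (chi_pair \<Phi> B q (w' x))"
    unfolding acts_def by blast
  then have "\<forall>x\<in>L. chi_pair \<Phi> B r x = (v \<circ> u) (chi_pair \<Phi> B p ((w \<circ> w') x))"
    using weyl_lattice by simp
  then show ?thesis using a weyl_comp[OF w(1,3)] unfolding acts_def by blast
qed

lemma acts_id: "p \<in> SPA \<Phi> B \<Longrightarrow> acts id p p"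
  unfolding acts_def by (intro conjI bexI[of _ id] weyl_group.weyl_id) simp_all

text \<open>As u is linear, each coordinate of u o \<chi> is the pairing with a combination of
  \<open>dual S\<close> and \<open>dual T\<close>. Dominance can then be treated one coordinate at a
  time.\<close>

lemma BC2_weyl_chi_vectors:
  assumes "u \<in> BC2_weyl" "p \<in> SPA \<Phi> B"
  obtains v1 v2 where "\<And>x. x \<in> L \<Longrightarrow> real_of_int (fst (u (chi_pair \<Phi> B p x))) = v1 \<bullet> x"
    "\<And>x. x \<in> L \<Longrightarrow> real_of_int (snd (u (chi_pair \<Phi> B p x))) = v2 \<bullet> x"
proof -
  obtain S T where p: "p = (S, T)" "S \<subseteq> B" "T \<subseteq> B" using assms(2) by (cases p) (auto simp: SPA_iff)
  obtain a b c d where u: "\<And>x y. u (x, y) = (a * x + b * y, c * x + d * y)"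
    using BC2_weyl_linear[OF assms(1)] by metis
  show ?thesis
    by (rule that[of "of_int a *\<^sub>R dual S + of_int b *\<^sub>R dual T" "of_int c *\<^sub>R dual S + of_int d *\<^sub>R dual T"])
      (simp_all add: p chi_pair_def u chi_real inner_add_left)
qed

lemma chi_pair_base:
  "S \<subseteq> B \<Longrightarrow> T \<subseteq> B \<Longrightarrow> \<gamma> \<in> B \<Longrightarrow>
    chi_pair \<Phi> B (S, T) \<gamma> = (if \<gamma> \<in> S then 1 else 0, if \<gamma> \<in> T then 1 else 0)"
  by (simp add: chi_pair_def base_lattice chi_simple)

lemma chi_pair_inj:
  assumes "p \<in> SPA \<Phi> B" "q \<in> SPA \<Phi> B" "chi_pair \<Phi> B p = chi_pair \<Phi> B q" shows "p = q"
proof -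
  obtain S T where p: "p = (S, T)" "S \<subseteq> B" "T \<subseteq> B" using assms(1) by (cases p) (auto simp: SPA_iff)
  obtain S' T' where q: "q = (S', T')" "S' \<subseteq> B" "T' \<subseteq> B" using assms(2) by (cases q) (auto simp: SPA_iff)
  have "\<gamma> \<in> S \<longleftrightarrow> \<gamma> \<in> S'" "\<gamma> \<in> T \<longleftrightarrow> \<gamma> \<in> T'" if "\<gamma> \<in> B" for \<gamma>
    using chi_pair_base[OF p(2,3) that] chi_pair_base[OF q(2,3) that] assms(3) p q
    by (auto split: if_splits)
  then show ?thesis using p q by auto
qed

text \<open>A dominant \<rho> in the orbit has nonnegative coordinates on the base, and so has
  \<chi>_q. By \<open>dominant_unique\<close>, applied to each coordinate, they agree on the
  lattice; off the lattice both are undefined.\<close>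

lemma acts_SPA_act:
  assumes u: "u \<in> BC2_weyl" and a: "acts u p q" shows "SPA_act \<Phi> B u p = q"
proof -
  have p: "p \<in> SPA \<Phi> B" and q: "q \<in> SPA \<Phi> B"
    and ex: "\<exists>w\<in>weyl_group \<Phi>. \<forall>x\<in>L. chi_pair \<Phi> B q x = u (chi_pair \<Phi> B p (w x))"
    using a by (simp_all only: acts_def)
  from ex obtain w where w0: "w \<in> weyl_group \<Phi>" "\<forall>x\<in>L. chi_pair \<Phi> B q x = u (chi_pair \<Phi> B p (w x))" by (rule bexE)
  note w = w0(1) bspec[OF w0(2)]
  obtain v1 v2 where v: "\<And>x. x \<in> L \<Longrightarrow> real_of_int (fst (u (chi_pair \<Phi> B p x))) = v1 \<bullet> x"
    "\<And>x. x \<in> L \<Longrightarrow> real_of_int (snd (u (chi_pair \<Phi> B p x))) = v2 \<bullet> x"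
    by (rule BC2_weyl_chi_vectors[OF u p], rule that)
  have pos: "chi_pair \<Phi> B q ` B \<subseteq> BC2_pos \<union> {0}"
  proof -
    obtain S T where q': "q = (S, T)" "S \<subseteq> B" "T \<subseteq> B" using q by (cases q) (auto simp: SPA_iff)
    have "chi_pair \<Phi> B q \<gamma> \<in> BC2_pos \<union> {0}" if "\<gamma> \<in> B" for \<gamma>
      unfolding q'(1) chi_pair_base[OF q'(2,3) that] by (simp add: BC2_pos_def zero_prod_def)
    then show ?thesis by blast
  qed
  have "SPA_hom \<Phi> B u p = chi_pair \<Phi> B q"
    unfolding SPA_hom_def
  proof (rule the_equality)
    have "chi_pair \<Phi> B q = compose L (u \<circ> chi_pair \<Phi> B p) w"
      using w(2) by (auto simp: compose_def fun_eq_iff) (auto simp: chi_pair_def)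
    then show "chi_pair \<Phi> B q \<in> {compose L (u \<circ> chi_pair \<Phi> B p) w |w. w \<in> weyl_group \<Phi>} \<and>
        chi_pair \<Phi> B q ` B \<subseteq> BC2_pos \<union> {0}" using w(1) pos by blast
    fix \<rho> assume "\<rho> \<in> {compose L (u \<circ> chi_pair \<Phi> B p) w |w. w \<in> weyl_group \<Phi>} \<and> \<rho> ` B \<subseteq> BC2_pos \<union> {0}"
    then obtain w' where w': "w' \<in> weyl_group \<Phi>" "\<rho> = compose L (u \<circ> chi_pair \<Phi> B p) w'"
      and pos': "\<rho> ` B \<subseteq> BC2_pos \<union> {0}" by blast
    have rho: "\<rho> x = u (chi_pair \<Phi> B p (w' x))" if "x \<in> L" for x using that w' by (simp add: compose_def)
    have n: "fst (\<rho> \<gamma>) \<ge> 0" "snd (\<rho> \<gamma>) \<ge> 0" "fst (chi_pair \<Phi> B q \<gamma>) \<ge> 0" "snd (chi_pair \<Phi> B q \<gamma>) \<ge> 0"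
      if "\<gamma> \<in> B" for \<gamma> using that pos pos' BC2_pos_iff by blast+
    have "v1 \<bullet> w \<gamma> \<ge> 0" "v1 \<bullet> w' \<gamma> \<ge> 0" "v2 \<bullet> w \<gamma> \<ge> 0" "v2 \<bullet> w' \<gamma> \<ge> 0" if "\<gamma> \<in> B" for \<gamma>
      using n[OF that] base_lattice[OF that] by (simp_all add: rho w(2) weyl_lattice w(1) w'(1) flip: v)
    then have e: "v1 \<bullet> w x = v1 \<bullet> w' x" "v2 \<bullet> w x = v2 \<bullet> w' x" for x
      using dominant_unique[OF w(1) w'(1)] by blast+
    show "\<rho> = chi_pair \<Phi> B q"
    proof
      fix x
      show "\<rho> x = chi_pair \<Phi> B q x"
      proof (cases "x \<in> L")
        case True
        then have "real_of_int (fst (\<rho> x)) = real_of_int (fst (chi_pair \<Phi> B q x))"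
          "real_of_int (snd (\<rho> x)) = real_of_int (snd (chi_pair \<Phi> B q x))"
          using e[of x] by (simp_all add: rho w(2) v weyl_lattice w(1) w'(1))
        then show ?thesis by (simp add: prod_eq_iff)
      next
        case False
        then show ?thesis using w' by (simp add: compose_def chi_pair_def)
      qed
    qed
  qed
  then show ?thesis unfolding SPA_act_def
    by (intro the_equality) (use q chi_pair_inj in auto)
qed

end

section \<open>The highest root and a criterion for the action\<close>

locale highest_based_roots = based_roots +
  fixes \<mu> assumes highest: "highest_root \<Phi> B \<mu>"
begin

lemma highest_root: "\<mu> \<in> \<Phi>"
  using highest by (simp add: highest_root_def)

lemma highest_coeff_ge: "\<beta> \<in> \<Phi> \<Longrightarrow> \<gamma> \<in> B \<Longrightarrow> dual {\<gamma>} \<bullet> \<beta> \<le> dual {\<gamma>} \<bullet> \<mu>"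
  using highest dual_representation[OF root_span] highest_root by (simp add: highest_root_def)

lemma highest_coeff_ge_1: "\<gamma> \<in> B \<Longrightarrow> dual {\<gamma>} \<bullet> \<mu> \<ge> 1"
  using highest_coeff_ge[of \<gamma> \<gamma>] base_subset by (auto simp: dual_base)

lemmas highest_lattice = root_lattice_root[OF highest_root]
  and highest_span = root_span[OF highest_root]

text \<open>If the first coordinate of \<open>\<rho>\<close> were \<open>2\<close> at a simple root, then, all coefficients of the highest
  root being positive, it would vanish at the other simple roots and so be even on all roots, whereas
  it is odd at a short root.\<close>

lemma acts_if_nonneg:
  fixes u S T w
  defines "\<rho> \<equiv> \<lambda>x. u (chi_pair \<Phi> B (S, T) (w x))"
  defines "S' \<equiv> {\<gamma>\<in>B. fst (\<rho> \<gamma>) = 1}" and "T' \<equiv> {\<gamma>\<in>B. snd (\<rho> \<gamma>) = 1}"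
  assumes p: "(S, T) \<in> SPA \<Phi> B" and u: "u \<in> BC2_weyl" and w: "w \<in> weyl_group \<Phi>"
    and pos: "\<And>\<gamma>. \<gamma> \<in> B \<Longrightarrow> fst (\<rho> \<gamma>) \<ge> 0" "\<And>\<gamma>. \<gamma> \<in> B \<Longrightarrow> snd (\<rho> \<gamma>) \<ge> 0"
  shows "acts u (S, T) (S', T')" and "\<gamma> \<in> B \<Longrightarrow> fst (\<rho> \<gamma>) \<le> 1" and "\<gamma> \<in> B \<Longrightarrow> snd (\<rho> \<gamma>) \<le> 1"
proof -
  obtain v1 v2 where v: "\<And>x. x \<in> L \<Longrightarrow> real_of_int (fst (u (chi_pair \<Phi> B (S, T) x))) = v1 \<bullet> x"
    "\<And>x. x \<in> L \<Longrightarrow> real_of_int (snd (u (chi_pair \<Phi> B (S, T) x))) = v2 \<bullet> x"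
    by (rule BC2_weyl_chi_vectors[OF u p], rule that)
  obtain i where i: "i \<in> weyl_group \<Phi>" "\<And>x. i (w x) = x" "\<And>x. w (i x) = x"
    using weyl_obtain_inv[OF w] by metis
  \<comment> \<open>With i the inverse of w, the coordinates of \<rho> are the pairings with i v1
    and i v2.\<close>
  have r: "real_of_int (fst (\<rho> x)) = i v1 \<bullet> x" "real_of_int (snd (\<rho> x)) = i v2 \<bullet> x" if "x \<in> L" for x
    using v weyl_lattice[OF that w] weyl_inner[OF w, of "i v1" x] weyl_inner[OF w, of "i v2" x] i
    by (simp_all add: \<rho>_def)
  have BC: "\<rho> \<beta> \<in> BC2 \<union> {0}" if "\<beta> \<in> \<Phi>" for \<beta>
  proof -
    have "chi_pair \<Phi> B (S, T) (w \<beta>) \<in> BC2 \<union> {0}" using p weyl_root[OF w that] unfolding SPA_iff by blast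
    then show ?thesis unfolding \<rho>_def by (rule BC2_weyl_BC2[OF u])
  qed
  obtain \<beta> where b: "\<beta> \<in> \<Phi>" "chi_pair \<Phi> B (S, T) \<beta> \<in> BC2_short" using p unfolding SPA_iff by blast
  then have sh: "\<rho> (i \<beta>) \<in> BC2_short" using BC2_weyl_short[OF u] i by (simp add: \<rho>_def)
  have ib: "i \<beta> \<in> \<Phi>" by (rule weyl_root[OF i(1) b(1)])
  have fst_le: "fst (\<rho> \<gamma>) \<le> 1" if g: "\<gamma> \<in> B" for \<gamma>
  proof (rule ccontr)
    assume n: "\<not> fst (\<rho> \<gamma>) \<le> 1"
    have nn: "i v1 \<bullet> \<delta> \<ge> 0" if "\<delta> \<in> B" for \<delta> using pos(1)[OF that] r(1)[OF base_lattice[OF that]] by simp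
    have g2: "i v1 \<bullet> \<gamma> \<ge> 2" using n r(1)[OF base_lattice[OF g]] by simp
    have "fst (\<rho> \<mu>) \<le> 2" using BC[OF highest_root] BC2_iff by (cases "\<rho> \<mu>") auto
    then have m2: "i v1 \<bullet> \<mu> \<le> 2" using r(1)[OF highest_lattice] by simp
    have z: "i v1 \<bullet> \<delta> = 0" if d: "\<delta> \<in> B" "\<delta> \<noteq> \<gamma>" for \<delta>
    proof (rule ccontr)
      assume "i v1 \<bullet> \<delta> \<noteq> 0"
      then have pd: "i v1 \<bullet> \<delta> > 0" using nn[OF d(1)] by simp
      \<comment> \<open>All coefficients of \<mu> are at least 1, so the value at \<mu> is at least
        the sum of the values at \<gamma> and \<delta>, which exceeds 2.\<close>
      have "i v1 \<bullet> \<gamma> + i v1 \<bullet> \<delta> = (\<Sum>\<epsilon>\<in>{\<gamma>, \<delta>}. i v1 \<bullet> \<epsilon>)" using d by simp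
      also have "\<dots> \<le> (\<Sum>\<epsilon>\<in>B. i v1 \<bullet> \<epsilon>)" using g d nn finite_base by (intro sum_mono2) auto
      also have "\<dots> \<le> (\<Sum>\<epsilon>\<in>B. (dual {\<epsilon>} \<bullet> \<mu>) * (i v1 \<bullet> \<epsilon>))"
      proof (rule sum_mono)
        fix \<epsilon> assume e: "\<epsilon> \<in> B"
        show "i v1 \<bullet> \<epsilon> \<le> (dual {\<epsilon>} \<bullet> \<mu>) * (i v1 \<bullet> \<epsilon>)"
          using mult_right_mono[OF highest_coeff_ge_1[OF e] nn[OF e]] by simp
      qed
      also have "\<dots> = i v1 \<bullet> \<mu>" by (rule inner_expand[OF highest_span, symmetric])
      finally show False using g2 m2 pd by linarith
    qed
    have single: "i v1 \<bullet> x = (dual {\<gamma>} \<bullet> x) * (i v1 \<bullet> \<gamma>)" if "x \<in> span B" for x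
    proof -
      have "i v1 \<bullet> x = (\<Sum>\<epsilon>\<in>{\<gamma>}. (dual {\<epsilon>} \<bullet> x) * (i v1 \<bullet> \<epsilon>))"
        by (subst inner_expand[OF that]) (use g z finite_base in \<open>intro sum.mono_neutral_right; auto\<close>)
      then show ?thesis by simp
    qed
    have "i v1 \<bullet> \<gamma> = 2"
      using single[OF highest_span] mult_right_mono[OF highest_coeff_ge_1[OF g] nn[OF g]] m2 g2 by linarith
    moreover obtain k :: int where "dual {\<gamma>} \<bullet> i \<beta> = of_int k" using coeff_Ints[OF ib g] by (auto elim: Ints_cases)
    ultimately have "real_of_int (fst (\<rho> (i \<beta>))) = real_of_int (2 * k)"
      using single[OF root_span[OF ib]] r(1)[OF root_lattice_root[OF ib]] by simp
    then have "fst (\<rho> (i \<beta>)) = 2 * k" by linarith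
    then show False using sh BC2_short_iff by (cases "\<rho> (i \<beta>)") (auto, presburger)
  qed
  have snd_le: "snd (\<rho> \<gamma>) \<le> 1" if g: "\<gamma> \<in> B" for \<gamma>
  proof -
    obtain a b where ab: "\<rho> \<gamma> = (a, b)" by fastforce
    \<comment> \<open>With 0 \<le> a \<le> 1, a second coordinate b \<ge> 2 would give |b| + |a - b|
      \<ge> 3.\<close>
    have "\<bar>b\<bar> + \<bar>a - b\<bar> \<le> 2" using BC[of \<gamma>] base_subset g unfolding ab BC2_iff by blast
    then show ?thesis using fst_le[OF g] pos[OF g] by (simp add: ab)
  qed
  show "\<gamma> \<in> B \<Longrightarrow> fst (\<rho> \<gamma>) \<le> 1" "\<gamma> \<in> B \<Longrightarrow> snd (\<rho> \<gamma>) \<le> 1" using fst_le snd_le by auto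
  have sub: "S' \<subseteq> B" "T' \<subseteq> B" by (auto simp: S'_def T'_def)
  have "dual S' \<bullet> \<gamma> = i v1 \<bullet> \<gamma>" "dual T' \<bullet> \<gamma> = i v2 \<bullet> \<gamma>" if g: "\<gamma> \<in> B" for \<gamma>
  proof -
    have "fst (\<rho> \<gamma>) = (if \<gamma> \<in> S' then 1 else 0)" "snd (\<rho> \<gamma>) = (if \<gamma> \<in> T' then 1 else 0)"
      using fst_le[OF g] snd_le[OF g] pos[OF g] g by (auto simp: S'_def T'_def)
    then show "dual S' \<bullet> \<gamma> = i v1 \<bullet> \<gamma>" "dual T' \<bullet> \<gamma> = i v2 \<bullet> \<gamma>"
      using r[OF base_lattice[OF g]] g by (auto simp add: dual_base split: if_splits)
  qed
  then have "dual S' \<bullet> x = i v1 \<bullet> x" "dual T' \<bullet> x = i v2 \<bullet> x" if "x \<in> span B" for x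
    unfolding inner_expand[OF that, of "i v1"] inner_expand[OF that, of "i v2"]
      inner_expand[OF that, of "dual S'"] inner_expand[OF that, of "dual T'"] by (simp_all cong: sum.cong)
  then have eq: "chi_pair \<Phi> B (S', T') x = \<rho> x" if "x \<in> L" for x
    using that lattice_span[OF that] chi_real[OF that sub(1)] chi_real[OF that sub(2)] r[OF that]
    by (auto simp: chi_pair_def prod_eq_iff)
  have "(S', T') \<in> SPA \<Phi> B"
    unfolding SPA_iff using sub BC sh ib root_lattice_root by (auto simp: eq image_subset_iff)
  moreover have "\<exists>w\<in>weyl_group \<Phi>. \<forall>x\<in>L. chi_pair \<Phi> B (S', T') x = u (chi_pair \<Phi> B (S, T) (w x))"
    using eq unfolding \<rho>_def by (intro bexI[OF _ w]) simp
  ultimately show "acts u (S, T) (S', T')" unfolding acts_def using p by simp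
qed

end

section \<open>Admissible pairs under s_1, s_2 and -1\<close>

context based_roots
begin

lemma mem_diag_aut_image:
  assumes "X \<subseteq> B" "\<gamma> \<in> X" "R \<subseteq> X"
  shows "\<gamma> \<in> diag_aut \<Phi> X ` R \<longleftrightarrow> diag_aut \<Phi> X \<gamma> \<in> R"
  using diag_aut_diag_aut[OF assms(1)] by (metis imageE imageI)

lemma diag_aut_image_subset: "X \<subseteq> B \<Longrightarrow> R \<subseteq> X \<Longrightarrow> diag_aut \<Phi> X ` R \<subseteq> X"
  using diag_aut_base by blast

lemma chi_pair_long_elt:
  assumes "X \<subseteq> B" "\<gamma> \<in> X" "S \<subseteq> B" "T \<subseteq> B"
  shows "chi_pair \<Phi> B (S, T) (long_elt \<Phi> X \<gamma>) =
    (- (if diag_aut \<Phi> X \<gamma> \<in> S then 1 else 0), - (if diag_aut \<Phi> X \<gamma> \<in> T then 1 else 0))"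
proof -
  have d: "diag_aut \<Phi> X \<gamma> \<in> B" using diag_aut_base assms by blast
  then have "- diag_aut \<Phi> X \<gamma> \<in> L" using base_subset neg_root root_lattice_root by blast
  then show ?thesis
    using d assms by (simp add: long_elt_neg[OF assms(1)] chi_pair_def chi_simple_neg)
qed

lemma base_act_base_act:
  assumes "S \<subseteq> B" shows "base_act B (base_act B S (diag_aut \<Phi> B)) (diag_aut \<Phi> B) = S"
  using assms diag_aut_base[OF subset_refl] diag_aut_diag_aut[OF subset_refl]
  by (auto simp: base_act_def)

end

context highest_based_roots
begin

context
  fixes S T assumes p: "(S, T) \<in> SPA \<Phi> B"
begin

lemma SPA_subsets: "S \<subseteq> B" "T \<subseteq> B"
  using p by (simp_all add: SPA_iff)

lemma SPA_root_values:
  assumes "\<beta> \<in> \<Phi>" shows "\<bar>chi \<Phi> B T \<beta>\<bar> + \<bar>chi \<Phi> B S \<beta> - chi \<Phi> B T \<beta>\<bar> \<le> 2"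
proof -
  have "chi_pair \<Phi> B (S, T) \<beta> \<in> BC2 \<union> {0}" using p assms unfolding SPA_iff by blast
  then have "(chi \<Phi> B S \<beta>, chi \<Phi> B T \<beta>) \<in> BC2 \<union> {0}"
    using root_lattice_root[OF assms] by (simp add: chi_pair_def)
  then show ?thesis unfolding BC2_iff .
qed

text \<open>Both equations hold because w_{B - T} leaves the coefficients in T alone. By the first,
  the condition in the definition of \<open>breve_S\<close> says that \<chi>_S(w \<gamma>) =
  1.\<close>

lemma breve_value_split:
  assumes "\<gamma> \<in> T"
  shows "chi \<Phi> B S (long_elt \<Phi> (B - T) \<gamma>) =
    chi \<Phi> B (S - T) (long_elt \<Phi> (B - T) \<gamma>) + chi \<Phi> B (S \<inter> T) \<gamma>"
    and "chi \<Phi> B T (long_elt \<Phi> (B - T) \<gamma>) = 1"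
proof -
  have X: "B - T \<subseteq> B" and g: "\<gamma> \<in> B" using assms SPA_subsets by auto
  have L: "\<gamma> \<in> L" "long_elt \<Phi> (B - T) \<gamma> \<in> L"
    using base_lattice[OF g] weyl_lattice[OF _ long_elt_weyl[OF X]] by auto
  have "chi \<Phi> B S (long_elt \<Phi> (B - T) \<gamma>) = chi \<Phi> B ((S - T) \<union> (S \<inter> T)) (long_elt \<Phi> (B - T) \<gamma>)"
    by (simp add: Un_Diff_Int)
  also have "\<dots> = chi \<Phi> B (S - T) (long_elt \<Phi> (B - T) \<gamma>) + chi \<Phi> B (S \<inter> T) (long_elt \<Phi> (B - T) \<gamma>)"
    using SPA_subsets by (intro chi_union[OF L(2)]) auto
  also have "chi \<Phi> B (S \<inter> T) (long_elt \<Phi> (B - T) \<gamma>) = chi \<Phi> B (S \<inter> T) \<gamma>"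
    using SPA_subsets by (intro chi_long_elt[OF L(1)]) auto
  finally show "chi \<Phi> B S (long_elt \<Phi> (B - T) \<gamma>) =
    chi \<Phi> B (S - T) (long_elt \<Phi> (B - T) \<gamma>) + chi \<Phi> B (S \<inter> T) \<gamma>" .
  have "chi \<Phi> B T (long_elt \<Phi> (B - T) \<gamma>) = chi \<Phi> B T \<gamma>"
    using SPA_subsets by (intro chi_long_elt[OF L(1)]) auto
  then show "chi \<Phi> B T (long_elt \<Phi> (B - T) \<gamma>) = 1" using assms g SPA_subsets by (simp add: chi_simple)
qed

text \<open>Since s_1(a, b) = (2 b - a, b), composing with w_{B - T} gives (1, 0) or (0, 0) at
  \<gamma> in B - T, according to whether \<sigma> \<gamma> lies in S, and (2 - m, 1) at \<gamma> in
  T, where m is the value \<open>?m\<close>. Admissibility of (S, T) gives m \<le> 2. The bound m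
  \<ge> 1 is gained from \<open>acts_if_nonneg\<close>, by which 2 - m is at most 1.\<close>

lemma acts_s1: "acts BC2_s1 (S, T) (breve_S \<Phi> B S T, T)"
  and breve_value_range: "\<gamma> \<in> T \<Longrightarrow>
    chi \<Phi> B (S - T) (long_elt \<Phi> (B - T) \<gamma>) + chi \<Phi> B (S \<inter> T) \<gamma> \<in> {1, 2}"
proof -
  let ?w = "long_elt \<Phi> (B - T)"
  let ?m = "\<lambda>\<gamma>. chi \<Phi> B (S - T) (?w \<gamma>) + chi \<Phi> B (S \<inter> T) \<gamma>"
  let ?r = "\<lambda>x. BC2_s1 (chi_pair \<Phi> B (S, T) (?w x))"
  have X: "B - T \<subseteq> B" by blast
  have u: "BC2_s1 \<in> BC2_weyl" by (simp add: BC2_weyl_eq)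
  have rX: "?r \<gamma> = (if diag_aut \<Phi> (B - T) \<gamma> \<in> S then 1 else 0, 0)" if "\<gamma> \<in> B - T" for \<gamma>
    using diag_aut_base[OF X that] SPA_subsets that
    by (simp add: chi_pair_long_elt[OF X that] BC2_s1_def)
  have L: "?w \<gamma> \<in> \<Phi>" "?w \<gamma> \<in> L" if "\<gamma> \<in> B" for \<gamma>
    using that weyl_root[OF long_elt_weyl[OF X]] base_subset root_lattice_root by blast+
  have rT: "?r \<gamma> = (2 - ?m \<gamma>, 1)" if "\<gamma> \<in> T" for \<gamma>
    using that breve_value_split[OF that] L SPA_subsets by (auto simp: chi_pair_def BC2_s1_def)
  have m: "?m \<gamma> \<le> 2" if "\<gamma> \<in> T" for \<gamma>
  proof -
    have "?w \<gamma> \<in> \<Phi>" using L that SPA_subsets by blast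
    from SPA_root_values[OF this] show ?thesis using breve_value_split[OF that] by linarith
  qed
  have pos: "fst (?r \<gamma>) \<ge> 0" "snd (?r \<gamma>) \<ge> 0" if "\<gamma> \<in> B" for \<gamma>
    using that rX[of \<gamma>] rT[of \<gamma>] m[of \<gamma>] by (cases "\<gamma> \<in> T"; simp)+
  note ex = acts_if_nonneg[OF p u long_elt_weyl[OF X] pos]
  show "?m \<gamma> \<in> {1, 2}" if "\<gamma> \<in> T" for \<gamma>
    using ex(2)[of \<gamma>] rT[OF that] m[OF that] that SPA_subsets by auto
  have "{\<gamma>\<in>B. fst (?r \<gamma>) = 1} = breve_S \<Phi> B S T"
  proof (intro set_eqI)
    fix \<gamma>
    show "\<gamma> \<in> {\<gamma>\<in>B. fst (?r \<gamma>) = 1} \<longleftrightarrow> \<gamma> \<in> breve_S \<Phi> B S T"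
    proof (cases "\<gamma> \<in> B - T")
      case True
      have "diag_aut \<Phi> (B - T) \<gamma> \<in> S \<longleftrightarrow> diag_aut \<Phi> (B - T) \<gamma> \<in> S - T"
        using diag_aut_base[OF X True] by blast
      also have "\<dots> \<longleftrightarrow> \<gamma> \<in> diag_aut \<Phi> (B - T) ` (S - T)"
        using mem_diag_aut_image[OF X True, of "S - T"] SPA_subsets by blast
      finally show ?thesis using True rX[OF True] by (simp add: breve_S_def)
    next
      case False
      then have n: "\<gamma> \<notin> diag_aut \<Phi> (B - T) ` (S - T)"
        using diag_aut_image_subset[OF X, of "S - T"] SPA_subsets by blast
      show ?thesis
      proof (cases "\<gamma> \<in> T")
        case True
        then show ?thesis using n rT[OF True] SPA_subsets
          by (auto simp: breve_S_def long_elt_ext_eq[OF X])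
      next
        case nT: False
        then show ?thesis using False n by (simp add: breve_S_def)
      qed
    qed
  qed
  moreover have "{\<gamma>\<in>B. snd (?r \<gamma>) = 1} = T"
  proof (intro set_eqI)
    fix \<gamma>
    show "\<gamma> \<in> {\<gamma>\<in>B. snd (?r \<gamma>) = 1} \<longleftrightarrow> \<gamma> \<in> T"
      using rX[of \<gamma>] rT[of \<gamma>] SPA_subsets by (cases "\<gamma> \<in> T") auto
  qed
  ultimately show "acts BC2_s1 (S, T) (breve_S \<Phi> B S T, T)" using ex(1) by simp
qed

lemma bar_value_split:
  assumes "\<gamma> \<in> S"
  shows "chi \<Phi> B T (long_elt \<Phi> (B - S) \<gamma>) =
    chi \<Phi> B (T - S) (long_elt \<Phi> (B - S) \<gamma>) + chi \<Phi> B (T \<inter> S) \<gamma>"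
    and "chi \<Phi> B S (long_elt \<Phi> (B - S) \<gamma>) = 1"
proof -
  have X: "B - S \<subseteq> B" and g: "\<gamma> \<in> B" using assms SPA_subsets by auto
  have L: "\<gamma> \<in> L" "long_elt \<Phi> (B - S) \<gamma> \<in> L"
    using base_lattice[OF g] weyl_lattice[OF _ long_elt_weyl[OF X]] by auto
  have "chi \<Phi> B T (long_elt \<Phi> (B - S) \<gamma>) = chi \<Phi> B ((T - S) \<union> (T \<inter> S)) (long_elt \<Phi> (B - S) \<gamma>)"
    by (simp add: Un_Diff_Int)
  also have "\<dots> = chi \<Phi> B (T - S) (long_elt \<Phi> (B - S) \<gamma>) + chi \<Phi> B (T \<inter> S) (long_elt \<Phi> (B - S) \<gamma>)"
    using SPA_subsets by (intro chi_union[OF L(2)]) auto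
  also have "chi \<Phi> B (T \<inter> S) (long_elt \<Phi> (B - S) \<gamma>) = chi \<Phi> B (T \<inter> S) \<gamma>"
    using SPA_subsets by (intro chi_long_elt[OF L(1)]) auto
  finally show "chi \<Phi> B T (long_elt \<Phi> (B - S) \<gamma>) =
    chi \<Phi> B (T - S) (long_elt \<Phi> (B - S) \<gamma>) + chi \<Phi> B (T \<inter> S) \<gamma>" .
  have "chi \<Phi> B S (long_elt \<Phi> (B - S) \<gamma>) = chi \<Phi> B S \<gamma>"
    using SPA_subsets by (intro chi_long_elt[OF L(1)]) auto
  then show "chi \<Phi> B S (long_elt \<Phi> (B - S) \<gamma>) = 1" using assms g SPA_subsets by (simp add: chi_simple)
qed

text \<open>A positive root has nonnegative coefficients, so their sum over R vanishes only if each
  does. This turns the support condition in \<open>bar_T\<close> into a value of \<chi>.\<close>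

lemma chi_zero_iff_supp:
  assumes "\<beta> \<in> Pos" "R \<subseteq> B" shows "chi \<Phi> B R \<beta> = 0 \<longleftrightarrow> root_supp B \<beta> \<inter> R = {}"
proof -
  have b: "\<beta> \<in> span B" "\<beta> \<in> L" using assms(1) Pos_root root_span root_lattice_root by auto
  have "chi \<Phi> B R \<beta> = 0 \<longleftrightarrow> dual R \<bullet> \<beta> = 0" using chi_real[OF b(2) assms(2)] by (metis of_int_0 of_int_eq_iff)
  also have "dual R \<bullet> \<beta> = (\<Sum>\<gamma>\<in>R. dual {\<gamma>} \<bullet> \<beta>)" by (rule dual_sum[OF b(1) assms(2)])
  also have "\<dots> = 0 \<longleftrightarrow> (\<forall>\<gamma>\<in>R. dual {\<gamma>} \<bullet> \<beta> = 0)"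
    using assms finite_base by (intro sum_nonneg_eq_0_iff) (auto simp: Pos_iff intro: finite_subset)
  also have "\<dots> \<longleftrightarrow> root_supp B \<beta> \<inter> R = {}"
  proof -
    have "dual {\<gamma>} \<bullet> \<beta> = representation B \<beta> \<gamma>" if "\<gamma> \<in> R" for \<gamma>
      using dual_representation[OF b(1)] assms(2) that by blast
    then show ?thesis using assms(2) by (auto simp: root_supp_def)
  qed
  finally show ?thesis .
qed

text \<open>Here s_2(a, b) = (a, a - b), and w_{B - S} keeps \<chi>_S. A root \<gamma> in S gets the
  value (1, 1 - \<chi>_T(w \<gamma>)), so it enters the new second set iff \<chi>_T(w \<gamma>) = 0,
  that is, iff \<gamma> is not in T and the support of w \<gamma> misses T - S.\<close>

lemma acts_s2: "acts BC2_s2 (S, T) (S, bar_T \<Phi> B S T)"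
proof -
  let ?w = "long_elt \<Phi> (B - S)"
  let ?r = "\<lambda>x. BC2_s2 (chi_pair \<Phi> B (S, T) (?w x))"
  have X: "B - S \<subseteq> B" by blast
  have u: "BC2_s2 \<in> BC2_weyl" by (simp add: BC2_weyl_eq)
  have rX: "?r \<gamma> = (0, if diag_aut \<Phi> (B - S) \<gamma> \<in> T then 1 else 0)" if "\<gamma> \<in> B - S" for \<gamma>
    using diag_aut_base[OF X that] SPA_subsets that
    by (simp add: chi_pair_long_elt[OF X that] BC2_s2_def)
  have P: "?w \<gamma> \<in> Pos" if "\<gamma> \<in> S" for \<gamma>
    using long_elt_base_Pos[OF X] that SPA_subsets by blast
  have rS: "?r \<gamma> = (1, 1 - chi \<Phi> B T (?w \<gamma>))" if "\<gamma> \<in> S" for \<gamma>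
    using that bar_value_split(2)[OF that] root_lattice_root[OF Pos_root[OF P[OF that]]]
    by (simp add: chi_pair_def BC2_s2_def)
  have m: "chi \<Phi> B T (?w \<gamma>) \<le> 1" if "\<gamma> \<in> S" for \<gamma>
    using SPA_root_values[OF Pos_root[OF P[OF that]]] bar_value_split(2)[OF that] by linarith
  have m0: "chi \<Phi> B T (?w \<gamma>) = 0 \<longleftrightarrow> \<gamma> \<notin> T \<and> root_supp B (?w \<gamma>) \<inter> (T - S) = {}" if "\<gamma> \<in> S" for \<gamma>
  proof -
    have "chi \<Phi> B (T - S) (?w \<gamma>) \<ge> 0" "chi \<Phi> B (T - S) (?w \<gamma>) = 0 \<longleftrightarrow> root_supp B (?w \<gamma>) \<inter> (T - S) = {}"
      using SPA_subsets by (intro chi_Pos_nonneg chi_zero_iff_supp P[OF that]; blast)+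
    moreover have "chi \<Phi> B (T \<inter> S) \<gamma> = (if \<gamma> \<in> T then 1 else 0)"
      using that SPA_subsets by (subst chi_simple) auto
    ultimately show ?thesis unfolding bar_value_split(1)[OF that] by auto
  qed
  have pos: "fst (?r \<gamma>) \<ge> 0" "snd (?r \<gamma>) \<ge> 0" if "\<gamma> \<in> B" for \<gamma>
    using that rX[of \<gamma>] rS[of \<gamma>] m[of \<gamma>] by (cases "\<gamma> \<in> S"; simp)+
  note ex = acts_if_nonneg[OF p u long_elt_weyl[OF X] pos]
  have "{\<gamma>\<in>B. snd (?r \<gamma>) = 1} = bar_T \<Phi> B S T"
  proof (intro set_eqI)
    fix \<gamma>
    show "\<gamma> \<in> {\<gamma>\<in>B. snd (?r \<gamma>) = 1} \<longleftrightarrow> \<gamma> \<in> bar_T \<Phi> B S T"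
    proof (cases "\<gamma> \<in> B - S")
      case True
      have "diag_aut \<Phi> (B - S) \<gamma> \<in> T \<longleftrightarrow> diag_aut \<Phi> (B - S) \<gamma> \<in> T - S"
        using diag_aut_base[OF X True] by blast
      also have "\<dots> \<longleftrightarrow> \<gamma> \<in> diag_aut \<Phi> (B - S) ` (T - S)"
        using mem_diag_aut_image[OF X True, of "T - S"] SPA_subsets by blast
      finally show ?thesis using True rX[OF True] by (simp add: bar_T_def)
    next
      case False
      then have n: "\<gamma> \<notin> diag_aut \<Phi> (B - S) ` (T - S)"
        using diag_aut_image_subset[OF X, of "T - S"] SPA_subsets by blast
      show ?thesis
      proof (cases "\<gamma> \<in> S")
        case True
        then show ?thesis using n rS[OF True] m0[OF True] SPA_subsets
          by (auto simp: bar_T_def long_elt_ext_eq[OF X])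
      next
        case nS: False
        then show ?thesis using False n by (simp add: bar_T_def)
      qed
    qed
  qed
  moreover have "{\<gamma>\<in>B. fst (?r \<gamma>) = 1} = S"
  proof (intro set_eqI)
    fix \<gamma>
    show "\<gamma> \<in> {\<gamma>\<in>B. fst (?r \<gamma>) = 1} \<longleftrightarrow> \<gamma> \<in> S"
      using rX[of \<gamma>] rS[of \<gamma>] SPA_subsets by (cases "\<gamma> \<in> S") auto
  qed
  ultimately show "acts BC2_s2 (S, T) (S, bar_T \<Phi> B S T)" using ex(1) by simp
qed

lemma acts_uminus:
  "acts uminus (S, T) (base_act B S (diag_aut \<Phi> B), base_act B T (diag_aut \<Phi> B))"
proof -
  let ?w = "long_elt \<Phi> B"
  let ?r = "\<lambda>x. - chi_pair \<Phi> B (S, T) (?w x)"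
  have u: "uminus \<in> BC2_weyl" by (simp add: BC2_weyl_eq)
  have r: "?r \<gamma> = (if diag_aut \<Phi> B \<gamma> \<in> S then 1 else 0, if diag_aut \<Phi> B \<gamma> \<in> T then 1 else 0)"
    if "\<gamma> \<in> B" for \<gamma>
    using that SPA_subsets by (simp add: chi_pair_long_elt)
  have pos: "fst (?r \<gamma>) \<ge> 0" "snd (?r \<gamma>) \<ge> 0" if "\<gamma> \<in> B" for \<gamma>
    unfolding r[OF that] by simp_all
  note ex = acts_if_nonneg(1)[OF p u long_elt_weyl[OF subset_refl] pos]
  have "fst (?r \<gamma>) = 1 \<longleftrightarrow> diag_aut \<Phi> B \<gamma> \<in> S" "snd (?r \<gamma>) = 1 \<longleftrightarrow> diag_aut \<Phi> B \<gamma> \<in> T"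
    if "\<gamma> \<in> B" for \<gamma> unfolding r[OF that] by simp_all
  then have "{\<gamma>\<in>B. fst (?r \<gamma>) = 1} = base_act B S (diag_aut \<Phi> B)"
    "{\<gamma>\<in>B. snd (?r \<gamma>) = 1} = base_act B T (diag_aut \<Phi> B)"
    unfolding base_act_def by blast+
  then show ?thesis using ex by simp
qed

end

lemma acts_SPA: "acts u p q \<Longrightarrow> q \<in> SPA \<Phi> B"
  by (simp add: acts_def)

text \<open>The formulas for \<open>s\<^sub>2 s\<^sub>1\<close> and \<open>-s\<^sub>2 s\<^sub>1\<close> follow by comparison: \<open>s\<^sub>2 s\<^sub>1\<close> determines the first
  component, and \<open>-s\<^sub>2 s\<^sub>1 = s\<^sub>1 s\<^sub>2\<close> the second one.\<close>

lemma SPA_act_formulas: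
  fixes S T
  assumes p: "(S, T) \<in> SPA \<Phi> B"
  defines "\<sigma> \<equiv> \<lambda>R. base_act B R (diag_aut \<Phi> B)"
  shows "SPA_act \<Phi> B id (S, T) = (S, T)"
    and "SPA_act \<Phi> B BC2_s1 (S, T) = (breve_S \<Phi> B S T, T)"
    and "SPA_act \<Phi> B BC2_s2 (S, T) = (S, bar_T \<Phi> B S T)"
    and "SPA_act \<Phi> B (BC2_s2 \<circ> BC2_s1) (S, T) = (breve_S \<Phi> B S T, \<sigma> (bar_T \<Phi> B S T))"
    and "SPA_act \<Phi> B uminus (S, T) = (\<sigma> S, \<sigma> T)"
    and "SPA_act \<Phi> B (uminus \<circ> BC2_s1) (S, T) = (\<sigma> (breve_S \<Phi> B S T), \<sigma> T)"
    and "SPA_act \<Phi> B (uminus \<circ> BC2_s2) (S, T) = (\<sigma> S, \<sigma> (bar_T \<Phi> B S T))"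
    and "SPA_act \<Phi> B (uminus \<circ> (BC2_s2 \<circ> BC2_s1)) (S, T) = (\<sigma> (breve_S \<Phi> B S T), bar_T \<Phi> B S T)"
proof -
  have W: "id \<in> BC2_weyl" "uminus \<in> BC2_weyl" "BC2_s1 \<in> BC2_weyl" "uminus \<circ> BC2_s1 \<in> BC2_weyl"
    "BC2_s2 \<in> BC2_weyl" "uminus \<circ> BC2_s2 \<in> BC2_weyl" "BC2_s2 \<circ> BC2_s1 \<in> BC2_weyl"
    "uminus \<circ> (BC2_s2 \<circ> BC2_s1) \<in> BC2_weyl" by (simp_all only: BC2_weyl_eq insert_iff simp_thms)
  note a1 = acts_s1[OF p] and a2 = acts_s2[OF p]
  note s1 = acts_SPA[OF a1] and s2 = acts_SPA[OF a2]
  \<comment> \<open>Iterating the generators directly leads to nested expressions, named X and Y.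
    Computing -s_2 s_1 in two ways expresses them through breve S, bar T and \<sigma>.\<close>
  define X where "X = bar_T \<Phi> B (breve_S \<Phi> B S T) T"
  define Y where "Y = breve_S \<Phi> B S (bar_T \<Phi> B S T)"
  have a21: "acts (BC2_s2 \<circ> BC2_s1) (S, T) (breve_S \<Phi> B S T, X)"
    unfolding X_def by (rule acts_comp[OF a1 acts_s2[OF s1]])
  note s21 = acts_SPA[OF a21]
  have n: "acts (uminus \<circ> u) (S, T) (\<sigma> S', \<sigma> T')" if "acts u (S, T) (S', T')" for u S' T'
    unfolding \<sigma>_def by (rule acts_comp[OF that acts_uminus[OF acts_SPA[OF that]]])
  have "acts (BC2_s1 \<circ> BC2_s2) (S, T) (Y, bar_T \<Phi> B S T)"
    unfolding Y_def by (rule acts_comp[OF a2 acts_s1[OF s2]])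
  moreover have "BC2_s1 \<circ> BC2_s2 = uminus \<circ> (BC2_s2 \<circ> BC2_s1)"
    by (auto simp: fun_eq_iff BC2_s1_def BC2_s2_def)
  ultimately have a: "acts (uminus \<circ> (BC2_s2 \<circ> BC2_s1)) (S, T) (Y, bar_T \<Phi> B S T)" by simp
  have "(\<sigma> (breve_S \<Phi> B S T), \<sigma> X) = (Y, bar_T \<Phi> B S T)"
    using acts_SPA_act[OF W(8) a] acts_SPA_act[OF W(8) n[OF a21]] by simp
  moreover have "\<sigma> (\<sigma> X) = X" using s21 unfolding \<sigma>_def by (intro base_act_base_act) (simp add: SPA_iff)
  ultimately have X: "X = \<sigma> (bar_T \<Phi> B S T)" "Y = \<sigma> (breve_S \<Phi> B S T)" by auto
  show "SPA_act \<Phi> B id (S, T) = (S, T)" by (rule acts_SPA_act[OF W(1) acts_id[OF p]])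
  show "SPA_act \<Phi> B BC2_s1 (S, T) = (breve_S \<Phi> B S T, T)" by (rule acts_SPA_act[OF W(3) a1])
  show "SPA_act \<Phi> B BC2_s2 (S, T) = (S, bar_T \<Phi> B S T)" by (rule acts_SPA_act[OF W(5) a2])
  show "SPA_act \<Phi> B (BC2_s2 \<circ> BC2_s1) (S, T) = (breve_S \<Phi> B S T, \<sigma> (bar_T \<Phi> B S T))"
    using acts_SPA_act[OF W(7) a21] X by simp
  show "SPA_act \<Phi> B uminus (S, T) = (\<sigma> S, \<sigma> T)"
    unfolding \<sigma>_def by (rule acts_SPA_act[OF W(2) acts_uminus[OF p]])
  show "SPA_act \<Phi> B (uminus \<circ> BC2_s1) (S, T) = (\<sigma> (breve_S \<Phi> B S T), \<sigma> T)"
    by (rule acts_SPA_act[OF W(4) n[OF a1]])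
  show "SPA_act \<Phi> B (uminus \<circ> BC2_s2) (S, T) = (\<sigma> S, \<sigma> (bar_T \<Phi> B S T))"
    by (rule acts_SPA_act[OF W(6) n[OF a2]])
  show "SPA_act \<Phi> B (uminus \<circ> (BC2_s2 \<circ> BC2_s1)) (S, T) = (\<sigma> (breve_S \<Phi> B S T), bar_T \<Phi> B S T)"
    using acts_SPA_act[OF W(8) a] X by simp
qed

end

section \<open>Paths in the Dynkin diagram\<close>

lemma successively_nth: "successively P p \<Longrightarrow> Suc i < length p \<Longrightarrow> P (p ! i) (p ! Suc i)"
proof -
  assume s: "successively P p" and i: "Suc i < length p"
  have "successively P (take (Suc i) p @ drop (Suc i) p)" using s by simp
  then have "P (last (take (Suc i) p)) (hd (drop (Suc i) p))"
    using i by (subst (asm) successively_append_iff) auto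
  then show ?thesis using i by (simp add: take_Suc_conv_app_nth hd_drop_conv_nth)
qed

context based_roots
begin

text \<open>Both Cartan numbers are negative integers. If one of them is -1, a reflection produces
  the sum. If both are at most -2, the squared length of the sum is at most 0, so the sum vanishes,
  which is excluded.\<close>

lemma add_root:
  assumes "\<alpha> \<in> \<Phi>" "\<beta> \<in> \<Phi>" "\<alpha> \<bullet> \<beta> < 0" "\<alpha> \<noteq> - \<beta>" shows "\<alpha> + \<beta> \<in> \<Phi>"
proof -
  obtain m n :: int where mn: "cartan \<alpha> \<beta> = of_int m" "cartan \<beta> \<alpha> = of_int n"
    using cartan_Ints assms by (metis Ints_cases)
  have p: "\<alpha> \<bullet> \<alpha> > 0" "\<beta> \<bullet> \<beta> > 0" using assms(1,2) zero_notin by (auto intro: inner_gt_zero_iff[THEN iffD2])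
  have e: "2 * (\<alpha> \<bullet> \<beta>) = m * (\<beta> \<bullet> \<beta>)" "2 * (\<alpha> \<bullet> \<beta>) = n * (\<alpha> \<bullet> \<alpha>)"
    using p mn by (simp_all add: cartan_def inner_commute divide_simps)
  have neg: "m < 0" "n < 0"
    using e assms(3) p by (smt (verit) mult_nonneg_nonneg of_int_0_le_iff)+
  consider "m = -1" | "n = -1" | "m \<le> -2" "n \<le> -2" using neg by linarith
  then show ?thesis
  proof cases
    case 1
    then show ?thesis using refl_root[OF assms(2,1)] mn by (simp add: root_refl_def)
  next
    case 2
    then show ?thesis using refl_root[OF assms(1,2)] mn by (simp add: root_refl_def add.commute)
  next
    case 3
    then have "m * (\<beta> \<bullet> \<beta>) \<le> -2 * (\<beta> \<bullet> \<beta>)" "n * (\<alpha> \<bullet> \<alpha>) \<le> -2 * (\<alpha> \<bullet> \<alpha>)"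
      using p by (intro mult_right_mono; simp)+
    then have "(\<alpha> + \<beta>) \<bullet> (\<alpha> + \<beta>) \<le> 0"
      using e by (simp add: inner_add_left inner_add_right inner_commute)
    then have "\<alpha> + \<beta> = 0" by (metis inner_ge_zero inner_eq_zero_iff order_antisym)
    then show ?thesis using assms(4) by (simp add: eq_neg_iff_add_eq_0)
  qed
qed

definition dpath :: "'a list \<Rightarrow> bool" where
  "dpath p \<longleftrightarrow> p \<noteq> [] \<and> distinct p \<and> set p \<subseteq> B \<and> successively dynkin_adj p"

lemma dpath_append: "dpath (p @ q) \<Longrightarrow> p \<noteq> [] \<Longrightarrow> dpath p" "dpath (p @ q) \<Longrightarrow> q \<noteq> [] \<Longrightarrow> dpath q"
  by (auto simp: dpath_def successively_append_iff)

lemma dual_sum_set: "Y \<subseteq> B \<Longrightarrow> dual R \<bullet> (\<Sum>\<gamma>\<in>Y. \<gamma>) = real (card (R \<inter> Y))"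
proof -
  assume Y: "Y \<subseteq> B"
  then have f: "finite Y" using finite_base finite_subset by blast
  have "dual R \<bullet> (\<Sum>\<gamma>\<in>Y. \<gamma>) = (\<Sum>\<gamma>\<in>Y. if \<gamma> \<in> R then 1 else 0)"
    unfolding inner_sum_right using Y by (intro sum.cong refl dual_base) auto
  also have "\<dots> = real (card (Y \<inter> R))" using f by (simp flip: sum.inter_restrict)
  finally show ?thesis by (simp add: Int_commute)
qed

text \<open>A vertex x prepended to a path has nonpositive inner product with every later vertex and
  a negative one with the next, so it is at an obtuse angle to their sum and \<open>add_root\<close>
  applies. These sums are the test roots of the case analysis.\<close>

lemma dpath_root: "dpath p \<Longrightarrow> (\<Sum>\<gamma>\<in>set p. \<gamma>) \<in> \<Phi>"
proof (induction p)
  case (Cons x q)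
  show ?case
  proof (cases q)
    case Nil
    then show ?thesis using Cons base_subset by (auto simp: dpath_def)
  next
    case c: (Cons y r)
    have q: "dpath q" using dpath_append(2)[of "[x]" q] Cons.prems c by simp
    have x: "x \<in> B" "x \<notin> set q" and qB: "set q \<subseteq> B" and xy: "dynkin_adj x y"
      using Cons.prems c by (auto simp: dpath_def)
    let ?s = "\<Sum>\<gamma>\<in>set q. \<gamma>"
    have le: "x \<bullet> \<gamma> \<le> 0" if "\<gamma> \<in> set q" for \<gamma> using base_obtuse x qB that by blast
    have "x \<bullet> y < 0" using xy le[of y] c by (simp add: dynkin_adj_def)
    then have "(\<Sum>\<gamma>\<in>set q. x \<bullet> \<gamma>) < (\<Sum>\<gamma>\<in>set q. 0)"
      using le c by (intro sum_strict_mono_ex1) auto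
    then have "x \<bullet> ?s < 0" by (simp add: inner_sum_right)
    moreover have "x \<noteq> - ?s"
    proof
      assume "x = - ?s"
      then have "dual {x} \<bullet> x = - (dual {x} \<bullet> ?s)" by (metis inner_minus_right)
      then show False using x dual_sum_set[OF qB, of "{x}"] by (simp add: dual_base)
    qed
    ultimately have "x + ?s \<in> \<Phi>" using add_root x base_subset Cons.IH[OF q] by blast
    then show ?thesis using x by simp
  qed
qed (simp add: dpath_def)

lemma chi_path:
  assumes "dpath p" "R \<subseteq> B" shows "chi \<Phi> B R (\<Sum>\<gamma>\<in>set p. \<gamma>) = int (card (R \<inter> set p))"
proof -
  have "real_of_int (chi \<Phi> B R (\<Sum>\<gamma>\<in>set p. \<gamma>)) = real (card (R \<inter> set p))"
    using chi_real[OF root_lattice_root[OF dpath_root[OF assms(1)]] assms(2)] dual_sum_set[of "set p" R]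
      assms(1) by (simp add: dpath_def)
  then show ?thesis by linarith
qed

lemma orthogonal_span: "(\<And>y. y \<in> Y \<Longrightarrow> a \<bullet> y = 0) \<Longrightarrow> x \<in> span Y \<Longrightarrow> a \<bullet> x = 0"
  by (rule span_induct[of x Y "\<lambda>x. a \<bullet> x = 0"]) (simp_all add: subspace_hyperplane)

lemma wprod_span:
  assumes "set l \<subseteq> X \<union> Z" "\<And>x z. x \<in> X \<Longrightarrow> z \<in> Z \<Longrightarrow> z \<bullet> x = 0" "x \<in> span X"
  shows "wprod l x \<in> span X"
  using assms(1)
proof (induction l)
  case (Cons a l)
  have h: "wprod l x \<in> span X" using Cons by simp
  show ?case
  proof (cases "a \<in> X")
    case True
    then show ?thesis using h by (simp add: root_refl_def span_diff span_scale span_base)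
  next
    case False
    then have "a \<bullet> wprod l x = 0" using Cons.prems assms(2) orthogonal_span[OF _ h, of a] by auto
    then show ?thesis using h by (simp add: root_refl_orthogonal inner_commute)
  qed
qed (use assms(3) in simp)

text \<open>Every root is a word applied to a simple root. Letters from X preserve span X and
  letters from Z fix it pointwise, and likewise with X and Z exchanged, so the root stays in the
  span where the word starts.\<close>

lemma root_orthogonal_split:
  assumes B: "B = X \<union> Z" and o: "\<And>x z. x \<in> X \<Longrightarrow> z \<in> Z \<Longrightarrow> x \<bullet> z = 0" and b: "\<beta> \<in> \<Phi>"
  shows "\<beta> \<in> span X \<or> \<beta> \<in> span Z"
proof -
  obtain l \<gamma> where l: "set l \<subseteq> B" "\<gamma> \<in> B" "\<beta> = wprod l \<gamma>" using root_conjugate_simple[OF b] by blast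
  show ?thesis
  proof (cases "\<gamma> \<in> X")
    case True
    have "wprod l \<gamma> \<in> span X"
      using l B o True by (intro wprod_span[of l X Z]) (auto simp: inner_commute span_base)
    then show ?thesis using l by simp
  next
    case False
    have "wprod l \<gamma> \<in> span Z"
    proof (rule wprod_span[of l Z X])
      show "z \<bullet> x = 0" if "x \<in> Z" "z \<in> X" for x z using o[OF that(2,1)] .
    qed (use l B False in \<open>auto simp: span_base\<close>)
    then show ?thesis using l by simp
  qed
qed

text \<open>The vertices reachable from x are orthogonal to all others, since otherwise a path could
  be extended. If there were others, the roots would split into two nonempty orthogonal
  parts.\<close>

lemma dynkin_connected:
  assumes irr: "irreducible_roots \<Phi>" and x: "x \<in> B" and y: "y \<in> B"
  obtains p where "dpath p" "hd p = x" "last p = y"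
proof -
  define X where "X = {z\<in>B. \<exists>p. dpath p \<and> hd p = x \<and> last p = z}"
  have xX: "x \<in> X" using x by (auto simp: X_def dpath_def intro!: exI[of _ "[x]"])
  have orth: "a \<bullet> b = 0" if a: "a \<in> X" and b: "b \<in> B - X" for a b
  proof (rule ccontr)
    assume "a \<bullet> b \<noteq> 0"
    obtain p where p: "dpath p" "hd p = x" "last p = a" using a by (auto simp: X_def)
    have adj: "dynkin_adj a b" using \<open>a \<bullet> b \<noteq> 0\<close> a b by (auto simp: dynkin_adj_def)
    have "\<exists>q. dpath q \<and> hd q = x \<and> last q = b"
    proof (cases "b \<in> set p")
      case True
      \<comment> \<open>The path already visits b; cutting it there keeps it simple.\<close>
      then obtain p1 p2 where s: "p = p1 @ b # p2" by (meson split_list)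
      then have "dpath (p1 @ [b])" using dpath_append(1)[of "p1 @ [b]" p2] p by simp
      moreover have "hd (p1 @ [b]) = x" using p(2) s by (cases p1) auto
      ultimately show ?thesis by (intro exI[of _ "p1 @ [b]"]) simp
    next
      case False
      then have "dpath (p @ [b])" using p adj b by (auto simp: dpath_def successively_append_iff)
      then show ?thesis using p by (intro exI[of _ "p @ [b]"]) (auto simp: dpath_def)
    qed
    then show False using b by (auto simp: X_def)
  qed
  have sub: "X \<subseteq> B" by (auto simp: X_def)
  have "B - X = {}"
  proof (rule ccontr)
    assume ne: "B - X \<noteq> {}"
    let ?A = "\<Phi> \<inter> span X" and ?C = "\<Phi> \<inter> span (B - X)"
    have "?A \<union> ?C = \<Phi>" using root_orthogonal_split[of X "B - X"] orth sub by blast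
    moreover have "x \<in> ?A" using xX base_subset sub by (auto simp: span_base)
    moreover obtain z where "z \<in> B - X" using ne by blast
    then have "z \<in> ?C" using base_subset by (auto simp: span_base)
    moreover have "\<forall>u\<in>?A. \<forall>v\<in>?C. u \<bullet> v = 0"
    proof (intro ballI)
      fix u v assume u: "u \<in> ?A" and v: "v \<in> ?C"
      have "a \<bullet> v = 0" if "a \<in> X" for a using orthogonal_span[of "B - X" a v] orth[OF that] v by blast
      then show "u \<bullet> v = 0" using orthogonal_span[of X v u] u by (simp add: inner_commute)
    qed
    ultimately have "\<exists>A C. A \<noteq> {} \<and> C \<noteq> {} \<and> A \<union> C = \<Phi> \<and> (\<forall>u\<in>A. \<forall>v\<in>C. u \<bullet> v = 0)"
      by (intro exI[of _ ?A] exI[of _ ?C]) blast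
    then show False using irr by (simp add: irreducible_roots_def)
  qed
  then have "y \<in> X" using y by blast
  then show ?thesis using that by (auto simp: X_def)
qed

lemma dpath_stays:
  assumes "successively dynkin_adj p" "p \<noteq> []" "hd p \<in> X" "set p \<subseteq> X \<union> Z"
    and "\<And>x z. x \<in> X \<Longrightarrow> z \<in> Z \<Longrightarrow> x \<bullet> z = 0"
  shows "set p \<subseteq> X"
  using assms(1-4)
proof (induction p)
  case (Cons a p)
  show ?case
  proof (cases p)
    case (Cons b q)
    then have "b \<in> X"
      using Cons.prems assms(5)[of a b] by (auto simp: dynkin_adj_def)
    then show ?thesis using Cons.IH Cons.prems Cons by simp
  qed (use Cons in simp)
qed simp

end

locale irreducible_based_roots = highest_based_roots +
  assumes irr: "irreducible_roots \<Phi>"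
begin

subsection \<open>Type A\<close>

text \<open>The highest root is dominant, since its reflection in \<gamma> cannot have a larger
  coefficient at \<gamma>. Expanding its Cartan number with \<gamma> over the base gives the bound
  for all other simple roots together; their terms are nonnegative, so it holds for any subset
  N.\<close>

lemma neighbours_bound:
  assumes g: "\<gamma> \<in> B" and N: "N \<subseteq> B - {\<gamma>}"
  shows "(\<Sum>\<delta>\<in>N. (dual {\<delta>} \<bullet> \<mu>) * - cartan \<delta> \<gamma>) \<le> 2 * (dual {\<gamma>} \<bullet> \<mu>)"
proof -
  have "root_refl \<gamma> \<mu> \<in> \<Phi>" using refl_root g base_subset highest_root by blast
  then have "dual {\<gamma>} \<bullet> root_refl \<gamma> \<mu> \<le> dual {\<gamma>} \<bullet> \<mu>" using highest_coeff_ge g by blast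
  then have "cartan \<mu> \<gamma> \<ge> 0" using g by (simp add: root_refl_def inner_diff_right dual_base)
  have gg: "\<gamma> \<bullet> \<gamma> > 0" using base_nonzero[OF g] by simp
  have "cartan \<mu> \<gamma> = 2 * (\<gamma> \<bullet> \<mu>) / (\<gamma> \<bullet> \<gamma>)" by (simp add: cartan_def inner_commute)
  also have "\<gamma> \<bullet> \<mu> = (\<Sum>\<delta>\<in>B. (dual {\<delta>} \<bullet> \<mu>) * (\<gamma> \<bullet> \<delta>))" by (rule inner_expand[OF highest_span])
  also have "2 * \<dots> / (\<gamma> \<bullet> \<gamma>) = (\<Sum>\<delta>\<in>B. (dual {\<delta>} \<bullet> \<mu>) * cartan \<delta> \<gamma>)"
    by (simp add: cartan_def sum_distrib_left sum_divide_distrib inner_commute mult_ac)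
  also have "\<dots> = (dual {\<gamma>} \<bullet> \<mu>) * 2 + (\<Sum>\<delta>\<in>B - {\<gamma>}. (dual {\<delta>} \<bullet> \<mu>) * cartan \<delta> \<gamma>)"
    using g finite_base gg by (subst sum.remove[of _ \<gamma>]) (auto simp: cartan_def)
  finally have "(\<Sum>\<delta>\<in>B - {\<gamma>}. (dual {\<delta>} \<bullet> \<mu>) * - cartan \<delta> \<gamma>) \<le> 2 * (dual {\<gamma>} \<bullet> \<mu>)"
    using \<open>cartan \<mu> \<gamma> \<ge> 0\<close> by (simp add: sum_negf)
  moreover have "(\<Sum>\<delta>\<in>N. (dual {\<delta>} \<bullet> \<mu>) * - cartan \<delta> \<gamma>) \<le> (\<Sum>\<delta>\<in>B - {\<gamma>}. (dual {\<delta>} \<bullet> \<mu>) * - cartan \<delta> \<gamma>)"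
  proof (rule sum_mono2)
    fix \<delta> assume d: "\<delta> \<in> B - {\<gamma>} - N"
    have "cartan \<delta> \<gamma> \<le> 0" using base_obtuse[of \<delta> \<gamma>] g d gg by (simp add: cartan_def divide_le_0_iff)
    moreover have "dual {\<delta>} \<bullet> \<mu> \<ge> 1" using highest_coeff_ge_1 d by blast
    ultimately show "0 \<le> (dual {\<delta>} \<bullet> \<mu>) * - cartan \<delta> \<gamma>" by (intro mult_nonneg_nonneg) auto
  qed (use N finite_base in auto)
  ultimately show ?thesis by linarith
qed

lemma adj_cartan: "\<gamma> \<in> B \<Longrightarrow> \<delta> \<in> B \<Longrightarrow> dynkin_adj \<gamma> \<delta> \<Longrightarrow> - cartan \<delta> \<gamma> \<ge> 1"
proof -
  assume a: "\<gamma> \<in> B" "\<delta> \<in> B" "dynkin_adj \<gamma> \<delta>"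
  then have "cartan \<delta> \<gamma> < 0"
    using base_obtuse[of \<gamma> \<delta>] base_nonzero[OF a(1)]
    by (simp add: cartan_def dynkin_adj_def inner_commute divide_less_0_iff mult_less_0_iff)
  moreover obtain m :: int where "cartan \<delta> \<gamma> = of_int m" using a cartan_Ints base_subset by (meson Ints_cases subsetD)
  ultimately show ?thesis by simp
qed

lemma dynkin_adj_sym: "dynkin_adj x y \<longleftrightarrow> dynkin_adj y x"
  by (auto simp: dynkin_adj_def inner_commute)

text \<open>Each of the two neighbours contributes at least its own coefficient, hence at least 1,
  to a sum bounded by 2.\<close>

lemma neighbour_coeff_1:
  assumes g: "\<gamma> \<in> B" "dual {\<gamma>} \<bullet> \<mu> = 1" and d: "\<delta> \<in> B" "\<epsilon> \<in> B" "\<delta> \<noteq> \<epsilon>" "dynkin_adj \<gamma> \<delta>" "dynkin_adj \<gamma> \<epsilon>"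
  shows "dual {\<delta>} \<bullet> \<mu> = 1"
proof -
  have m: "(dual {\<zeta>} \<bullet> \<mu>) * - cartan \<zeta> \<gamma> \<ge> dual {\<zeta>} \<bullet> \<mu>" if "\<zeta> \<in> B" "dynkin_adj \<gamma> \<zeta>" for \<zeta>
    using mult_left_mono[OF adj_cartan[OF g(1) that], of "dual {\<zeta>} \<bullet> \<mu>"] highest_coeff_ge_1[OF that(1)] by simp
  have "{\<delta>, \<epsilon>} \<subseteq> B - {\<gamma>}" using d by (auto simp: dynkin_adj_def)
  from neighbours_bound[OF g(1) this] have "(dual {\<delta>} \<bullet> \<mu>) * - cartan \<delta> \<gamma> + (dual {\<epsilon>} \<bullet> \<mu>) * - cartan \<epsilon> \<gamma> \<le> 2"
    using d g by simp
  then show ?thesis using m[of \<delta>] m[of \<epsilon>] d highest_coeff_ge_1[of \<delta>] highest_coeff_ge_1[of \<epsilon>] by linarith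
qed

text \<open>A longest path exhausts the diagram, as each vertex has at most two neighbours; a chord would
  turn the diagram into a cycle, and then the highest root would be orthogonal to all roots.\<close>

lemma coeffs_1_type_A:
  assumes one: "\<And>\<gamma>. \<gamma> \<in> B \<Longrightarrow> dual {\<gamma>} \<bullet> \<mu> = 1"
  shows "type_A B (card B)"
proof -
  have deg: "card N \<le> 2" if N: "N \<subseteq> B" "\<And>\<delta>. \<delta> \<in> N \<Longrightarrow> dynkin_adj \<gamma> \<delta>" and g: "\<gamma> \<in> B" for N \<gamma>
  proof -
    have "real (card N) = (\<Sum>\<delta>\<in>N. 1)" by simp
    also have "\<dots> \<le> (\<Sum>\<delta>\<in>N. (dual {\<delta>} \<bullet> \<mu>) * - cartan \<delta> \<gamma>)"
      using adj_cartan[OF g] N one by (intro sum_mono) (auto simp: subset_iff)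
    also have "\<dots> \<le> 2" using neighbours_bound[OF g, of N] N one[OF g] by (auto simp: dynkin_adj_def)
    finally show ?thesis by simp
  qed
  \<comment> \<open>Reflecting \<delta> in \<gamma> puts minus their Cartan number at \<gamma>, and
    no coefficient of a root exceeds 1.\<close>
  have cart: "cartan \<delta> \<gamma> = (if dynkin_adj \<gamma> \<delta> then -1 else 0)" if "\<gamma> \<in> B" "\<delta> \<in> B" "\<delta> \<noteq> \<gamma>" for \<gamma> \<delta>
  proof (cases "dynkin_adj \<gamma> \<delta>")
    case True
    have "root_refl \<gamma> \<delta> \<in> \<Phi>" using that base_subset refl_root by blast
    then have "dual {\<gamma>} \<bullet> root_refl \<gamma> \<delta> \<le> 1" using highest_coeff_ge one that by metis
    then have "- cartan \<delta> \<gamma> \<le> 1" using that by (simp add: root_refl_def inner_diff_right dual_base)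
    then show ?thesis using adj_cartan[OF that(1,2) True] True by simp
  next
    case False
    then show ?thesis using that by (simp add: dynkin_adj_def cartan_def inner_commute)
  qed
  have no_cycle: False if all: "\<And>\<gamma>. \<gamma> \<in> B \<Longrightarrow> \<exists>N. N \<subseteq> B \<and> card N = 2 \<and> (\<forall>\<delta>\<in>N. dynkin_adj \<gamma> \<delta>)"
  proof -
    \<comment> \<open>With all coefficients 1, \<gamma> \<bullet> \<mu> is \<gamma> \<bullet>
      \<gamma>, plus two neighbours at -(\<gamma> \<bullet> \<gamma>)/2 each, plus nonpositive
      terms.\<close>
    have le: "\<gamma> \<bullet> \<mu> \<le> 0" if g: "\<gamma> \<in> B" for \<gamma>
    proof -
      obtain N where N: "N \<subseteq> B" "card N = 2" "\<forall>\<delta>\<in>N. dynkin_adj \<gamma> \<delta>" using all[OF g] by blast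
      then have gN: "\<gamma> \<notin> N" and fN: "finite N" by (auto simp: dynkin_adj_def intro: card_ge_0_finite)
      have z: "cartan \<delta> \<gamma> = -1" if "\<delta> \<in> N" for \<delta> using cart[OF g, of \<delta>] N that gN by auto
      have "\<gamma> \<bullet> \<mu> = (\<Sum>\<delta>\<in>B. (dual {\<delta>} \<bullet> \<mu>) * (\<gamma> \<bullet> \<delta>))" by (rule inner_expand[OF highest_span])
      also have "\<dots> = (\<Sum>\<delta>\<in>B. \<gamma> \<bullet> \<delta>)" using one by (intro sum.cong) auto
      also have "\<dots> = (\<Sum>\<delta>\<in>B - insert \<gamma> N. \<gamma> \<bullet> \<delta>) + (\<Sum>\<delta>\<in>insert \<gamma> N. \<gamma> \<bullet> \<delta>)"
        using g N finite_base by (intro sum.subset_diff) auto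
      also have "(\<Sum>\<delta>\<in>B - insert \<gamma> N. \<gamma> \<bullet> \<delta>) \<le> 0" using base_obtuse g by (intro sum_nonpos) auto
      also have "(\<Sum>\<delta>\<in>insert \<gamma> N. \<gamma> \<bullet> \<delta>) = \<gamma> \<bullet> \<gamma> + (\<Sum>\<delta>\<in>N. - (\<gamma> \<bullet> \<gamma>) / 2)"
      proof -
        have "\<gamma> \<bullet> \<delta> = - (\<gamma> \<bullet> \<gamma>) / 2" if "\<delta> \<in> N" for \<delta>
          using z[OF that] base_nonzero[OF g] by (simp add: cartan_def inner_commute divide_simps)
        then show ?thesis using gN fN by simp
      qed
      also have "\<dots> = 0" using N(2) by simp
      finally show ?thesis by simp
    qed
    have "\<mu> \<bullet> \<mu> = (\<Sum>\<delta>\<in>B. (dual {\<delta>} \<bullet> \<mu>) * (\<mu> \<bullet> \<delta>))" by (rule inner_expand[OF highest_span])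
    also have "\<dots> \<le> 0" using le one by (intro sum_nonpos) (simp add: inner_commute)
    finally have "\<mu> = 0" by (metis inner_ge_zero inner_eq_zero_iff order_antisym)
    then show False using highest_root zero_notin by simp
  qed
  obtain p where p: "dpath p" and max: "\<And>q. dpath q \<Longrightarrow> length q \<le> length p"
  proof -
    obtain b where b: "b \<in> B" using irr base_subset highest_root expand[OF highest_span] zero_notin
      by (cases "B = {}") auto
    have "dpath [b]" using b by (simp add: dpath_def)
    moreover have "length q \<le> card B" if "dpath q" for q
      using that finite_base card_mono[of B "set q"] by (auto simp: dpath_def distinct_card)
    ultimately show ?thesis using that ex_has_greatest_nat[of dpath "[b]" length "Suc (card B)"]
      by (metis less_Suc_eq_le)
  qed
  have pB: "set p \<subseteq> B" "distinct p" "p \<noteq> []" "successively dynkin_adj p" using p by (auto simp: dpath_def)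
  let ?n = "length p"
  have next_adj: "dynkin_adj (p ! i) (p ! Suc i)" if "Suc i < ?n" for i
    using successively_nth pB(4) that by blast
  then have prev_adj: "dynkin_adj (p ! i) (p ! (i - 1))" if "0 < i" "i < ?n" for i
    using that dynkin_adj_sym by (metis Suc_pred')
  have inB: "p ! i \<in> B" if "i < ?n" for i using that pB nth_mem by blast
  have nth_ne: "p ! i \<noteq> p ! j" if "i < ?n" "j < ?n" "i \<noteq> j" for i j
    using that pB(2) nth_eq_iff_index_eq by blast
  have interior: "z = p ! (i - 1) \<or> z = p ! Suc i"
    if "z \<in> B" "dynkin_adj (p ! i) z" "0 < i" "Suc i < ?n" for i z
  proof (rule ccontr)
    assume "\<not> ?thesis"
    moreover have "p ! (i - 1) \<noteq> p ! Suc i" using that by (intro nth_ne) auto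
    ultimately have "card {z, p ! (i - 1), p ! Suc i} = 3" by simp
    moreover have "card {z, p ! (i - 1), p ! Suc i} \<le> 2"
      using that next_adj[of i] prev_adj[of i] inB by (intro deg[of _ "p ! i"]) auto
    ultimately show False by simp
  qed
  have nbr_in: "z \<in> set p" if z: "z \<in> B" "dynkin_adj (p ! i) z" "i < ?n" for i z
  proof (rule ccontr)
    assume nz: "z \<notin> set p"
    consider "i = 0" | "Suc i = ?n" | "0 < i" "Suc i < ?n" using z(3) by linarith
    then show False
    proof cases
      case 1
      then have "dpath (z # p)" using z nz pB dynkin_adj_sym
        by (auto simp: dpath_def successively_Cons hd_conv_nth)
      then show False using max by fastforce
    next
      case 2
      then have "last p = p ! i" using pB(3) by (metis diff_Suc_1 last_conv_nth)
      then have "dpath (p @ [z])" using z nz pB by (auto simp: dpath_def successively_append_iff)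
      then show False using max by fastforce
    next
      case 3
      then show False using interior[OF z(1,2) 3] nz z(3) by auto
    qed
  qed
  have all: "set p = B"
  proof (rule ccontr)
    assume "set p \<noteq> B"
    then obtain b where b: "b \<in> B - set p" using pB by blast
    \<comment> \<open>A path from the start of p to a vertex off p has to step from p to an adjacent
      vertex outside, against \<open>nbr_in\<close>.\<close>
    obtain q where q: "dpath q" "hd q = hd p" "last q = b"
      using dynkin_connected[OF irr, of "hd p" b] b pB by (metis Diff_iff hd_in_set subsetD)
    have "set q \<subseteq> set p"
    proof (rule dpath_stays[of q "set p" "B - set p"])
      fix x z assume xz: "x \<in> set p" "z \<in> B - set p"
      then obtain i where "i < ?n" "x = p ! i" by (metis in_set_conv_nth)
      then have "\<not> dynkin_adj x z" using nbr_in xz by blast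
      then show "x \<bullet> z = 0" using xz by (auto simp: dynkin_adj_def)
    qed (use q pB in \<open>auto simp: dpath_def\<close>)
    then show False using q b last_in_set[of q] by (auto simp: dpath_def)
  qed
  have chord: "j = Suc i" if ij: "i < j" "j < ?n" "dynkin_adj (p ! i) (p ! j)" for i j
  proof (rule ccontr)
    assume ne: "j \<noteq> Suc i"
    \<comment> \<open>An interior vertex of p has no neighbours but its predecessor and successor,
      so a chord can only join the two ends.\<close>
    have i0: "i = 0"
    proof (rule ccontr)
      assume "i \<noteq> 0"
      then have "p ! j = p ! (i - 1) \<or> p ! j = p ! Suc i" using ij by (intro interior inB) auto
      moreover have "i - 1 < ?n" "Suc i < ?n" "j \<noteq> i - 1" using ij by auto
      ultimately show False using nth_ne[of j "i - 1"] nth_ne[of j "Suc i"] ij ne by auto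
    qed
    have jn: "Suc j = ?n"
    proof (rule ccontr)
      assume "Suc j \<noteq> ?n"
      then have "p ! i = p ! (j - 1) \<or> p ! i = p ! Suc j"
        using ij dynkin_adj_sym by (intro interior inB) auto
      moreover have "j - 1 < ?n" "Suc j < ?n" "i \<noteq> j - 1" using ij ne \<open>Suc j \<noteq> ?n\<close> by auto
      ultimately show False using nth_ne[of i "j - 1"] nth_ne[of i "Suc j"] ij by auto
    qed
    \<comment> \<open>The chord supplies the second neighbour at each end, so now every vertex has
      two.\<close>
    show False
    proof (rule no_cycle)
      fix \<gamma> assume "\<gamma> \<in> B"
      then obtain k where k: "k < ?n" "\<gamma> = p ! k" using all by (metis in_set_conv_nth)
      have two: "\<exists>N. N \<subseteq> B \<and> card N = 2 \<and> (\<forall>\<delta>\<in>N. dynkin_adj \<gamma> \<delta>)"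
        if "a < ?n" "b < ?n" "a \<noteq> b" "dynkin_adj \<gamma> (p ! a)" "dynkin_adj \<gamma> (p ! b)" for a b
        using that inB nth_ne by (intro exI[of _ "{p ! a, p ! b}"]) auto
      consider "k = 0" | "k = j" | "0 < k" "Suc k < ?n" using k(1) jn by linarith
      then show "\<exists>N. N \<subseteq> B \<and> card N = 2 \<and> (\<forall>\<delta>\<in>N. dynkin_adj \<gamma> \<delta>)"
      proof cases
        case 1
        then show ?thesis using ij ne i0 k next_adj[of 0] by (intro two[of 1 j]) auto
      next
        case 2
        then show ?thesis using ij ne i0 k prev_adj[of j] dynkin_adj_sym by (intro two[of 0 "j - 1"]) auto
      next
        case 3
        then show ?thesis using k next_adj[of k] prev_adj[of k] by (intro two[of "k - 1" "Suc k"]) auto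
      qed
    qed
  qed
  have "cartan (p ! i) (p ! j) = (if i = j then 2 else if i = j + 1 \<or> j = i + 1 then -1 else 0)"
    if "i < ?n" "j < ?n" for i j
  proof (cases "i = j")
    case True
    then show ?thesis using base_nonzero[OF inB[OF that(1)]] by (simp add: cartan_def)
  next
    case False
    have "dynkin_adj (p ! j) (p ! i) \<longleftrightarrow> i = j + 1 \<or> j = i + 1"
      using chord[of i j] chord[of j i] next_adj[of i] next_adj[of j] dynkin_adj_sym that False
      by (metis Suc_eq_plus1 linorder_neqE_nat)
    then show ?thesis using cart[OF inB[OF that(2)] inB[OF that(1)] nth_ne[OF that False]] False by simp
  qed
  moreover have "?n = card B" using all pB(2) distinct_card by metis
  ultimately show ?thesis unfolding type_A_def using all pB(2) by (intro exI[of _ p]) auto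
qed

text \<open>The value 1 spreads along paths from \<gamma>. Beyond the first step, the preceding
  vertex serves as the other neighbour in \<open>neighbour_coeff_1\<close>; at the first step
  \<delta> or \<epsilon> does, whichever is not the next vertex.\<close>

lemma interior_coeff_1_type_A:
  assumes g: "\<gamma> \<in> B" "dual {\<gamma>} \<bullet> \<mu> = 1"
    and d: "\<delta> \<in> B" "\<epsilon> \<in> B" "\<delta> \<noteq> \<epsilon>" "dynkin_adj \<gamma> \<delta>" "dynkin_adj \<gamma> \<epsilon>"
  shows "type_A B (card B)"
proof (rule coeffs_1_type_A)
  fix x assume "x \<in> B"
  then obtain p where p: "dpath p" "hd p = \<gamma>" "last p = x" using dynkin_connected[OF irr g(1)] by metis
  have pB: "set p \<subseteq> B" "distinct p" "p \<noteq> []" "successively dynkin_adj p" using p by (auto simp: dpath_def)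
  have "dual {p ! i} \<bullet> \<mu> = 1" if "i < length p" for i
    using that
  proof (induction i)
    case 0
    then show ?case using p g by (simp add: hd_conv_nth)
  next
    case (Suc i)
    have inB: "p ! j \<in> B" if "j < length p" for j using that pB nth_mem by blast
    have adj: "dynkin_adj (p ! i) (p ! Suc i)" using successively_nth pB(4) Suc.prems by blast
    show ?case
    proof (cases i)
      case 0
      then have "p ! i = \<gamma>" using p pB by (simp add: hd_conv_nth)
      then show ?thesis
        using neighbour_coeff_1[OF g inB[OF Suc.prems], of \<delta>] neighbour_coeff_1[OF g inB[OF Suc.prems], of \<epsilon>]
          adj d by (cases "p ! Suc i = \<delta>") auto
    next
      case (Suc k)
      have "dynkin_adj (p ! i) (p ! k)"
        using successively_nth[OF pB(4), of k] Suc Suc.prems by (simp add: dynkin_adj_sym[of "p ! k"])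
      moreover have "p ! Suc i \<noteq> p ! k" using Suc Suc.prems pB(2) by (simp add: nth_eq_iff_index_eq)
      ultimately show ?thesis
        using Suc.IH Suc Suc.prems adj neighbour_coeff_1[of "p ! i" "p ! Suc i" "p ! k"] inB by simp
    qed
  qed
  moreover have "x = p ! (length p - 1)" using p pB by (simp add: last_conv_nth)
  ultimately show "dual {x} \<bullet> \<mu> = 1" using pB(3) by simp
qed

end

section \<open>Values on the highest root and on paths\<close>

context highest_based_roots
begin

lemma highest_Pos: "\<mu> \<in> Pos"
  using highest_root highest_coeff_ge_1 by (fastforce simp: Pos_iff)

lemma chi_real_sum: "x \<in> L \<Longrightarrow> R \<subseteq> B \<Longrightarrow> real_of_int (chi \<Phi> B R x) = (\<Sum>\<gamma>\<in>R. dual {\<gamma>} \<bullet> x)"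
  using chi_real dual_sum lattice_span by metis

lemma chi_le_highest: assumes "\<beta> \<in> \<Phi>" "R \<subseteq> B" shows "chi \<Phi> B R \<beta> \<le> chi \<Phi> B R \<mu>"
proof -
  have "real_of_int (chi \<Phi> B R \<beta>) \<le> real_of_int (chi \<Phi> B R \<mu>)"
    using assms highest_coeff_ge[OF assms(1)]
    by (auto simp: chi_real_sum root_lattice_root highest_lattice intro!: sum_mono)
  then show ?thesis by linarith
qed

lemma card_le_chi_highest: assumes "R \<subseteq> B" shows "int (card R) \<le> chi \<Phi> B R \<mu>"
proof -
  have "real (card R) = (\<Sum>\<gamma>\<in>R. 1)" by simp
  also have "\<dots> \<le> (\<Sum>\<gamma>\<in>R. dual {\<gamma>} \<bullet> \<mu>)" using assms highest_coeff_ge_1 by (intro sum_mono) auto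
  also have "\<dots> = real_of_int (chi \<Phi> B R \<mu>)" using chi_real_sum[OF highest_lattice assms] by simp
  finally show ?thesis by linarith
qed

lemma chi_highest_union:
  "R \<subseteq> B \<Longrightarrow> Q \<subseteq> B \<Longrightarrow> R \<inter> Q = {} \<Longrightarrow> chi \<Phi> B (R \<union> Q) \<mu> = chi \<Phi> B R \<mu> + chi \<Phi> B Q \<mu>"
  by (rule chi_union[OF highest_lattice])

lemma chi_highest_mono: assumes "R \<subseteq> Q" "Q \<subseteq> B" shows "chi \<Phi> B R \<mu> \<le> chi \<Phi> B Q \<mu>"
proof -
  have "chi \<Phi> B (R \<union> (Q - R)) \<mu> = chi \<Phi> B R \<mu> + chi \<Phi> B (Q - R) \<mu>"
    using assms by (intro chi_highest_union) auto
  moreover have "R \<union> (Q - R) = Q" using assms by blast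
  moreover have "chi \<Phi> B (Q - R) \<mu> \<ge> 0" using assms by (intro chi_Pos_nonneg[OF highest_Pos]) auto
  ultimately show ?thesis by simp
qed

lemma long_elt_ge:
  assumes X: "X \<subseteq> B" and b: "\<beta> \<in> \<Phi>" and g: "\<gamma> \<in> B - X" and R: "R \<subseteq> B"
    and e: "\<And>\<delta>. \<delta> \<in> B - X \<Longrightarrow> dual {\<delta>} \<bullet> \<beta> = (if \<delta> = \<gamma> then 1 else 0)"
  shows "chi \<Phi> B R \<beta> \<le> chi \<Phi> B R (long_elt \<Phi> X \<gamma>)"
proof -
  have L: "long_elt \<Phi> X \<gamma> \<in> L"
    using root_lattice_root[OF Pos_root[OF long_elt_base_Pos[OF X g]]] .
  have "(\<Sum>\<delta>\<in>R. dual {\<delta>} \<bullet> \<beta>) \<le> (\<Sum>\<delta>\<in>R. dual {\<delta>} \<bullet> long_elt \<Phi> X \<gamma>)"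
    using long_elt_highest[OF X b g e] R by (intro sum_mono) auto
  then have "real_of_int (chi \<Phi> B R \<beta>) \<le> real_of_int (chi \<Phi> B R (long_elt \<Phi> X \<gamma>))"
    using chi_real_sum[OF root_lattice_root[OF b] R] chi_real_sum[OF L R] by simp
  then show ?thesis by linarith
qed

text \<open>A path whose only vertex outside X is \<gamma> gives a root to compare with w_X
  \<gamma>, so values at w_X \<gamma> are bounded below by counting vertices.\<close>

lemma long_elt_path:
  assumes X: "X \<subseteq> B" and q: "dpath q" "(B - X) \<inter> set q = {\<gamma>}" and R: "R \<subseteq> B"
  shows "int (card (R \<inter> set q)) \<le> chi \<Phi> B R (long_elt \<Phi> X \<gamma>)"
proof -
  have qB: "set q \<subseteq> B" using q by (simp add: dpath_def)
  have "chi \<Phi> B R (\<Sum>\<gamma>\<in>set q. \<gamma>) \<le> chi \<Phi> B R (long_elt \<Phi> X \<gamma>)"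
  proof (rule long_elt_ge[OF X dpath_root[OF q(1)] _ R])
    show "\<gamma> \<in> B - X" using q by blast
    fix \<delta> assume "\<delta> \<in> B - X"
    then have "{\<delta>} \<inter> set q = (if \<delta> = \<gamma> then {\<delta>} else {})" using q(2) by auto
    then show "dual {\<delta>} \<bullet> (\<Sum>\<gamma>\<in>set q. \<gamma>) = (if \<delta> = \<gamma> then 1 else 0)"
      using dual_sum_set[OF qB, of "{\<delta>}"] by simp
  qed
  then show ?thesis using chi_path[OF q(1) R] by simp
qed

lemma dpath_split:
  assumes "dpath q" "x \<in> set q" "x \<noteq> hd q" "x \<noteq> last q"
  obtains q1 q2 where "q = q1 @ x # q2" "q1 \<noteq> []" "q2 \<noteq> []" "dpath (q1 @ [x])" "dpath (x # q2)"
    "hd q \<in> set q1" "last q \<in> set q2" "x \<notin> set q1" "x \<notin> set q2" "set q1 \<inter> set q2 = {}"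
proof -
  obtain q1 q2 where s: "q = q1 @ x # q2" using assms(2) by (meson split_list)
  have ne: "q1 \<noteq> []" "q2 \<noteq> []" using s assms(3,4) by auto
  have d: "distinct q" using assms(1) by (simp add: dpath_def)
  have "dpath (q1 @ [x])" using dpath_append(1)[of "q1 @ [x]" q2] assms(1) s by simp
  moreover have "dpath (x # q2)" using dpath_append(2)[of q1 "x # q2"] assms(1) s by simp
  moreover have "hd q \<in> set q1" "last q \<in> set q2" using s ne by auto
  ultimately show ?thesis using that[OF s ne] d s by auto
qed

text \<open>Applied in this form: a path with two vertices of T has exactly two vertices of
  S.\<close>

lemma SPA_path:
  assumes "(S, T) \<in> SPA \<Phi> B" "dpath q"
  shows "\<bar>int (card (T \<inter> set q))\<bar> + \<bar>int (card (S \<inter> set q)) - int (card (T \<inter> set q))\<bar> \<le> 2"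
  using SPA_root_values[OF assms(1) dpath_root[OF assms(2)]] SPA_subsets[OF assms(1)]
  by (simp add: chi_path[OF assms(2)])

end

section \<open>Explicit forms of the two sets\<close>

context irreducible_based_roots
begin

lemma path_ex:
  assumes "x \<in> B" "y \<in> B"
  obtains q where "dpath q" "hd q = x" "last q = y" "x \<in> set q" "y \<in> set q"
proof -
  obtain q where q: "dpath q" "hd q = x" "last q = y" using dynkin_connected[OF irr assms] by metis
  then have "x \<in> set q" "y \<in> set q" by (auto simp: dpath_def)
  then show ?thesis using that q by blast
qed

context
  fixes S T assumes p: "(S, T) \<in> SPA \<Phi> B"
begin

lemma finite_ST: "finite S" "finite T"
  using SPA_subsets[OF p] finite_base finite_subset by blast+

lemma chi_S_highest_le: "chi \<Phi> B S \<mu> \<le> 2"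
  using SPA_root_values[OF p highest_root] by linarith

lemma chi_diff_highest: "chi \<Phi> B (S - T) \<mu> \<in> {0, 1, 2}"
proof -
  have "0 \<le> chi \<Phi> B (S - T) \<mu>" using SPA_subsets[OF p] by (intro chi_Pos_nonneg[OF highest_Pos]) auto
  moreover have "chi \<Phi> B (S - T) \<mu> \<le> chi \<Phi> B S \<mu>"
    using SPA_subsets[OF p] by (intro chi_highest_mono) auto
  ultimately show ?thesis using chi_S_highest_le by auto
qed

lemma card_S_le: "card S \<le> 2"
  using card_le_chi_highest[of S] chi_S_highest_le SPA_subsets[OF p] by linarith

lemma breve_S_eq:
  "breve_S \<Phi> B S T = diag_aut \<Phi> (B - T) ` (S - T) \<union>
    {\<gamma>\<in>T. chi \<Phi> B (S - T) (long_elt \<Phi> (B - T) \<gamma>) + (if \<gamma> \<in> S then 1 else 0) = 1}"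
proof -
  have "chi \<Phi> B (S \<inter> T) \<gamma> = (if \<gamma> \<in> S then 1 else 0)" if "\<gamma> \<in> T" for \<gamma>
    using that SPA_subsets[OF p] by (subst chi_simple) auto
  moreover have "B - T \<subseteq> B" by blast
  ultimately show ?thesis by (auto simp: breve_S_def long_elt_ext_eq)
qed

lemma breve_value:
  assumes "\<gamma> \<in> T"
  shows "chi \<Phi> B (S - T) (long_elt \<Phi> (B - T) \<gamma>) + (if \<gamma> \<in> S then 1 else 0) \<in> {1, 2}"
proof -
  have "chi \<Phi> B (S \<inter> T) \<gamma> = (if \<gamma> \<in> S then 1 else 0)"
    using assms SPA_subsets[OF p] by (subst chi_simple) auto
  then show ?thesis using breve_value_range[OF p assms] by simp
qed

text \<open>All coefficients of \<mu> are positive, so the value 0 means that S - T is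
  empty.\<close>

lemma breve_case_0: assumes z: "chi \<Phi> B (S - T) \<mu> = 0" shows "breve_S \<Phi> B S T = S"
proof -
  have "int (card (S - T)) \<le> 0"
    using card_le_chi_highest[of "S - T"] z SPA_subsets[OF p] by auto
  then have e: "S - T = {}" using finite_ST by simp
  have "chi \<Phi> B {} (long_elt \<Phi> (B - T) \<gamma>) = 0" if "\<gamma> \<in> T" for \<gamma>
    using weyl_lattice[OF base_lattice long_elt_weyl, of \<gamma> "B - T"] that SPA_subsets[OF p]
    by (auto simp: chi_def)
  then show ?thesis unfolding breve_S_eq e using e by auto
qed

text \<open>A root \<gamma> of T lies in breve S iff \<chi>_{S - T}(w \<gamma>) is 1, when \<gamma>
  is outside S, or 0, when \<gamma> is in S. Outside S the value is 1 or 2 and at most the value 1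
  at \<mu>. In S, a path from \<gamma> to S - T that meets no other vertex of T excludes 0.\<close>

lemma breve_case_1:
  assumes one: "chi \<Phi> B (S - T) \<mu> = 1"
  shows "breve_S \<Phi> B S T = diag_aut \<Phi> (B - T) ` (S - T) \<union> (T - S)"
proof -
  let ?w = "long_elt \<Phi> (B - T)"
  have X: "B - T \<subseteq> B" and BX: "B - (B - T) = T" and sub: "S - T \<subseteq> B" using SPA_subsets[OF p] by auto
  have in1: "chi \<Phi> B (S - T) (?w \<gamma>) = 1" if g: "\<gamma> \<in> T - S" for \<gamma>
  proof -
    have "?w \<gamma> \<in> \<Phi>" using weyl_root[OF long_elt_weyl[OF X]] g SPA_subsets[OF p] base_subset by blast
    then have "chi \<Phi> B (S - T) (?w \<gamma>) \<le> 1" using chi_le_highest[OF _ sub] one by metis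
    then show ?thesis using breve_value[of \<gamma>] g by auto
  qed
  have in2: "chi \<Phi> B (S - T) (?w \<gamma>) \<ge> 1" if g: "\<gamma> \<in> T" "\<gamma> \<in> S" for \<gamma>
  proof -
    have "S - T \<noteq> {}"
    proof
      assume "S - T = {}"
      with one show False by (simp only: chi_def) (simp add: highest_lattice)
    qed
    then obtain \<alpha> where a: "\<alpha> \<in> S" "\<alpha> \<notin> T" by blast
    have "\<exists>q. dpath q \<and> T \<inter> set q = {\<gamma>} \<and> \<alpha> \<in> set q"
    proof (cases "T = {\<gamma>}")
      case True
      obtain q where "dpath q" "hd q = \<gamma>" "last q = \<alpha>" "\<gamma> \<in> set q" "\<alpha> \<in> set q"
        using path_ex[of \<gamma> \<alpha>] a g SPA_subsets[OF p] by blast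
      then show ?thesis using True by blast
    next
      case False
      \<comment> \<open>The path from \<gamma> to \<nu> has two vertices of T, hence two of S, hence
        all of S, which has at most two elements. So \<alpha> lies strictly inside, and the part
        from \<gamma> to \<alpha> avoids \<nu>.\<close>
      then obtain \<nu> where n: "\<nu> \<in> T" "\<nu> \<noteq> \<gamma>" using g by blast
      obtain q where q: "dpath q" "hd q = \<gamma>" "last q = \<nu>" "\<gamma> \<in> set q" "\<nu> \<in> set q"
        using path_ex[of \<gamma> \<nu>] n g SPA_subsets[OF p] by blast
      have "card {\<gamma>, \<nu>} \<le> card (T \<inter> set q)" using q n g by (intro card_mono) auto
      then have "card (T \<inter> set q) = 2" "card (S \<inter> set q) = 2"
        using SPA_path[OF p q(1)] n(2) by auto
      then have Teq: "T \<inter> set q = {\<gamma>, \<nu>}" and Seq: "S \<inter> set q = S"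
        using q n g card_S_le finite_ST
        by (intro card_subset_eq[symmetric] card_seteq; auto)+
      have "\<alpha> \<in> set q" using a Seq by blast
      moreover have "\<alpha> \<noteq> \<gamma>" "\<alpha> \<noteq> \<nu>" using a g n by auto
      ultimately obtain q1 q2 where s: "q = q1 @ \<alpha> # q2" "dpath (q1 @ [\<alpha>])" "hd q \<in> set q1"
        "last q \<in> set q2" "set q1 \<inter> set q2 = {}"
        using dpath_split[OF q(1), of \<alpha>] q(2,3) by metis
      have "T \<inter> set (q1 @ [\<alpha>]) = {\<gamma>}" using s q(2,3) a g Teq by auto
      then show ?thesis using s(2) by (intro exI[of _ "q1 @ [\<alpha>]"]) simp
    qed
    then obtain q where q: "dpath q" "T \<inter> set q = {\<gamma>}" "\<alpha> \<in> set q" by blast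
    have "int (card ((S - T) \<inter> set q)) \<le> chi \<Phi> B (S - T) (?w \<gamma>)"
      using long_elt_path[OF X q(1) _ sub, of \<gamma>] q(2) unfolding BX by simp
    moreover have "card ((S - T) \<inter> set q) > 0" using a q(3) by (subst card_gt_0_iff) auto
    ultimately show ?thesis by linarith
  qed
  have "{\<gamma>\<in>T. chi \<Phi> B (S - T) (?w \<gamma>) + (if \<gamma> \<in> S then 1 else 0) = 1} = T - S"
  proof (intro set_eqI)
    fix \<gamma>
    show "\<gamma> \<in> {\<gamma>\<in>T. chi \<Phi> B (S - T) (?w \<gamma>) + (if \<gamma> \<in> S then 1 else 0) = 1} \<longleftrightarrow> \<gamma> \<in> T - S"
      using in1[of \<gamma>] in2[of \<gamma>] by auto
  qed
  then show ?thesis unfolding breve_S_eq by simp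
qed

text \<open>The value 2 exhausts the bound \<chi>_S(\<mu>) \<le> 2, so S and T are disjoint. A root
  \<gamma> of T in breve S would stand there beside \<sigma>(S - T); the same bound for the new pair
  then leaves \<gamma> the coefficient 1 in \<mu> and S a single element. Neither T = {\<gamma>} nor
  a second root in T is compatible with that.\<close>

lemma breve_case_2:
  assumes two: "chi \<Phi> B (S - T) \<mu> = 2"
  shows "breve_S \<Phi> B S T = diag_aut \<Phi> (B - T) ` (S - T)"
proof -
  let ?w = "long_elt \<Phi> (B - T)" and ?\<sigma> = "diag_aut \<Phi> (B - T)"
  have X: "B - T \<subseteq> B" and BX: "B - (B - T) = T" and sub: "S - T \<subseteq> B" using SPA_subsets[OF p] by auto
  have "chi \<Phi> B ((S - T) \<union> (S \<inter> T)) \<mu> = chi \<Phi> B (S - T) \<mu> + chi \<Phi> B (S \<inter> T) \<mu>"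
    using SPA_subsets[OF p] by (intro chi_highest_union) auto
  then have "chi \<Phi> B (S \<inter> T) \<mu> \<le> 0" using chi_S_highest_le two by (simp add: Un_Diff_Int)
  moreover have "int (card (S \<inter> T)) \<le> chi \<Phi> B (S \<inter> T) \<mu>"
    using SPA_subsets[OF p] by (intro card_le_chi_highest) auto
  ultimately have "card (S \<inter> T) = 0" by linarith
  then have disj: "S \<inter> T = {}" using finite_ST by simp
  have "False" if g: "\<gamma> \<in> T" and m: "chi \<Phi> B (S - T) (?w \<gamma>) + (if \<gamma> \<in> S then 1 else 0) = 1" for \<gamma>
  proof -
    have gB: "\<gamma> \<in> B" using g SPA_subsets[OF p] by blast
    have "\<gamma> \<notin> S" using g disj by blast
    with m have m1: "chi \<Phi> B (S - T) (?w \<gamma>) = 1" by simp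
    have p': "(breve_S \<Phi> B S T, T) \<in> SPA \<Phi> B" using acts_s1[OF p] by (simp add: acts_def)
    have sB: "?\<sigma> ` (S - T) \<subseteq> B - T" using diag_aut_image_subset[OF X] SPA_subsets[OF p] by blast
    have "inj_on ?\<sigma> (S - T)" by (metis inj_onI diag_aut_diag_aut[OF X])
    then have c: "card (?\<sigma> ` (S - T)) = card (S - T)" by (rule card_image)
    have "{\<gamma>} \<union> ?\<sigma> ` (S - T) \<subseteq> breve_S \<Phi> B S T" unfolding breve_S_eq using g m by auto
    then have "chi \<Phi> B ({\<gamma>} \<union> ?\<sigma> ` (S - T)) \<mu> \<le> chi \<Phi> B (breve_S \<Phi> B S T) \<mu>"
      using SPA_subsets[OF p'] by (intro chi_highest_mono)
    also have "\<dots> \<le> 2" using SPA_root_values[OF p' highest_root] by linarith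
    also have "chi \<Phi> B ({\<gamma>} \<union> ?\<sigma> ` (S - T)) \<mu> = chi \<Phi> B {\<gamma>} \<mu> + chi \<Phi> B (?\<sigma> ` (S - T)) \<mu>"
      using gB sB g by (intro chi_highest_union) auto
    finally have "chi \<Phi> B {\<gamma>} \<mu> + chi \<Phi> B (?\<sigma> ` (S - T)) \<mu> \<le> 2" .
    moreover have "int (card (?\<sigma> ` (S - T))) \<le> chi \<Phi> B (?\<sigma> ` (S - T)) \<mu>"
      using sB by (intro card_le_chi_highest) blast
    ultimately have le: "chi \<Phi> B {\<gamma>} \<mu> + int (card (S - T)) \<le> 2" unfolding c by linarith
    have "S - T \<noteq> {}"
    proof
      assume "S - T = {}"
      with two show False by (simp only: chi_def) (simp add: highest_lattice)
    qed
    then have pos: "card (S - T) \<ge> 1" using finite_ST by (simp add: Suc_le_eq card_gt_0_iff)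
    have g1: "chi \<Phi> B {\<gamma>} \<mu> \<ge> 1" using card_le_chi_highest[of "{\<gamma>}"] gB by simp
    have cS: "card S \<le> 1" using le g1 disj by (simp add: Diff_triv)
    have gm: "chi \<Phi> B {\<gamma>} \<mu> = 1" using le g1 pos by linarith
    then have Dg: "dual {\<gamma>} \<bullet> \<mu> = 1" using chi_real[OF highest_lattice, of "{\<gamma>}"] gB by simp
    show False
    proof (cases "T = {\<gamma>}")
      case True
      \<comment> \<open>Here \<mu> itself is a root whose part outside B - T is \<gamma>, so w
        \<gamma> is at least \<mu> and has value at least 2.\<close>
      have "chi \<Phi> B (S - T) \<mu> \<le> chi \<Phi> B (S - T) (?w \<gamma>)"
        using True Dg gB by (intro long_elt_ge[OF X highest_root _ sub]) auto
      then show False using two m1 by simp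
    next
      case False
      then obtain \<nu> where n: "\<nu> \<in> T" "\<nu> \<noteq> \<gamma>" using g by blast
      obtain q where q: "dpath q" "hd q = \<gamma>" "last q = \<nu>" "\<gamma> \<in> set q" "\<nu> \<in> set q"
        using path_ex[of \<gamma> \<nu>] n g SPA_subsets[OF p] by blast
      \<comment> \<open>Two vertices of T on a path require two of S, but S has at most one
        element.\<close>
      have "card {\<gamma>, \<nu>} \<le> card (T \<inter> set q)" using q n g by (intro card_mono) auto
      then have "card (S \<inter> set q) = 2" using SPA_path[OF p q(1)] n(2) by auto
      moreover have "card (S \<inter> set q) \<le> card S" using finite_ST by (intro card_mono) auto
      ultimately show False using cS by simp
    qed
  qed
  then have "{\<gamma>\<in>T. chi \<Phi> B (S - T) (?w \<gamma>) + (if \<gamma> \<in> S then 1 else 0) = 1} = {}" by blast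
  then show ?thesis unfolding breve_S_eq by (simp only: Un_empty_right)
qed

lemma bar_T_eq:
  "bar_T \<Phi> B S T = diag_aut \<Phi> (B - S) ` (T - S) \<union>
    {\<gamma>\<in>S - T. chi \<Phi> B (T - S) (long_elt \<Phi> (B - S) \<gamma>) = 0}"
proof -
  have X: "B - S \<subseteq> B" and sub: "T - S \<subseteq> B" using SPA_subsets[OF p] by auto
  have "root_supp B (long_elt \<Phi> (B - S) \<gamma>) \<inter> (T - S) = {} \<longleftrightarrow>
    chi \<Phi> B (T - S) (long_elt \<Phi> (B - S) \<gamma>) = 0" if "\<gamma> \<in> S - T" for \<gamma>
  proof -
    have "long_elt \<Phi> (B - S) \<gamma> \<in> Pos" using that SPA_subsets[OF p] by (intro long_elt_base_Pos[OF X]) auto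
    then show ?thesis using chi_zero_iff_supp[OF p _ sub] by simp
  qed
  then show ?thesis by (auto simp: bar_T_def long_elt_ext_eq[OF X])
qed

lemma bar_case_subset: "T \<subseteq> S \<Longrightarrow> bar_T \<Phi> B S T = S - T"
proof -
  assume "T \<subseteq> S"
  then have "T - S = {}" by blast
  then show ?thesis unfolding bar_T_def by (simp only:) auto
qed

text \<open>Here bar T contains l besides \<sigma>(T - S). Admissibility of (S, bar T) leaves room
  for one root m in T - S and for coefficient 1 at l in \<mu>, and gives S = {l, l'} with
  coefficient 1 at l' too. Path roots then put l' between l and m, so l' is an interior vertex with
  coefficient 1 and the type is A.\<close>

lemma bar_case_exceptional:
  assumes n: "\<not> T \<subseteq> S" and l: "l \<in> S - T" and z: "chi \<Phi> B (T - S) (long_elt \<Phi> (B - S) l) = 0"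
  shows "\<exists>l' m. ex_cond B S T l l' m"
proof -
  let ?\<sigma> = "diag_aut \<Phi> (B - S)"
  have X: "B - S \<subseteq> B" and BX: "B - (B - S) = S" and sub: "T - S \<subseteq> B" and SB: "S \<subseteq> B"
    using SPA_subsets[OF p] by auto
  have p': "(S, bar_T \<Phi> B S T) \<in> SPA \<Phi> B" using acts_s2[OF p] by (simp add: acts_def)
  have lB: "l \<in> B" using l SB by blast
  have sB: "?\<sigma> ` (T - S) \<subseteq> B - S" using diag_aut_image_subset[OF X] SPA_subsets[OF p] by blast
  have "inj_on ?\<sigma> (T - S)" by (metis inj_onI diag_aut_diag_aut[OF X])
  then have c: "card (?\<sigma> ` (T - S)) = card (T - S)" by (rule card_image)
  have "{l} \<union> ?\<sigma> ` (T - S) \<subseteq> bar_T \<Phi> B S T" unfolding bar_T_eq using l z by auto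
  then have "chi \<Phi> B ({l} \<union> ?\<sigma> ` (T - S)) \<mu> \<le> chi \<Phi> B (bar_T \<Phi> B S T) \<mu>"
    using SPA_subsets[OF p'] by (intro chi_highest_mono)
  moreover have "chi \<Phi> B ({l} \<union> ?\<sigma> ` (T - S)) \<mu> = chi \<Phi> B {l} \<mu> + chi \<Phi> B (?\<sigma> ` (T - S)) \<mu>"
    using lB sB l by (intro chi_highest_union) auto
  moreover have "int (card (T - S)) \<le> chi \<Phi> B (?\<sigma> ` (T - S)) \<mu>"
    using card_le_chi_highest[of "?\<sigma> ` (T - S)"] sB c by auto
  moreover have l1: "chi \<Phi> B {l} \<mu> \<ge> 1" using card_le_chi_highest[of "{l}"] lB by simp
  moreover have pos: "card (T - S) \<ge> 1" using finite_ST n by (simp add: Suc_le_eq card_gt_0_iff)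
  moreover note SPA_root_values[OF p' highest_root]
  \<comment> \<open>The second coordinate at \<mu> is at least 2, and |b| + |a - b| \<le> 2 then
    forces a = b = 2.\<close>
  ultimately have card1: "card (T - S) = 1" and lm: "chi \<Phi> B {l} \<mu> = 1" and S2: "chi \<Phi> B S \<mu> = 2"
    by linarith+
  obtain m where m: "T - S = {m}" using card1 by (metis card_1_singletonE)
  have "S \<noteq> {l}" using lm S2 by auto
  then obtain l' where l': "l' \<in> S" "l' \<noteq> l" using l by blast
  have S: "S = {l, l'}"
    using card_S_le l l' finite_ST by (intro card_seteq[symmetric]) auto
  have "chi \<Phi> B ({l} \<union> {l'}) \<mu> = chi \<Phi> B {l} \<mu> + chi \<Phi> B {l'} \<mu>"
    using l l' SB by (intro chi_highest_union) auto
  then have "chi \<Phi> B {l'} \<mu> = 1" using S S2 lm by (simp add: insert_commute)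
  then have Dl': "dual {l'} \<bullet> \<mu> = 1" using chi_real[OF highest_lattice, of "{l'}"] l' SB by auto
  have mB: "m \<in> B" "m \<in> T" "m \<notin> S" using m sub by auto
  obtain q where q: "dpath q" "hd q = l" "last q = m" "l \<in> set q" "m \<in> set q"
    using path_ex[OF lB mB(1)] by blast
  \<comment> \<open>Without l' the path from l to m meets S in l only, and its sum gives w l a
    positive value on T - S.\<close>
  have l'q: "l' \<in> set q"
  proof (rule ccontr)
    assume "l' \<notin> set q"
    then have "S \<inter> set q = {l}" using S q by auto
    then have "int (card ((T - S) \<inter> set q)) \<le> chi \<Phi> B (T - S) (long_elt \<Phi> (B - S) l)"
      using long_elt_path[OF X q(1) _ sub, of l] unfolding BX by simp
    moreover have "(T - S) \<inter> set q = {m}" using m q by auto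
    ultimately show False using z by simp
  qed
  have ne: "l' \<noteq> hd q" "l' \<noteq> last q" using l' q mB by auto
  obtain q1 q2 where s: "q = q1 @ l' # q2" "q1 \<noteq> []" "q2 \<noteq> []" "dpath (l' # q2)"
    "hd q \<in> set q1" "last q \<in> set q2" "set q1 \<inter> set q2 = {}"
    using dpath_split[OF q(1) l'q ne] by metis
  have adj: "dynkin_adj (last q1) l'" "dynkin_adj l' (hd q2)"
    using q(1) s(1-3) by (auto simp: dpath_def successively_append_iff successively_Cons)
  have "last q1 \<in> B" "hd q2 \<in> B" "last q1 \<noteq> hd q2"
  proof -
    have "last q1 \<in> set q1" "hd q2 \<in> set q2" using s by auto
    then show "last q1 \<in> B" "hd q2 \<in> B" "last q1 \<noteq> hd q2" using q(1) s(1,7) by (auto simp: dpath_def)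
  qed
  then have A: "type_A B (card B)"
    using interior_coeff_1_type_A[OF _ Dl'] adj dynkin_adj_sym l' SB by blast
  have "card {l, l', m} \<le> card B" using lB l' SB mB finite_base by (intro card_mono) auto
  moreover have dist: "distinct [l, l', m]" using l l' mB by auto
  ultimately have B3: "card B \<ge> 3" by auto
  \<comment> \<open>Otherwise the part of the path from l' to m has two vertices of T but only one
    of S.\<close>
  have "l' \<notin> T"
  proof
    assume "l' \<in> T"
    then have "card {l', m} \<le> card (T \<inter> set (l' # q2))"
      using mB q s by (intro card_mono) auto
    moreover have "S \<inter> set (l' # q2) = {l'}" using S q s l' by auto
    ultimately show False using SPA_path[OF p s(4)] dist by auto
  qed
  then have T: "T = {m}" using m S l by auto
  have "dynkin_between B l l' m"
    using q l'q dist unfolding dynkin_between_def dpath_def by auto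
  then show ?thesis
    using A B3 dist S T lB l' SB mB unfolding ex_cond_def by blast
qed

lemma bar_case_generic:
  assumes "\<not> T \<subseteq> S" "\<not> (\<exists>l l' m. ex_cond B S T l l' m)"
  shows "bar_T \<Phi> B S T = diag_aut \<Phi> (B - S) ` (T - S)"
proof -
  have "\<gamma> \<notin> S - T \<or> chi \<Phi> B (T - S) (long_elt \<Phi> (B - S) \<gamma>) \<noteq> 0" for \<gamma>
    using bar_case_exceptional[OF assms(1), of \<gamma>] assms(2) by metis
  then have "{\<gamma>\<in>S - T. chi \<Phi> B (T - S) (long_elt \<Phi> (B - S) \<gamma>) = 0} = {}" by blast
  then show ?thesis unfolding bar_T_eq by (simp only: Un_empty_right)
qed

end

text \<open>Removing a vertex cuts the chain into two mutually orthogonal sides, so a root with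
  coefficient 0 at that vertex lives on one side only.\<close>

lemma type_A_split:
  assumes g: "distinct \<gamma>s" "set \<gamma>s = B" "length \<gamma>s = n"
    and c: "\<And>i j. i < n \<Longrightarrow> j < n \<Longrightarrow> cartan (\<gamma>s ! i) (\<gamma>s ! j) =
        (if i = j then 2 else if i = j + 1 \<or> j = i + 1 then -1 else 0)"
    and k: "k < n"
  defines "lo \<equiv> {\<gamma>s ! i | i. i < k}" and "hi \<equiv> {\<gamma>s ! i | i. k < i \<and> i < n}"
  shows "B - {\<gamma>s ! k} = lo \<union> hi" and "x \<in> lo \<Longrightarrow> z \<in> hi \<Longrightarrow> x \<bullet> z = 0" and "lo \<inter> hi = {}"
proof -
  have ne: "\<gamma>s ! i \<noteq> \<gamma>s ! j" if "i < n" "j < n" "i \<noteq> j" for i j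
    using that g nth_eq_iff_index_eq by blast
  have inB: "\<gamma>s ! i \<in> B" if "i < n" for i
    using nth_mem[of i \<gamma>s] that g by simp
  show "B - {\<gamma>s ! k} = lo \<union> hi"
  proof
    show "B - {\<gamma>s ! k} \<subseteq> lo \<union> hi"
    proof
      fix x assume x: "x \<in> B - {\<gamma>s ! k}"
      then obtain i where i: "i < n" "x = \<gamma>s ! i" using g by (metis DiffD1 in_set_conv_nth)
      then have "i < k \<or> k < i" using x by (metis DiffD2 insertI1 linorder_neqE_nat)
      then show "x \<in> lo \<union> hi" using i by (auto simp: lo_def hi_def)
    qed
    show "lo \<union> hi \<subseteq> B - {\<gamma>s ! k}"
    proof
      fix x assume "x \<in> lo \<union> hi"
      then consider i where "i < k" "x = \<gamma>s ! i" | i where "k < i" "i < n" "x = \<gamma>s ! i"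
        by (auto simp: lo_def hi_def)
      then obtain i where "i < n" "i \<noteq> k" "x = \<gamma>s ! i"
        by cases (use k in \<open>auto intro: less_trans\<close>)
      then show "x \<in> B - {\<gamma>s ! k}" using ne[of i k] k inB[of i] by simp
    qed
  qed
  show "x \<bullet> z = 0" if xz: "x \<in> lo" "z \<in> hi"
  proof -
    obtain i j where ij: "x = \<gamma>s ! i" "i < k" "z = \<gamma>s ! j" "k < j" "j < n"
      using xz by (auto simp: lo_def hi_def)
    then have "cartan x z = 0" using c[of i j] k by simp
    moreover have "z \<noteq> 0" using ij(3) base_nonzero[OF inB[OF ij(5)]] by simp
    ultimately show ?thesis by (simp add: cartan_def)
  qed
  have "\<gamma>s ! i \<noteq> \<gamma>s ! j" if "i < k" "k < j" "j < n" for i j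
    using ne[of i j] that k by simp
  then show "lo \<inter> hi = {}" unfolding lo_def hi_def by blast
qed

text \<open>The path from l' to m shows that w l' involves m, so l' is not in bar T. If w l involved
  m, it would be a root with coefficient 1 at l, 0 at l' and nonzero at m, although removing l'
  separates l from m.\<close>

lemma bar_case_type_A:
  assumes p: "(S, T) \<in> SPA \<Phi> B" and ex: "ex_cond B S T l l' m"
  shows "bar_T \<Phi> B S T = {diag_aut \<Phi> (B - S) m, l}"
proof -
  let ?w = "long_elt \<Phi> (B - S)"
  have d: "l \<noteq> l'" "l \<noteq> m" "l' \<noteq> m" and lB: "l \<in> B" "l' \<in> B" "m \<in> B" and S: "S = {l, l'}" and T: "T = {m}"
    using ex by (auto simp: ex_cond_def)
  obtain n where n: "type_A B n" using ex by (auto simp: ex_cond_def)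
  obtain q where q: "dpath q" "hd q = l" "last q = m" "l' \<in> set q"
    using ex by (auto simp: ex_cond_def dynkin_between_def dpath_def)
  have X: "B - S \<subseteq> B" and BX: "B - (B - S) = S" using lB S by auto
  obtain q1 q2 where s: "q = q1 @ l' # q2" "dpath (q1 @ [l'])" "dpath (l' # q2)" "l \<in> set q1"
    "m \<in> set q2" "set q1 \<inter> set q2 = {}" "q1 \<noteq> []" "q2 \<noteq> []"
    using dpath_split[OF q(1) q(4)] d q(2,3) by metis
  have TS: "T - S = {m}" "S - T = {l, l'}" using d S T by auto
  have "S \<inter> set (l' # q2) = {l'}" using S s d by auto
  then have "int (card ({m} \<inter> set (l' # q2))) \<le> chi \<Phi> B {m} (?w l')"
    using long_elt_path[OF X s(3), of l' "{m}"] lB unfolding BX by simp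
  moreover have "{m} \<inter> set (l' # q2) = {m}" using s by auto
  ultimately have nl': "chi \<Phi> B {m} (?w l') \<noteq> 0" by simp
  have zl: "chi \<Phi> B {m} (?w l) = 0"
  proof (rule ccontr)
    assume nz: "chi \<Phi> B {m} (?w l) \<noteq> 0"
    have wP: "?w l \<in> Pos" using lB S by (intro long_elt_base_Pos[OF X]) auto
    have b: "?w l \<in> \<Phi>" by (rule Pos_root[OF wP])
    have Dm: "dual {m} \<bullet> ?w l \<noteq> 0"
      using nz chi_real[OF root_lattice_root[OF b], of "{m}"] lB by auto
    have Dl: "dual {l} \<bullet> ?w l = 1" "dual {l'} \<bullet> ?w l = 0"
      using dual_long_elt[OF X, of "{l}" l] dual_long_elt[OF X, of "{l'}" l] S d lB by (auto simp: dual_base)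
    obtain \<gamma>s where g: "distinct \<gamma>s" "set \<gamma>s = B" "length \<gamma>s = n"
      and c: "\<And>i j. i < n \<Longrightarrow> j < n \<Longrightarrow> cartan (\<gamma>s ! i) (\<gamma>s ! j) =
        (if i = j then 2 else if i = j + 1 \<or> j = i + 1 then -1 else 0)"
      using n unfolding type_A_def by blast
    have split: "B - {\<gamma>s ! b} = {\<gamma>s ! i | i. i < b} \<union> {\<gamma>s ! i | i. b < i \<and> i < n}"
      "\<And>x z. x \<in> {\<gamma>s ! i | i. i < b} \<Longrightarrow> z \<in> {\<gamma>s ! i | i. b < i \<and> i < n} \<Longrightarrow> x \<bullet> z = 0"
      "{\<gamma>s ! i | i. i < b} \<inter> {\<gamma>s ! i | i. b < i \<and> i < n} = {}" if "b < n" for b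
      by (rule type_A_split[OF g _ that]; simp add: c; fail)+
    obtain i j k where ijk: "i < n" "j < n" "k < n" "l = \<gamma>s ! i" "m = \<gamma>s ! j" "l' = \<gamma>s ! k"
      using lB g by (metis in_set_conv_nth)
    \<comment> \<open>Betweenness in \<open>ex_cond\<close> is stated by a path, the type by a
      numbering. They match because a path cannot avoid a vertex whose index lies between those of
      its ends.\<close>
    have between: "\<gamma>s ! b \<in> set r"
      if r: "dpath r" "hd r = \<gamma>s ! a" "last r = \<gamma>s ! c" and abc: "a < b \<and> b < c \<or> c < b \<and> b < a"
        "a < n" "b < n" "c < n" for r a b c
    proof (rule ccontr)
      assume nb: "\<gamma>s ! b \<notin> set r"
      let ?lo = "{\<gamma>s ! i | i. i < b}" and ?hi = "{\<gamma>s ! i | i. b < i \<and> i < n}"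
      have r': "r \<noteq> []" "successively dynkin_adj r" "set r \<subseteq> B - {\<gamma>s ! b}" "last r \<in> set r"
        using r nb last_in_set[of r] by (auto simp: dpath_def)
      have sub: "set r \<subseteq> ?lo \<union> ?hi" "set r \<subseteq> ?hi \<union> ?lo" using r'(3) split(1)[OF abc(3)] by auto
      from abc(1) show False
      proof
        assume h: "a < b \<and> b < c"
        then have "hd r \<in> ?lo" using r(2) by auto
        then have "set r \<subseteq> ?lo" using dpath_stays[OF r'(2,1) _ sub(1)] split(2)[OF abc(3)] by blast
        moreover have "last r \<in> ?hi" using r(3) h abc by auto
        ultimately show False using r'(4) split(3)[OF abc(3)] by blast
      next
        assume h: "c < b \<and> b < a"
        then have "hd r \<in> ?hi" using r(2) abc by auto
        moreover have "x \<bullet> z = 0" if "x \<in> ?hi" "z \<in> ?lo" for x z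
          using split(2)[OF abc(3) that(2,1)] by (simp add: inner_commute)
        ultimately have "set r \<subseteq> ?hi" using dpath_stays[OF r'(2,1) _ sub(2)] by blast
        moreover have "last r \<in> ?lo" using r(3) h abc by auto
        ultimately show False using r'(4) split(3)[OF abc(3)] by blast
      qed
    qed
    have neq: "i \<noteq> j" "i \<noteq> k" "j \<noteq> k" using d ijk by auto
    \<comment> \<open>The part of q from l to l' misses m, and the part from l' to m misses l, so
      neither m nor l has the middle index; that leaves l'.\<close>
    have "\<not> (i < j \<and> j < k \<or> k < j \<and> j < i)"
    proof
      assume "i < j \<and> j < k \<or> k < j \<and> j < i"
      then have "m \<in> set (q1 @ [l'])"
        using between[of "q1 @ [l']" i k j] s q(2) ijk by simp
      then show False using s d by auto
    qed
    moreover have "\<not> (k < i \<and> i < j \<or> j < i \<and> i < k)"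
    proof
      assume "k < i \<and> i < j \<or> j < i \<and> i < k"
      then have "l \<in> set (l' # q2)"
        using between[of "l' # q2" k j i] s q(3) ijk by simp
      then show False using s d by auto
    qed
    ultimately have ord: "i < k \<and> k < j \<or> j < k \<and> k < i" using neq by linarith
    let ?lo = "{\<gamma>s ! i | i. i < k}" and ?hi = "{\<gamma>s ! i | i. k < i \<and> i < n}"
    have Y: "B - {l'} \<subseteq> B" by blast
    interpret sub: based_roots "\<Phi> \<inter> span (B - {l'})" "B - {l'}" by (rule sub_based_roots[OF Y])
    \<comment> \<open>As a root of the subsystem with base B - {l'}, w l lies in the span of one
      side, and each side lacks l or m.\<close>
    have "?w l \<in> span (B - {l'})" using Dl(2) by (intro span_subI[OF root_span[OF b] Y]) auto
    then have "?w l \<in> span ?lo \<or> ?w l \<in> span ?hi"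
      using b split(2)[OF ijk(3)] by (intro sub.root_orthogonal_split[of ?lo ?hi] split(1)[OF ijk(3), folded ijk(6)]) auto
    moreover have loB: "?lo \<subseteq> B" "?hi \<subseteq> B" using split(1)[OF ijk(3)] by blast+
    have "?w l \<notin> span Z" if Z: "Z \<subseteq> B" "l \<notin> Z \<or> m \<notin> Z" for Z
      using dual_span_zero[of "?w l" Z "{l}"] dual_span_zero[of "?w l" Z "{m}"] Z Dl Dm by auto
    moreover have "l \<notin> ?lo \<or> m \<notin> ?lo" "l \<notin> ?hi \<or> m \<notin> ?hi"
    proof -
      have "(l \<in> ?lo \<and> m \<in> ?hi) \<or> (m \<in> ?lo \<and> l \<in> ?hi)" using ord ijk by auto
      then show "l \<notin> ?lo \<or> m \<notin> ?lo" "l \<notin> ?hi \<or> m \<notin> ?hi" using split(3)[OF ijk(3)] by blast+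
    qed
    ultimately show False using loB by blast
  qed
  show ?thesis unfolding bar_T_eq[OF p] TS using nl' zl by auto
qed

end

theorem theorem8p3p2:
  fixes \<Sigma> B S T :: "'a::euclidean_space set" and \<mu>\<^sub>p :: 'a
  assumes "root_system \<Sigma>" and "reduced_roots \<Sigma>" and "irreducible_roots \<Sigma>"
    and "is_base \<Sigma> B" and "highest_root \<Sigma> B \<mu>\<^sub>p"
    and "(S, T) \<in> SPA \<Sigma> B"
  shows
    "BC2_weyl = {id, uminus, BC2_s1, uminus \<circ> BC2_s1, BC2_s2, uminus \<circ> BC2_s2,
        BC2_s2 \<circ> BC2_s1, uminus \<circ> (BC2_s2 \<circ> BC2_s1)}
     \<and> SPA_act \<Sigma> B id (S, T) = (S, T)
     \<and> SPA_act \<Sigma> B BC2_s1 (S, T) = (breve_S \<Sigma> B S T, T)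
     \<and> SPA_act \<Sigma> B BC2_s2 (S, T) = (S, bar_T \<Sigma> B S T)
     \<and> SPA_act \<Sigma> B (BC2_s2 \<circ> BC2_s1) (S, T) =
         (breve_S \<Sigma> B S T, base_act B (bar_T \<Sigma> B S T) (diag_aut \<Sigma> B))
     \<and> SPA_act \<Sigma> B uminus (S, T) =
         (base_act B S (diag_aut \<Sigma> B), base_act B T (diag_aut \<Sigma> B))
     \<and> SPA_act \<Sigma> B (uminus \<circ> BC2_s1) (S, T) =
         (base_act B (breve_S \<Sigma> B S T) (diag_aut \<Sigma> B), base_act B T (diag_aut \<Sigma> B))
     \<and> SPA_act \<Sigma> B (uminus \<circ> BC2_s2) (S, T) =
         (base_act B S (diag_aut \<Sigma> B), base_act B (bar_T \<Sigma> B S T) (diag_aut \<Sigma> B))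
     \<and> SPA_act \<Sigma> B (uminus \<circ> (BC2_s2 \<circ> BC2_s1)) (S, T) =
         (base_act B (breve_S \<Sigma> B S T) (diag_aut \<Sigma> B), bar_T \<Sigma> B S T)
     \<and> chi \<Sigma> B (S - T) \<mu>\<^sub>p \<in> {0, 1, 2}
     \<and> (chi \<Sigma> B (S - T) \<mu>\<^sub>p = 0 \<longrightarrow> breve_S \<Sigma> B S T = S)
     \<and> (chi \<Sigma> B (S - T) \<mu>\<^sub>p = 1 \<longrightarrow>
          breve_S \<Sigma> B S T = diag_aut \<Sigma> (B - T) ` (S - T) \<union> (T - S))
     \<and> (chi \<Sigma> B (S - T) \<mu>\<^sub>p = 2 \<longrightarrow>
          breve_S \<Sigma> B S T = diag_aut \<Sigma> (B - T) ` (S - T))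
     \<and> (T \<subseteq> S \<longrightarrow> bar_T \<Sigma> B S T = S - T)
     \<and> (\<forall>l l' m. ex_cond B S T l l' m \<longrightarrow> bar_T \<Sigma> B S T = {diag_aut \<Sigma> (B - S) m, l})
     \<and> (\<not> T \<subseteq> S \<and> \<not> (\<exists>l l' m. ex_cond B S T l l' m) \<longrightarrow>
          bar_T \<Sigma> B S T = diag_aut \<Sigma> (B - S) ` (T - S))"
proof -
  interpret irreducible_based_roots \<Sigma> B \<mu>\<^sub>p
    using assms(1-5) by unfold_locales
  note p = assms(6)
  show ?thesis
    apply (intro conjI allI impI)
                   apply (rule BC2_weyl_eq)
                  apply (rule SPA_act_formulas[OF p])+
          apply (rule chi_diff_highest[OF p])
         apply (erule breve_case_0[OF p])
        apply (erule breve_case_1[OF p])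
       apply (erule breve_case_2[OF p])
      apply (erule bar_case_subset[OF p])
     apply (erule bar_case_type_A[OF p])
    apply (elim conjE, erule (1) bar_case_generic[OF p])
    done
qed

end
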